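(* Let $d\geq 2$ be a fixed integer and let $k=k(n)$ be a positive integer with $k\leq O(\log n)$. Let $m=m(n)$. If $d$ is odd, then $$p_1=\frac{(\log (mn))^{1/d}}{m^{(d-1)/(2d)}\,n^{(d-1)/(2d)}}$$ is a sharp threshold function for the property $rc_k(G(m,n,p))\leq d+1$, where $m$ and $n$ satisfy $p_1 n\geq p_1 m\geq (\log n)^4$. If $d$ is even, then $$p_2=\frac{(\log n)^{1/d}}{m^{1/2}\,n^{(d-2)/(2d)}}$$ is a sharp threshold function for the property $rc_k(G(m,n,p))\leq d+1$, where $m$ and $n$ satisfy that there exists a small constant $\epsilon$ with $0<\epsilon<1$ such that $p_2 n^{1-\epsilon}\geq p_2 m^{1-\epsilon}\geq (\log n)^4$.
   Context: All graphs are finite, simple and undirected. A path in an edge-colored graph is a rainbow path if no two of its edges have the same color. For an integer $k\geq 1$, the rainbow $k$-connectivity $rc_k(G)$ of a graph $G$ is the minimum number of colors in an edge-coloring of $G$ such that every pair of distinct vertices is connected by at least $k$ internally vertex-disjoint rainbow paths. $G(m,n,p)$ denotes the random bipartite graph with bipartition $(U,V)$, $|U|=m$, $|V|=n$, in which each edge $uv$ with $u\in U$, $v\in V$ is present independently with probability $p$. An event happens almost surely if its probability tends to $1$ as $n\to\infty$. A function $p^*(n)$ is a sharp threshold function for a property $\mathcal{P}$ if there are positive constants $c,C$ such that for every $p(n)\leq c\,p^*(n)$, $G(m,n,p(n))$ almost surely does not satisfy $\mathcal{P}$, and for every $p'(n)\geq C\,p^*(n)$, $G(m,n,p'(n))$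 almost surely satisfies $\mathcal{P}$. Here $\log$ denotes the logarithm to base $2$; asymptotic notation is as $n\to\infty$. *)

theory Defs
  imports Complex_Main "HOL-Library.Extended_Nat"
begin

text \<open>Random bipartite graph G(m,n,p): vertex set Inl ` {..<m} (part U) and Inr ` {..<n}
  (part V); an edge set is a subset of {..<m} \<times> {..<n}, the pair (i,j) standing for the
  edge between Inl i and Inr j.\<close>

definition bip_verts :: "nat \<Rightarrow> nat \<Rightarrow> (nat + nat) set" where
  "bip_verts m n = Inl ` {..<m} \<union> Inr ` {..<n}"

definition bip_adj :: "(nat \<times> nat) set \<Rightarrow> nat + nat \<Rightarrow> nat + nat \<Rightarrow> bool" where
  "bip_adj E x y = (case (x, y) of
      (Inl i, Inr j) \<Rightarrow> (i, j) \<in> E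
    | (Inr j, Inl i) \<Rightarrow> (i, j) \<in> E
    | _ \<Rightarrow> False)"

definition edge_col :: "(nat \<times> nat \<Rightarrow> nat) \<Rightarrow> nat + nat \<Rightarrow> nat + nat \<Rightarrow> nat" where
  "edge_col c x y = (case (x, y) of
      (Inl i, Inr j) \<Rightarrow> c (i, j)
    | (Inr j, Inl i) \<Rightarrow> c (i, j)
    | _ \<Rightarrow> 0)"

definition is_path :: "(nat \<times> nat) set \<Rightarrow> (nat + nat) list \<Rightarrow> nat + nat \<Rightarrow> nat + nat \<Rightarrow> bool" where
  "is_path E xs u v \<longleftrightarrow> 2 \<le> length xs \<and> hd xs = u \<and> last xs = v \<and> distinct xs \<and>
     (\<forall>i. Suc i < length xs \<longrightarrow> bip_adj E (xs ! i) (xs ! Suc i))"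

definition rainbow :: "(nat \<times> nat \<Rightarrow> nat) \<Rightarrow> (nat + nat) list \<Rightarrow> bool" where
  "rainbow c xs \<longleftrightarrow> distinct (map (\<lambda>i. edge_col c (xs ! i) (xs ! Suc i)) [0..<length xs - 1])"

definition interior :: "(nat + nat) list \<Rightarrow> (nat + nat) set" where
  "interior xs = set (butlast (tl xs))"

definition rainbow_k_colouring ::
  "nat \<Rightarrow> nat \<Rightarrow> (nat \<times> nat) set \<Rightarrow> nat \<Rightarrow> nat \<Rightarrow> (nat \<times> nat \<Rightarrow> nat) \<Rightarrow> bool" where
  "rainbow_k_colouring m n E k r c \<longleftrightarrow>
     (\<forall>e\<in>E. c e < r) \<and>
     (\<forall>u\<in>bip_verts m n. \<forall>v\<in>bip_verts m n. u \<noteq> v \<longrightarrow>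
        (\<exists>P :: nat \<Rightarrow> (nat + nat) list.
           (\<forall>i<k. is_path E (P i) u v \<and> rainbow c (P i)) \<and>
           (\<forall>i<k. \<forall>j<k. i \<noteq> j \<longrightarrow> P i \<noteq> P j \<and> interior (P i) \<inter> interior (P j) = {})))"

text \<open>Rainbow k-connectivity; \<infinity> if no such colouring exists.\<close>
definition rc :: "nat \<Rightarrow> nat \<Rightarrow> nat \<Rightarrow> (nat \<times> nat) set \<Rightarrow> enat" where
  "rc m n k E = (INF r \<in> {r. \<exists>c. rainbow_k_colouring m n E k r c}. enat r)"

definition rb_prob :: "nat \<Rightarrow> nat \<Rightarrow> real \<Rightarrow> ((nat \<times> nat) set \<Rightarrow> bool) \<Rightarrow> real" where
  "rb_prob m n p Q = (\<Sum>E \<in> Pow ({..<m} \<times> {..<n}).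
       if Q E then p ^ card E * (1 - p) ^ (m * n - card E) else 0)"

definition sharp_threshold ::
  "(nat \<Rightarrow> nat) \<Rightarrow> (nat \<Rightarrow> (nat \<times> nat) set \<Rightarrow> bool) \<Rightarrow> (nat \<Rightarrow> real) \<Rightarrow> bool" where
  "sharp_threshold m Q ps \<longleftrightarrow>
     (\<exists>c>0. \<exists>C>0.
        (\<forall>p. (\<forall>n. 0 \<le> p n \<and> p n \<le> 1) \<and> (\<forall>\<^sub>F n in sequentially. p n \<le> c * ps n) \<longrightarrow>
              (\<lambda>n. rb_prob (m n) n (p n) (Q n)) \<longlonglongrightarrow> 0) \<and>
        (\<forall>p. (\<forall>n. 0 \<le> p n \<and> p n \<le> 1) \<and> (\<forall>\<^sub>F n in sequentially. C * ps n \<le> p n) \<longrightarrow>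
              (\<lambda>n. rb_prob (m n) n (p n) (Q n)) \<longlonglongrightarrow> 1))"

end

theory Submission
  imports (* Defs comes last so that \<open>interior\<close> is the interior of a path *)
    "HOL-Analysis.Harmonic_Numbers" "HOL-Real_Asymp.Real_Asymp" "HOL-Library.FuncSet"
    "HOL-Library.Disjoint_Sets" Defs
begin

text \<open>
  Put \<open>a = d div 2\<close>, \<open>b = (d - 1) div 2\<close>. Both thresholds say that \<open>p^d m^a n^b\<close>, the expected
  number of paths of length \<open>d\<close> ending at two given vertices (of opposite sides for odd \<open>d\<close>, both
  in \<open>V\<close> for even \<open>d\<close>), has order \<open>log n\<close>. By parity, a path with at most \<open>d + 1\<close> edges
  between such vertices has at most \<open>d\<close> edges.

  Below the threshold, delete a set \<open>W\<close> of \<open>n^\<delta>\<close> vertices of \<open>V\<close>. In the remaining graph all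
  degrees are bounded, so the set \<open>D\<close> of vertices of \<open>U\<close> at distance less than \<open>d\<close> from a fixed
  vertex has at most \<open>\<epsilon> (log n) / p\<close> elements. The neighbourhoods of the vertices of \<open>W\<close> are
  independent, and each misses \<open>D\<close> with probability \<open>n^(-O(\<epsilon>))\<close>, so some vertex of \<open>W\<close> is not
  reached; short detours through a second vertex of \<open>W\<close> are excluded by the union bound.

  Above the threshold, colour the edges at random with \<open>d + 1\<close> colours. For given \<open>x\<close>, \<open>y\<close> fix
  disjoint layers between them and keep only edges of colour \<open>i\<close> between layers \<open>i\<close> and \<open>i + 1\<close>;
  this is a thinning of the edges by the factor \<open>1/(d + 1)\<close>, and every layered path is rainbow.
  Exposing the layers one at a time, grow disjoint trees rooted at polylogarithmically many
  neighbours of \<open>x\<close>, with a large multiple of \<open>(log n) / p\<close> leaves altogether. Trees that contain a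
  neighbour of \<open>y\<close> yield internally disjoint rainbow paths, and an exponential moment bound shows
  that fewer than \<open>k\<close> trees are hit with probability less than \<open>n^(-3)\<close>, which suffices for the
  union bound over all pairs.
\<close>

section \<open>Random subsets and random colourings\<close>

text \<open>The expectation of \<open>f\<close> at a random subset of \<open>S\<close> that contains
  each element independently with probability \<open>p\<close>. Being a finite sum, it can be
  nested, so exposing edges in stages becomes an equation between real numbers. Probabilities are
  expectations of \<open>of_bool\<close>.\<close>

definition bern :: "'a set \<Rightarrow> real \<Rightarrow> ('a set \<Rightarrow> real) \<Rightarrow> real" where
  "bern S p f = (\<Sum>A\<in>Pow S. p ^ card A * (1 - p) ^ (card S - card A) * f A)"

lemma of_bool_mono: "(P \<Longrightarrow> Q) \<Longrightarrow> of_bool P \<le> (of_bool Q :: real)"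
  by (cases P) auto

lemma rb_prob_eq_bern: "rb_prob m n p Q = bern ({..<m} \<times> {..<n}) p (\<lambda>E. of_bool (Q E))"
  unfolding rb_prob_def bern_def by (intro sum.cong) (auto simp: card_cartesian_product)

lemma bern_empty [simp]: "bern {} p f = f {}"
  by (simp add: bern_def)

text \<open>Conditions on whether \<open>e\<close> is chosen. This recursion drives the inductions
  on \<open>S\<close> that follow.\<close>

lemma bern_insert:
  assumes "finite S" "e \<notin> S"
  shows "bern (insert e S) p f = p * bern S p (\<lambda>A. f (insert e A)) + (1 - p) * bern S p f"
proof -
  have disj: "Pow S \<inter> insert e ` Pow S = {}" using assms by auto
  have inj: "inj_on (insert e) (Pow S)" using assms by (auto simp: inj_on_def)
  have fin: "finite A" "e \<notin> A" "card A \<le> card S" if "A \<subseteq> S" for A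
    using that assms by (auto intro: finite_subset card_mono)
  have "(\<Sum>A\<in>insert e ` Pow S. p ^ card A * (1 - p) ^ (card (insert e S) - card A) * f A)
      = (\<Sum>A\<in>Pow S. p * (p ^ card A * (1 - p) ^ (card S - card A) * f (insert e A)))"
    unfolding sum.reindex[OF inj] o_def
    by (intro sum.cong refl) (use fin assms in auto)
  moreover have "(\<Sum>A\<in>Pow S. p ^ card A * (1 - p) ^ (card (insert e S) - card A) * f A)
      = (\<Sum>A\<in>Pow S. (1 - p) * (p ^ card A * (1 - p) ^ (card S - card A) * f A))"
    by (intro sum.cong refl) (use fin assms in \<open>auto simp: Suc_diff_le\<close>)
  ultimately show ?thesis
    unfolding bern_def Pow_insert
    using assms disj by (subst sum.union_disjoint) (auto simp: sum_distrib_left)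
qed

lemma bern_cong:
  assumes "\<And>A. A \<subseteq> S \<Longrightarrow> f A = g A"
  shows "bern S p f = bern S p g"
  unfolding bern_def by (intro sum.cong refl) (use assms in auto)

lemma bern_mono:
  assumes "0 \<le> p" "p \<le> 1" "\<And>A. A \<subseteq> S \<Longrightarrow> f A \<le> g A"
  shows "bern S p f \<le> bern S p g"
  unfolding bern_def by (intro sum_mono mult_left_mono) (use assms in auto)

lemma bern_add: "bern S p (\<lambda>A. f A + g A) = bern S p f + bern S p g"
  by (simp add: bern_def algebra_simps sum.distrib)

lemma bern_cmult: "bern S p (\<lambda>A. c * f A) = c * bern S p f"
  by (simp add: bern_def algebra_simps sum_distrib_left)

lemma bern_divide: "bern S p (\<lambda>A. f A / c) = bern S p f / c"
  by (simp add: bern_def sum_divide_distrib)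

lemma bern_diff: "bern S p (\<lambda>A. f A - g A) = bern S p f - bern S p g"
  by (simp add: bern_def algebra_simps sum_subtractf)

lemma bern_sum: "bern S p (\<lambda>A. \<Sum>i\<in>I. f i A) = (\<Sum>i\<in>I. bern S p (f i))"
  unfolding bern_def by (simp add: sum_distrib_left sum.swap[of _ I])

lemma bern_const [simp]: "finite S \<Longrightarrow> bern S p (\<lambda>_. c) = c"
  by (induction S rule: finite_induct) (auto simp: bern_insert algebra_simps)

lemma bern_nonneg:
  assumes "0 \<le> p" "p \<le> 1" "\<And>A. A \<subseteq> S \<Longrightarrow> 0 \<le> f A"
  shows "0 \<le> bern S p f"
  unfolding bern_def by (intro sum_nonneg) (use assms in auto)

lemma bern_le_const:
  assumes "finite S" "0 \<le> p" "p \<le> 1" "\<And>A. A \<subseteq> S \<Longrightarrow> f A \<le> c"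
  shows "bern S p f \<le> c"
  using bern_mono[OF assms(2,3), of S f "\<lambda>_. c"] assms by simp

text \<open>Exposure in two independent stages. In the applications the inner expectation is bounded
  for each fixed outcome of the first stage.\<close>

lemma bern_Un:
  assumes "finite S" "finite T" "S \<inter> T = {}"
  shows "bern (S \<union> T) p f = bern S p (\<lambda>A. bern T p (\<lambda>B. f (A \<union> B)))"
  using assms
proof (induction S arbitrary: f rule: finite_induct)
  case (insert e S)
  have "bern (insert e S \<union> T) p f = bern (insert e (S \<union> T)) p f" by simp
  also have "\<dots> = p * bern (S \<union> T) p (\<lambda>A. f (insert e A)) + (1 - p) * bern (S \<union> T) p f"
    using insert by (subst bern_insert) auto
  finally show ?case using insert by (simp add: bern_insert)
qed simp

lemma bern_image:
  assumes "finite S" "inj_on g S"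
  shows "bern (g ` S) p f = bern S p (\<lambda>A. f (g ` A))"
  using assms
proof (induction S arbitrary: f rule: finite_induct)
  case (insert e S)
  then have "g e \<notin> g ` S" by (auto simp: inj_on_def)
  then show ?case using insert by (simp add: bern_insert)
qed simp

text \<open>The marginal distribution on \<open>T\<close>: the coordinates outside \<open>T\<close>
  integrate to one.\<close>

lemma bern_restrict:
  assumes "finite S" "T \<subseteq> S"
  shows "bern S p (\<lambda>A. f (A \<inter> T)) = bern T p f"
proof -
  have fin: "finite T" using assms finite_subset by auto
  have S: "S = T \<union> (S - T)" using assms by auto
  have "bern S p (\<lambda>A. f (A \<inter> T)) = bern T p (\<lambda>A. bern (S - T) p (\<lambda>B. f ((A \<union> B) \<inter> T)))"
    by (subst S, subst bern_Un) (use assms fin in auto)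
  also have "\<dots> = bern T p (\<lambda>A. bern (S - T) p (\<lambda>B. f A))"
  proof (intro bern_cong)
    fix A B assume "A \<subseteq> T" "B \<subseteq> S - T"
    then have "(A \<union> B) \<inter> T = A" by auto
    then show "f ((A \<union> B) \<inter> T) = f A" by simp
  qed
  finally show ?thesis using assms by simp
qed

text \<open>Replaces a coupling of the two random sets. For increasing \<open>f\<close> the branch
  that contains \<open>e\<close> is the larger one, so moving weight to it cannot decrease the
  expectation; the two branches themselves are compared by induction.\<close>

lemma bern_mono_p:
  assumes "finite S" "0 \<le> p" "p \<le> p'" "p' \<le> 1"
    and "\<And>A B. A \<subseteq> B \<Longrightarrow> B \<subseteq> S \<Longrightarrow> f A \<le> f B"
  shows "bern S p f \<le> bern S p' f"
  using assms(1,5)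
proof (induction S arbitrary: f rule: finite_induct)
  case (insert e S)
  let ?g = "\<lambda>A. f (insert e A)"
  have fg: "bern S p f \<le> bern S p ?g"
    by (intro bern_mono insert.prems) (use assms in auto)
  have 1: "bern S p ?g \<le> bern S p' ?g"
    by (intro insert.IH insert.prems) auto
  have 2: "bern S p f \<le> bern S p' f"
    by (intro insert.IH insert.prems) auto
  have "p * bern S p ?g + (1 - p) * bern S p f \<le> p' * bern S p ?g + (1 - p') * bern S p f"
    using mult_nonneg_nonneg[of "p' - p" "bern S p ?g - bern S p f"] fg assms(3)
    by (simp add: algebra_simps)
  also have "\<dots> \<le> p' * bern S p' ?g + (1 - p') * bern S p' f"
    by (intro add_mono mult_left_mono) (use 1 2 assms in auto)
  finally show ?case using insert by (simp add: bern_insert)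
qed simp

lemma bern_prod_Union:
  assumes "finite J" "\<And>j. j \<in> J \<Longrightarrow> finite (F j)" "disjoint_family_on F J"
  shows "bern (\<Union>j\<in>J. F j) p (\<lambda>A. \<Prod>j\<in>J. \<phi> j (A \<inter> F j)) = (\<Prod>j\<in>J. bern (F j) p (\<phi> j))"
  using assms
proof (induction J rule: finite_induct)
  case (insert i J)
  have disj: "F i \<inter> F j = {}" if "j \<in> J" for j
    using insert.prems(2) insert.hyps that by (auto simp: disjoint_family_on_def)
  have "bern (\<Union>j\<in>insert i J. F j) p (\<lambda>A. \<Prod>j\<in>insert i J. \<phi> j (A \<inter> F j))
     = bern (F i \<union> (\<Union>j\<in>J. F j)) p (\<lambda>A. \<phi> i (A \<inter> F i) * (\<Prod>j\<in>J. \<phi> j (A \<inter> F j)))"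
    using insert.hyps by simp
  also have "\<dots> = bern (F i) p (\<lambda>A. bern (\<Union>j\<in>J. F j) p
      (\<lambda>B. \<phi> i ((A \<union> B) \<inter> F i) * (\<Prod>j\<in>J. \<phi> j ((A \<union> B) \<inter> F j))))"
    by (subst bern_Un) (use insert disj in auto)
  also have "\<dots> = bern (F i) p (\<lambda>A. bern (\<Union>j\<in>J. F j) p
      (\<lambda>B. \<phi> i A * (\<Prod>j\<in>J. \<phi> j (B \<inter> F j))))"
  proof (intro bern_cong)
    fix A B assume AB: "A \<subseteq> F i" "B \<subseteq> (\<Union>j\<in>J. F j)"
    then have "(A \<union> B) \<inter> F i = A" using disj by fastforce
    moreover have "(A \<union> B) \<inter> F j = B \<inter> F j" if "j \<in> J" for j using disj[OF that] AB by auto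
    ultimately show "\<phi> i ((A \<union> B) \<inter> F i) * (\<Prod>j\<in>J. \<phi> j ((A \<union> B) \<inter> F j))
      = \<phi> i A * (\<Prod>j\<in>J. \<phi> j (B \<inter> F j))" by simp
  qed
  also have "\<dots> = bern (F i) p (\<lambda>A. (\<Prod>j\<in>J. bern (F j) p (\<phi> j)) * \<phi> i A)"
  proof -
    have "disjoint_family_on F J"
      using insert.prems(2) by (auto simp: disjoint_family_on_def)
    then show ?thesis using insert by (simp add: bern_cmult mult.commute)
  qed
  finally show ?case using insert.hyps by (simp add: bern_cmult)
qed simp

lemma bern_prod:
  assumes "finite S" "finite J" "\<And>j. j \<in> J \<Longrightarrow> F j \<subseteq> S" "disjoint_family_on F J"
  shows "bern S p (\<lambda>A. \<Prod>j\<in>J. \<phi> j (A \<inter> F j)) = (\<Prod>j\<in>J. bern (F j) p (\<phi> j))"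
proof -
  let ?T = "\<Union>j\<in>J. F j"
  have "(\<Prod>j\<in>J. \<phi> j (A \<inter> F j)) = (\<Prod>j\<in>J. \<phi> j ((A \<inter> ?T) \<inter> F j))" for A
    by (intro prod.cong refl arg_cong[where f="\<phi> _"]) auto
  then have "bern S p (\<lambda>A. \<Prod>j\<in>J. \<phi> j (A \<inter> F j))
    = bern S p (\<lambda>A. \<Prod>j\<in>J. \<phi> j ((A \<inter> ?T) \<inter> F j))" by simp
  also have "\<dots> = bern ?T p (\<lambda>A. \<Prod>j\<in>J. \<phi> j (A \<inter> F j))"
    using assms by (intro bern_restrict) auto
  also have "\<dots> = (\<Prod>j\<in>J. bern (F j) p (\<phi> j))"
    using assms by (intro bern_prod_Union) (auto intro: finite_subset)
  finally show ?thesis .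
qed

section \<open>Exponential moments and tail bounds\<close>

lemma bern_avoid: "finite F \<Longrightarrow> bern F p (\<lambda>A. of_bool (A = {})) = (1 - p) ^ card F"
proof (induction F rule: finite_induct)
  case (insert e F)
  then show ?case by (simp add: bern_insert)
qed simp

text \<open>Generating function of the number of disjoint blocks that are hit: block
  \<open>j\<close> contributes the independent factor \<open>z\<close> if it is hit and
  \<open>1\<close> if it is missed, that is
  \<open>z + (1 - z) * of_bool (A \<inter> F j = {})\<close>.\<close>

lemma bern_hits:
  fixes z :: real
  assumes "finite S" "finite J" "\<And>j. j \<in> J \<Longrightarrow> F j \<subseteq> S" "disjoint_family_on F J"
  shows "bern S p (\<lambda>A. z ^ card {j \<in> J. A \<inter> F j \<noteq> {}})
       = (\<Prod>j\<in>J. z + (1 - z) * (1 - p) ^ card (F j))"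
proof -
  have fin: "finite (F j)" if "j \<in> J" for j using assms(1) assms(3)[OF that] finite_subset by blast
  have "z ^ card {j \<in> J. A \<inter> F j \<noteq> {}} = (\<Prod>j\<in>J. z + (1 - z) * of_bool (A \<inter> F j = {}))" for A
  proof -
    have "z ^ card {j \<in> J. A \<inter> F j \<noteq> {}} = (\<Prod>j\<in>{j \<in> J. A \<inter> F j \<noteq> {}}. z)" by simp
    also have "\<dots> = (\<Prod>j\<in>J. if A \<inter> F j \<noteq> {} then z else 1)"
      using assms(2) by (subst prod.inter_filter) auto
    also have "\<dots> = (\<Prod>j\<in>J. z + (1 - z) * of_bool (A \<inter> F j = {}))"
      by (intro prod.cong) auto
    finally show ?thesis .
  qed
  then have "bern S p (\<lambda>A. z ^ card {j \<in> J. A \<inter> F j \<noteq> {}})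
    = bern S p (\<lambda>A. \<Prod>j\<in>J. z + (1 - z) * of_bool (A \<inter> F j = {}))" by simp
  also have "\<dots> = (\<Prod>j\<in>J. bern (F j) p (\<lambda>A. z + (1 - z) * of_bool (A = {})))"
    by (rule bern_prod[OF assms])
  also have "\<dots> = (\<Prod>j\<in>J. z + (1 - z) * (1 - p) ^ card (F j))"
    by (intro prod.cong refl) (simp add: bern_add bern_cmult bern_avoid fin)
  finally show ?thesis .
qed

text \<open>Markov's inequality for the generating function at \<open>z = 1/2\<close>: fewer than
  \<open>k\<close> hits force \<open>1 \<le> 2 ^ k * (1/2) ^ hits\<close>. Blocks with at least
  \<open>s\<close> elements are missed with probability at most \<open>(1 - p) ^ s\<close>.\<close>

lemma hits_lower_tail:
  assumes "finite S" "finite J" "\<And>j. j \<in> J \<Longrightarrow> F j \<subseteq> S" "disjoint_family_on F J"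
    and "\<And>j. j \<in> J \<Longrightarrow> s \<le> card (F j)" "0 \<le> p" "p \<le> 1"
  shows "bern S p (\<lambda>A. of_bool (card {j \<in> J. A \<inter> F j \<noteq> {}} < k))
       \<le> 2 ^ k * ((1 + (1 - p) ^ s) / 2) ^ card J"
proof -
  have "bern S p (\<lambda>A. of_bool (card {j \<in> J. A \<inter> F j \<noteq> {}} < k))
      \<le> bern S p (\<lambda>A. 2 ^ k * (1/2) ^ card {j \<in> J. A \<inter> F j \<noteq> {}})"
  proof (intro bern_mono assms)
    fix A
    have "(2::real) ^ card {j \<in> J. A \<inter> F j \<noteq> {}} \<le> 2 ^ k" if "card {j \<in> J. A \<inter> F j \<noteq> {}} < k"
      using that by (intro power_increasing) auto
    then show "of_bool (card {j \<in> J. A \<inter> F j \<noteq> {}} < k)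
      \<le> (2::real) ^ k * (1/2) ^ card {j \<in> J. A \<inter> F j \<noteq> {}}"
      by (auto simp: of_bool_def power_divide field_simps)
  qed
  also have "\<dots> = 2 ^ k * (\<Prod>j\<in>J. 1/2 + (1 - 1/2) * (1 - p) ^ card (F j))"
    by (simp only: bern_cmult bern_hits[OF assms(1-4)])
  also have "\<dots> \<le> 2 ^ k * (\<Prod>j\<in>J. (1 + (1 - p) ^ s) / 2)"
  proof (intro mult_left_mono prod_mono conjI)
    fix j assume "j \<in> J"
    then have "(1 - p) ^ card (F j) \<le> (1 - p) ^ s" using assms by (intro power_decreasing) auto
    then show "1/2 + (1 - 1/2) * (1 - p) ^ card (F j) \<le> (1 + (1 - p) ^ s) / 2" by simp
  qed (use assms in auto)
  finally show ?thesis by simp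
qed

lemma card_lower_tail:
  assumes "finite S" "R \<subseteq> S" "0 \<le> p" "p \<le> 1"
  shows "bern S p (\<lambda>A. of_bool (card (A \<inter> R) < k)) \<le> 2 ^ k * (1 - p / 2) ^ card R"
proof -
  have "{j \<in> R. A \<inter> {j} \<noteq> {}} = A \<inter> R" for A by auto
  moreover have "(1 + (1 - p) ^ 1) / 2 = 1 - p / 2" by (simp add: field_simps)
  moreover have "finite R" using assms finite_subset by auto
  ultimately show ?thesis
    using hits_lower_tail[of S R "\<lambda>j. {j}" 1 p k] assms(1,3,4) subsetD[OF assms(2)]
    by (simp only: disjoint_family_on_def) auto
qed

text \<open>The same method at \<open>z = 2\<close> with singleton blocks, followed by
  \<open>1 + p \<le> exp p\<close>.\<close>

lemma card_upper_tail:
  assumes "finite S" "R \<subseteq> S" "0 \<le> p" "p \<le> 1"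
  shows "bern S p (\<lambda>A. of_bool (t < real (card (A \<inter> R)))) \<le> exp (p * card R) * 2 powr (- t)"
proof -
  have eq: "{j \<in> R. j \<in> A} = A \<inter> R" for A by auto
  have finR: "finite R" using assms finite_subset by auto
  have "bern S p (\<lambda>A. of_bool (t < real (card (A \<inter> R))))
     \<le> bern S p (\<lambda>A. 2 powr (- t) * 2 ^ card (A \<inter> R))"
  proof (intro bern_mono assms)
    fix A
    have "1 \<le> (2::real) powr (- t) * 2 ^ card (A \<inter> R)" if "t < real (card (A \<inter> R))"
    proof -
      have "(1::real) \<le> 2 powr (- t + real (card (A \<inter> R)))" using that by (intro ge_one_powr_ge_zero) auto
      then show ?thesis unfolding powr_add by (simp add: powr_realpow)
    qed
    then show "of_bool (t < real (card (A \<inter> R))) \<le> (2::real) powr (- t) * 2 ^ card (A \<inter> R)"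
      by (auto simp: of_bool_def)
  qed
  also have "\<dots> = 2 powr (- t) * (1 + p) ^ card R"
    using bern_hits[of S R "\<lambda>j. {j}" p 2] assms finR
    by (simp add: bern_cmult eq disjoint_family_on_def subset_iff)
  also have "\<dots> \<le> 2 powr (- t) * exp p ^ card R"
    using assms by (intro mult_left_mono power_mono exp_ge_add_one_self) auto
  finally show ?thesis by (simp add: exp_of_nat_mult[symmetric] mult.commute)
qed

lemma bern_pair:
  assumes "finite S" "e \<in> S" "f \<in> S" "e \<noteq> f"
  shows "bern S p (\<lambda>A. of_bool (e \<in> A \<and> f \<in> A)) = p\<^sup>2"
proof -
  have "bern S p (\<lambda>A. of_bool (e \<in> A \<and> f \<in> A)) = bern S p (\<lambda>A. of_bool (e \<in> A \<inter> {e,f} \<and> f \<in> A \<inter> {e,f}))"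
    by simp
  also have "\<dots> = bern {e,f} p (\<lambda>A. of_bool (e \<in> A \<and> f \<in> A))"
    using assms by (intro bern_restrict) auto
  also have "\<dots> = p\<^sup>2" using assms by (simp add: bern_insert power2_eq_square)
  finally show ?thesis .
qed

section \<open>Uniform random colourings and thinning\<close>

text \<open>The expectation over a uniformly random colouring of \<open>S\<close> with
  \<open>r\<close> colours. Extensional functions make the set of colourings finite, of size
  \<open>r ^ card S\<close>.\<close>

definition avg_col :: "'a set \<Rightarrow> nat \<Rightarrow> (('a \<Rightarrow> nat) \<Rightarrow> real) \<Rightarrow> real" where
  "avg_col S r f = (\<Sum>c\<in>S \<rightarrow>\<^sub>E {..<r}. f c) / real r ^ card S"

lemma avg_col_empty [simp]: "avg_col {} r f = f (\<lambda>_. undefined)"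
  by (simp add: avg_col_def)

lemma avg_col_insert:
  assumes "finite S" "e \<notin> S"
  shows "avg_col (insert e S) r f = (\<Sum>i<r. avg_col S r (\<lambda>c. f (c(e := i)))) / real r"
proof -
  have "(\<Sum>c\<in>insert e S \<rightarrow>\<^sub>E {..<r}. f c)
      = (\<Sum>(i, c)\<in>{..<r} \<times> (S \<rightarrow>\<^sub>E {..<r}). f (c(e := i)))"
    unfolding PiE_insert_eq
    by (subst sum.reindex) (use assms inj_combinator[of e S "\<lambda>_. {..<r}"] in \<open>auto simp: case_prod_unfold o_def\<close>)
  also have "\<dots> = (\<Sum>i<r. \<Sum>c\<in>S \<rightarrow>\<^sub>E {..<r}. f (c(e := i)))"
    by (simp add: sum.cartesian_product)
  finally show ?thesis using assms
    by (simp add: avg_col_def sum_divide_distrib field_simps)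
qed

lemma avg_col_cmult: "avg_col S r (\<lambda>c. a * f c) = a * avg_col S r f"
  by (simp add: avg_col_def sum_distrib_left)

lemma avg_col_add: "avg_col S r (\<lambda>c. f c + g c) = avg_col S r f + avg_col S r g"
  by (simp add: avg_col_def sum.distrib add_divide_distrib)

lemma avg_col_sum: "avg_col S r (\<lambda>c. \<Sum>i\<in>I. f i c) = (\<Sum>i\<in>I. avg_col S r (f i))"
  by (simp add: avg_col_def sum.swap[of _ I] sum_divide_distrib)

lemma avg_col_mono:
  assumes "\<And>c. c \<in> S \<rightarrow>\<^sub>E {..<r} \<Longrightarrow> f c \<le> g c"
  shows "avg_col S r f \<le> avg_col S r g"
  unfolding avg_col_def by (intro divide_right_mono sum_mono) (use assms in auto)

lemma avg_col_const [simp]: "finite S \<Longrightarrow> r > 0 \<Longrightarrow> avg_col S r (\<lambda>_. a) = a"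
  by (simp add: avg_col_def card_PiE)

lemma avg_col_bern:
  "avg_col S r (\<lambda>c. bern T p (f c)) = bern T p (\<lambda>A. avg_col S r (\<lambda>c. f c A))"
  by (simp add: avg_col_def bern_sum bern_divide)

text \<open>An element survives if it is chosen and receives its prescribed colour; these are
  independent events of probabilities \<open>p\<close> and \<open>1/r\<close>, and different
  elements are independent. So the survivors form a random set of density
  \<open>p / r\<close>.\<close>

lemma avg_col_thin:
  assumes "finite S" "r > 0" "\<And>e. e \<in> S \<Longrightarrow> t e < r"
  shows "avg_col S r (\<lambda>c. bern S p (\<lambda>A. F {e \<in> A. c e = t e})) = bern S (p / real r) F"
  using assms(1,3)
proof (induction S arbitrary: F rule: finite_induct)
  case empty
  then show ?case by simp
next
  case (insert e S)
  let ?X = "\<lambda>F. avg_col S r (\<lambda>c. bern S p (\<lambda>A. F {e \<in> A. c e = t e}))"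
  \<comment> \<open>Reveal \<open>e\<close> first: it can contribute only if its colour
    \<open>i\<close> equals \<open>t e\<close>, which happens for exactly one of the
    \<open>r\<close> colours.\<close>
  have "bern (insert e S) p (\<lambda>A. F {e' \<in> A. (c(e := i)) e' = t e'})
     = p * (if i = t e then bern S p (\<lambda>A. F (insert e {e \<in> A. c e = t e}))
         else bern S p (\<lambda>A. F {e \<in> A. c e = t e}))
       + (1 - p) * bern S p (\<lambda>A. F {e \<in> A. c e = t e})" (is "?L = _") for c i
  proof -
    have 1: "{e' \<in> A. (c(e := i)) e' = t e'} = {e \<in> A. c e = t e}" if "A \<subseteq> S" for A
      using that insert by auto
    have 2: "{e' \<in> insert e A. (c(e := i)) e' = t e'} =
      (if i = t e then insert e {e \<in> A. c e = t e} else {e \<in> A. c e = t e})" if "A \<subseteq> S" for A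
      using that insert by auto
    have "bern S p (\<lambda>A. F {e' \<in> insert e A. (c(e := i)) e' = t e'})
      = bern S p (\<lambda>A. F (if i = t e then insert e {e \<in> A. c e = t e} else {e \<in> A. c e = t e}))"
      by (intro bern_cong) (simp only: 2)
    moreover have "bern S p (\<lambda>A. F {e' \<in> A. (c(e := i)) e' = t e'})
      = bern S p (\<lambda>A. F {e \<in> A. c e = t e})"
      by (intro bern_cong) (simp only: 1)
    ultimately show ?thesis
      unfolding bern_insert[OF insert.hyps] by (cases "i = t e") simp_all
  qed
  then have "avg_col (insert e S) r (\<lambda>c. bern (insert e S) p (\<lambda>A. F {e \<in> A. c e = t e}))
    = (\<Sum>i<r. p * (if i = t e then ?X (\<lambda>A. F (insert e A)) else ?X F) + (1 - p) * ?X F) / real r"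
    using insert.hyps
    by (simp add: avg_col_insert avg_col_add avg_col_cmult if_distrib[of "avg_col S r"] if_distribR
        del: fun_upd_apply) (auto simp: avg_col_cmult intro!: sum.cong arg_cong2[where f="(/)"])
  also have "(\<Sum>i<r. p * (if i = t e then ?X (\<lambda>A. F (insert e A)) else ?X F) + (1 - p) * ?X F)
    = (\<Sum>i<r. (if i = t e then p * (?X (\<lambda>A. F (insert e A)) - ?X F) else 0) + ?X F)"
    by (intro sum.cong) (auto simp: algebra_simps)
  also have "\<dots> = p * (?X (\<lambda>A. F (insert e A)) - ?X F) + real r * ?X F"
    using insert.prems by (simp add: sum.distrib)
  finally have eq: "avg_col (insert e S) r (\<lambda>c. bern (insert e S) p (\<lambda>A. F {e \<in> A. c e = t e}))
    = (p * (?X (\<lambda>A. F (insert e A)) - ?X F) + real r * ?X F) / real r" .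
  have IH: "?X G = bern S (p / real r) G" for G
    using insert.prems by (intro insert.IH) auto
  show ?case
    unfolding eq unfolding IH[of F] IH[of "\<lambda>A. F (insert e A)"] bern_insert[OF insert.hyps] using assms(2) by (simp add: field_simps)
qed

section \<open>Walks of bounded length\<close>

text \<open>Two steps of a walk, from \<open>U\<close> to \<open>V\<close> and back, so that only
  vertices of \<open>U\<close> are recorded. Walks may repeat vertices; this only enlarges the set
  of reached vertices, which is harmless for upper bounds on what paths can reach.\<close>

definition twostep :: "(nat \<times> nat) set \<Rightarrow> nat set \<Rightarrow> nat set" where
  "twostep E S = {y. \<exists>x\<in>S. \<exists>w. (x, w) \<in> E \<and> (y, w) \<in> E}"

abbreviation reach :: "(nat \<times> nat) set \<Rightarrow> nat set \<Rightarrow> nat \<Rightarrow> nat set" where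
  "reach E S i \<equiv> (twostep E ^^ i) S"

lemma twostep_mono: "S \<subseteq> S' \<Longrightarrow> twostep E S \<subseteq> twostep E S'"
  by (auto simp: twostep_def)

lemma reach_mono: "S \<subseteq> S' \<Longrightarrow> reach E S i \<subseteq> reach E S' i"
  by (induction i) (simp_all add: twostep_mono)

lemma reach_Suc_iff:
  "y \<in> reach E S (Suc i) \<longleftrightarrow> (\<exists>x\<in>reach E S i. \<exists>w. (x, w) \<in> E \<and> (y, w) \<in> E)"
  by (simp, subst twostep_def) simp

lemma card_twostep_le:
  assumes "finite E" "finite S"
    and a: "\<And>x. card {w. (x, w) \<in> E} \<le> a" and b: "\<And>w. card {x. (x, w) \<in> E} \<le> b"
  shows "finite (twostep E S)" "card (twostep E S) \<le> card S * (a * b)"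
proof -
  have f1: "finite {w. (x, w) \<in> E}" for x
    by (rule finite_subset[OF _ finite_imageI[OF \<open>finite E\<close>, of snd]]) force
  have f2: "finite {x. (x, w) \<in> E}" for w
    by (rule finite_subset[OF _ finite_imageI[OF \<open>finite E\<close>, of fst]]) force
  have eq: "twostep E S = (\<Union>x\<in>S. \<Union>w\<in>{w. (x, w) \<in> E}. {y. (y, w) \<in> E})"
    by (auto simp: twostep_def)
  show "finite (twostep E S)" unfolding eq by (intro finite_UN_I \<open>finite S\<close> f1 f2)
  have "card (\<Union>w\<in>{w. (x, w) \<in> E}. {y. (y, w) \<in> E}) \<le> a * b" for x
  proof -
    have "card (\<Union>w\<in>{w. (x, w) \<in> E}. {y. (y, w) \<in> E}) \<le> (\<Sum>w\<in>{w. (x, w) \<in> E}. card {y. (y, w) \<in> E})"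
      by (rule card_UN_le[OF f1])
    also have "\<dots> \<le> (\<Sum>w\<in>{w. (x, w) \<in> E}. b)" by (intro sum_mono b)
    also have "\<dots> \<le> a * b" using a[of x] by simp
    finally show ?thesis .
  qed
  then have "(\<Sum>x\<in>S. card (\<Union>w\<in>{w. (x, w) \<in> E}. {y. (y, w) \<in> E})) \<le> (\<Sum>x\<in>S. a * b)"
    by (intro sum_mono)
  with card_UN_le[OF \<open>finite S\<close>, of "\<lambda>x. \<Union>w\<in>{w. (x, w) \<in> E}. {y. (y, w) \<in> E}"]
  show "card (twostep E S) \<le> card S * (a * b)"
    unfolding eq by simp
qed

lemma card_reach_le:
  assumes "finite E" "finite S"
    and a: "\<And>x. card {w. (x, w) \<in> E} \<le> a" and b: "\<And>w. card {x. (x, w) \<in> E} \<le> b"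
  shows "finite (reach E S i) \<and> card (reach E S i) \<le> card S * (a * b) ^ i"
proof (induction i)
  case (Suc i)
  have "card (twostep E (reach E S i)) \<le> card (reach E S i) * (a * b)"
    using Suc assms by (intro card_twostep_le) auto
  also have "\<dots> \<le> card S * (a * b) ^ i * (a * b)" using Suc by (intro mult_right_mono) auto
  finally show ?case using Suc card_twostep_le[OF assms(1) _ a b, of "reach E S i"]
    by (simp add: algebra_simps)
qed (use assms in simp)

text \<open>Cut a walk at its last visit to \<open>W\<close>.\<close>
lemma reach_last_visit:
  fixes E W
  defines "E' \<equiv> {e \<in> E. snd e \<notin> W}"
  assumes "y \<in> reach E S i"
  shows "y \<in> reach E' S i \<or> (\<exists>w\<in>W. \<exists>x j i' z. j < i \<and> i' < i \<and> (x, w) \<in> E \<and>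
     y \<in> reach E' {x} j \<and> z \<in> reach E S i' \<and> (z, w) \<in> E)"
  using assms(2)
proof (induction i arbitrary: y)
  case (Suc i)
  then obtain z w where zw: "z \<in> reach E S i" "(z, w) \<in> E" "(y, w) \<in> E"
    unfolding reach_Suc_iff by blast
  show ?case
  proof (cases "w \<in> W")
    case True
    then show ?thesis using zw
      by (intro disjI2 bexI[of _ w] exI[of _ y] exI[of _ 0] exI[of _ i] exI[of _ z]) auto
  next
    case False
    then have E': "(z, w) \<in> E'" "(y, w) \<in> E'" using zw by (auto simp: E'_def)
    from Suc.IH[OF zw(1)] show ?thesis
    proof
      assume "z \<in> reach E' S i"
      then have "y \<in> reach E' S (Suc i)" using E' unfolding reach_Suc_iff by blast
      then show ?thesis by blast
    next
      assume "\<exists>w\<in>W. \<exists>x j i' z'. j < i \<and> i' < i \<and> (x, w) \<in> E \<and>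
        z \<in> reach E' {x} j \<and> z' \<in> reach E S i' \<and> (z', w) \<in> E"
      then obtain w' x j i' z' where *: "w' \<in> W" "j < i" "i' < i" "(x, w') \<in> E"
        "z \<in> reach E' {x} j" "z' \<in> reach E S i'" "(z', w') \<in> E" by blast
      have "y \<in> reach E' {x} (Suc j)" using *(5) E' unfolding reach_Suc_iff by blast
      then show ?thesis using *
        by (intro disjI2 bexI[of _ w'] exI[of _ x] exI[of _ "Suc j"] exI[of _ i'] exI[of _ z']) auto
    qed
  qed
qed simp

text \<open>Cut a walk to \<open>v\<close> at its last visit to \<open>W\<close>. Without such a
  visit, \<open>direct\<close> applies. If the visited vertex is \<open>v\<close> itself, a shorter
  walk already ends at \<open>v\<close>, against the induction hypothesis. Otherwise the rest of the
  walk is a detour excluded by \<open>via\<close>.\<close>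

lemma not_reached:
  fixes E W
  defines "E' \<equiv> {e \<in> E. snd e \<notin> W}"
  assumes "v \<in> W"
    and direct: "\<And>i y. i \<le> h \<Longrightarrow> y \<in> reach E' S i \<Longrightarrow> (y, v) \<notin> E"
    and via: "\<And>w x y j. w \<in> W \<Longrightarrow> w \<noteq> v \<Longrightarrow> j < h \<Longrightarrow> (x, w) \<in> E \<Longrightarrow> y \<in> reach E' {x} j
      \<Longrightarrow> (y, v) \<notin> E"
  shows "i \<le> h \<Longrightarrow> y \<in> reach E S i \<Longrightarrow> (y, v) \<notin> E"
proof (induction i arbitrary: y rule: less_induct)
  case (less i)
  from reach_last_visit[OF less.prems(2), of W] show ?case
  proof
    assume "y \<in> reach {e \<in> E. snd e \<notin> W} S i"
    then show ?thesis using direct[OF less.prems(1)] unfolding E'_def by blast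
  next
    assume "\<exists>w\<in>W. \<exists>x j i' z. j < i \<and> i' < i \<and> (x, w) \<in> E \<and>
     y \<in> reach {e \<in> E. snd e \<notin> W} {x} j \<and> z \<in> reach E S i' \<and> (z, w) \<in> E"
    then obtain w x j i' z where *: "w \<in> W" "j < i" "i' < i" "(x, w) \<in> E"
      "y \<in> reach E' {x} j" "z \<in> reach E S i'" "(z, w) \<in> E" unfolding E'_def by blast
    show ?thesis
    proof (cases "w = v")
      case True
      have "i' \<le> h" using *(3) less.prems by linarith
      from less.IH[OF *(3) this *(6)] *(7) True show ?thesis by simp
    next
      case False
      have "j < h" using *(2) less.prems by linarith
      from via[OF *(1) False this *(4,5)] show ?thesis .
    qed
  qed
qed

section \<open>From rainbow paths to walks of bounded length\<close>

lemma bip_adj_simps [simp]: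
  "bip_adj E (Inl i) (Inr j) \<longleftrightarrow> (i, j) \<in> E" "bip_adj E (Inr j) (Inl i) \<longleftrightarrow> (i, j) \<in> E"
  "\<not> bip_adj E (Inl i) (Inl i')" "\<not> bip_adj E (Inr j) (Inr j')"
  by (auto simp: bip_adj_def)

lemma bip_adj_InlE: "bip_adj E (Inl i) y \<Longrightarrow> (\<And>j. y = Inr j \<Longrightarrow> (i, j) \<in> E \<Longrightarrow> thesis) \<Longrightarrow> thesis"
  by (cases y) auto

lemma bip_adj_InrE: "bip_adj E (Inr j) y \<Longrightarrow> (\<And>i. y = Inl i \<Longrightarrow> (i, j) \<in> E \<Longrightarrow> thesis) \<Longrightarrow> thesis"
  by (cases y) auto

lemma walk_reach:
  assumes "\<And>i. Suc i < length xs \<Longrightarrow> bip_adj E (xs ! i) (xs ! Suc i)" "xs ! 0 = Inl a" "xs \<noteq> []"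
  shows "2 * i < length xs \<Longrightarrow> \<exists>y \<in> reach E {a} i. xs ! (2 * i) = Inl y"
proof (induction i)
  case 0
  then show ?case using assms by auto
next
  case (Suc i)
  then obtain y where y: "y \<in> reach E {a} i" "xs ! (2 * i) = Inl y" by auto
  then obtain w where w: "xs ! Suc (2 * i) = Inr w" "(y, w) \<in> E"
    using assms(1)[of "2 * i"] Suc.prems by (auto elim!: bip_adj_InlE)
  then obtain z where z: "xs ! Suc (Suc (2 * i)) = Inl z" "(z, w) \<in> E"
    using assms(1)[of "Suc (2 * i)"] Suc.prems by (auto elim!: bip_adj_InrE)
  then have "z \<in> reach E {a} (Suc i)" using y w unfolding reach_Suc_iff by blast
  then show ?case using z by auto
qed

text \<open>A walk from \<open>U\<close> to \<open>V\<close> has an odd number of edges, so the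
  allowed \<open>2 * h + 2\<close> edges are at most \<open>2 * h + 1\<close>: no more than
  \<open>h\<close> double steps and one final edge.\<close>

lemma walk_end_reach:
  assumes "\<And>i. Suc i < length xs \<Longrightarrow> bip_adj E (xs ! i) (xs ! Suc i)" "xs ! 0 = Inl a"
    "xs \<noteq> []" "last xs = Inr v" "length xs \<le> 2 * h + 3"
  shows "\<exists>i\<le>h. \<exists>y \<in> reach E {a} i. (y, v) \<in> E"
proof -
  note walk = walk_reach[of xs E a, OF assms(1-3)]
  have last: "xs ! (length xs - 1) = Inr v" using assms by (simp add: last_conv_nth)
  have "odd (length xs - 1)"
  proof
    assume "even (length xs - 1)"
    then obtain i where "length xs - 1 = 2 * i" by blast
    then show False using walk[of i] last assms(3) by (cases xs) auto
  qed
  then obtain i where i: "length xs - 1 = Suc (2 * i)" by (metis oddE Suc_eq_plus1)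
  then have "2 * i < length xs" by linarith
  then obtain y where y: "y \<in> reach E {a} i" "xs ! (2 * i) = Inl y" using walk[of i] by auto
  have "bip_adj E (xs ! (2 * i)) (xs ! Suc (2 * i))" using i by (intro assms(1)) linarith
  then have "(y, v) \<in> E" using i last y(2) by simp
  moreover have "i \<le> h" using i assms(5) by linarith
  ultimately show ?thesis using y(1) by blast
qed

text \<open>Pigeonhole: the edges of the path have distinct colours below \<open>r\<close>.\<close>

lemma rainbow_length_le:
  assumes "\<forall>e\<in>E. c e < r" "is_path E xs u v" "rainbow c xs"
  shows "length xs \<le> Suc r"
proof -
  let ?col = "map (\<lambda>i. edge_col c (xs ! i) (xs ! Suc i)) [0..<length xs - 1]"
  have "edge_col c (xs ! i) (xs ! Suc i) < r" if "i < length xs - 1" for i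
  proof -
    have "bip_adj E (xs ! i) (xs ! Suc i)" using assms that by (auto simp: is_path_def)
    then show ?thesis using assms(1)
      by (cases "xs ! i"; cases "xs ! Suc i") (auto simp: edge_col_def)
  qed
  then have "set ?col \<subseteq> {..<r}" by auto
  then have "card (set ?col) \<le> r" by (metis card_lessThan card_mono finite_lessThan)
  moreover have "card (set ?col) = length xs - 1"
    using assms(3) by (simp only: rainbow_def distinct_card) simp
  ultimately show ?thesis by simp
qed

text \<open>A finite value means that the set of admissible numbers of colours is nonempty, and an
  infimum of a nonempty set in the well-order \<open>enat\<close> is attained.\<close>

lemma rc_leE:
  assumes "rc m n k E \<le> enat r"
  obtains r' c where "rainbow_k_colouring m n E k r' c" "r' \<le> r"
proof -
  let ?R = "{r. \<exists>c. rainbow_k_colouring m n E k r c}"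
  have "?R \<noteq> {}"
  proof
    assume "?R = {}"
    then have "rc m n k E = \<infinity>" unfolding rc_def by (simp only: image_empty) (simp add: top_enat_def)
    then show False using assms by simp
  qed
  then have "\<exists>e. e \<in> enat ` ?R" by blast
  then have "rc m n k E \<in> enat ` ?R" unfolding rc_def Inf_enat_def
    using \<open>?R \<noteq> {}\<close> by (simp only: image_is_empty if_False) (rule LeastI_ex)
  then show thesis using assms that by auto
qed

lemma rc_leD:
  assumes "rc m n k E \<le> enat r" "k \<ge> 1" "u \<in> bip_verts m n" "v \<in> bip_verts m n" "u \<noteq> v"
  shows "\<exists>xs. is_path E xs u v \<and> length xs \<le> Suc r"
proof -
  obtain r' c where r': "rainbow_k_colouring m n E k r' c" "r' \<le> r"
    using assms(1) by (rule rc_leE)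
  then have "\<exists>P :: nat \<Rightarrow> (nat + nat) list. (\<forall>i<k. is_path E (P i) u v \<and> rainbow c (P i))"
    using assms(3-5) unfolding rainbow_k_colouring_def by blast
  then obtain P :: "nat \<Rightarrow> (nat + nat) list" where P: "\<forall>i<k. is_path E (P i) u v \<and> rainbow c (P i)"
    by blast
  moreover have "0 < k" using assms(2) by simp
  ultimately have "is_path E (P 0) u v" "rainbow c (P 0)" by auto
  moreover have "length (P 0) \<le> Suc r'"
    using r'(1) by (intro rainbow_length_le[OF _ \<open>is_path E (P 0) u v\<close> \<open>rainbow c (P 0)\<close>]) (simp add: rainbow_k_colouring_def)
  ultimately show ?thesis using r'(2) \<open>is_path E (P 0) u v\<close> by (intro exI[of _ "P 0"]) auto
qed

section \<open>Probability bound below the threshold\<close>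

text \<open>The vertices of \<open>U\<close> from which walks continue in double steps: the start vertex is
  \<open>Inl 0\<close> for odd \<open>d\<close> and \<open>Inr 0\<close> for even \<open>d\<close>.\<close>
definition start_set :: "nat \<Rightarrow> (nat \<times> nat) set \<Rightarrow> nat set" where
  "start_set d E = (if odd d then {0} else {x. (x, 0) \<in> E})"

text \<open>One rainbow path from the start vertex to \<open>Inr v\<close> suffices; it has at most
  \<open>d + 1\<close> edges. For even \<open>d\<close> its first vertex \<open>Inr 0\<close> is
  dropped, leaving a walk from a neighbour of \<open>Inr 0\<close>. Parity then saves one edge in
  both cases.\<close>

lemma rc_le_imp_reach:
  assumes "rc m n k E \<le> enat (d + 1)" "k \<ge> 1" "d \<ge> 1" "v \<noteq> 0" "v < n" "m > 0"
  shows "\<exists>i \<le> (d - 1) div 2. \<exists>y \<in> reach E (start_set d E) i. (y, v) \<in> E"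
proof (cases "odd d")
  case True
  have "Inl 0 \<in> bip_verts m n" "Inr v \<in> bip_verts m n"
    using assms by (auto simp: bip_verts_def)
  then obtain xs where xs: "is_path E xs (Inl 0) (Inr v)" "length xs \<le> Suc (d + 1)"
    using rc_leD[OF assms(1,2), of "Inl 0" "Inr v"] by auto
  have "\<exists>i\<le>(d - 1) div 2. \<exists>y \<in> reach E {0} i. (y, v) \<in> E"
  proof (rule walk_end_reach)
    show "xs \<noteq> []" using xs by (auto simp: is_path_def)
    then show "xs ! 0 = Inl 0" using xs by (simp add: is_path_def hd_conv_nth)
    show "length xs \<le> 2 * ((d - 1) div 2) + 3" using xs(2) True by presburger
  qed (use xs in \<open>auto simp: is_path_def\<close>)
  then show ?thesis using True by (simp add: start_set_def)
next
  case False
  have "Inr 0 \<in> bip_verts m n" "Inr v \<in> bip_verts m n"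
    using assms by (auto simp: bip_verts_def)
  then obtain xs where xs: "is_path E xs (Inr 0) (Inr v)" "length xs \<le> Suc (d + 1)"
    using rc_leD[OF assms(1,2), of "Inr 0" "Inr v"] assms(4) by auto
  obtain ys where ys: "xs = Inr 0 # ys" "ys \<noteq> []"
    using xs by (cases xs; cases "tl xs") (auto simp: is_path_def)
  have adj: "bip_adj E (xs ! i) (xs ! Suc i)" if "Suc i < length xs" for i
    using xs that by (auto simp: is_path_def)
  from adj[of 0] ys obtain a where a: "ys ! 0 = Inl a" "(a, 0) \<in> E"
    by (auto elim!: bip_adj_InrE)
  have "\<exists>i\<le>(d - 1) div 2. \<exists>y \<in> reach E {a} i. (y, v) \<in> E"
  proof (rule walk_end_reach[OF _ a(1) ys(2)])
    show "last ys = Inr v" using xs ys by (simp add: is_path_def)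
    show "length ys \<le> 2 * ((d - 1) div 2) + 3" using xs(2) ys False assms(3) by simp
    show "bip_adj E (ys ! i) (ys ! Suc i)" if "Suc i < length ys" for i
      using adj[of "Suc i"] that ys by simp
  qed
  moreover have "reach E {a} i \<subseteq> reach E (start_set d E) i" for i
    using a False by (intro reach_mono) (simp add: start_set_def)
  ultimately show ?thesis by blast
qed

text \<open>Here \<open>A\<close> is the part of the graph already exposed, of bounded degree, and
  \<open>B\<close> consists of the random edges at the targets \<open>W\<close>. The first error
  term is the probability that all \<open>s\<close> targets, which behave independently, have a
  neighbour in \<open>D\<close>. The second is a union bound over two distinct targets and the ends
  \<open>x\<close>, \<open>y\<close> of a short detour, which requires two distinct edges.\<close>

lemma targets_missed:
  fixes A :: "(nat \<times> nat) set" and S0 :: "nat set" and p :: real and m h s a b \<sigma> :: nat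
  defines "W \<equiv> {1..s}" and "D \<equiv> (\<Union>i\<le>h. reach A S0 i)"
  assumes p: "0 \<le> p" "p \<le> 1/2" and A: "finite A"
    and S0: "finite S0" "card S0 \<le> \<sigma>"
    and a: "\<And>x. card {w. (x, w) \<in> A} \<le> a" and b: "\<And>w. card {x. (x, w) \<in> A} \<le> b"
    and ab: "1 \<le> a * b"
  shows "bern ({..<m} \<times> W) p (\<lambda>B. of_bool ((\<forall>v\<in>W. \<exists>y\<in>D. (y, v) \<in> B) \<or>
      (\<exists>v\<in>W. \<exists>w\<in>W. w \<noteq> v \<and> (\<exists>x y j. j < h \<and> (x, w) \<in> B \<and> y \<in> reach A {x} j \<and> (y, v) \<in> B))))
    \<le> exp (- (real s * exp (- 2 * p * (real (h + 1) * real \<sigma> * real (a * b) ^ h))))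
      + (real s)\<^sup>2 * (real m * (real h * real (a * b) ^ (h - 1))) * p\<^sup>2"
proof -
  let ?S = "{..<m} \<times> W"
  define U where "U = {..<m}"
  define D' where "D' = D \<inter> U"
  \<comment> \<open>The end pairs of detours with fewer than \<open>h\<close> double steps, cut down
    to \<open>U\<close> because random edges exist only there.\<close>
  define R where "R = Sigma U (\<lambda>x. (\<Union>j<h. reach A {x} j) \<inter> U)"
  define WW where "WW = (W \<times> W) - Id"
  note reach_card = card_reach_le[OF A _ a b]
  have fin: "finite W" "finite U" "finite D'" "finite ?S"
    by (auto simp: W_def U_def D'_def)
  have cardW: "card W = s" by (simp add: W_def)
  have finR: "finite R" and cardR: "real (card R) \<le> real m * (real h * real (a * b) ^ (h - 1))"
  proof -
    show "finite R" using fin by (auto simp: R_def)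
    \<comment> \<open>For \<open>h = 0\<close> the union is empty and the factor \<open>h\<close>
      vanishes, so the truncated exponent \<open>h - 1\<close> does no harm.\<close>
    have "card ((\<Union>j<h. reach A {x} j) \<inter> U) \<le> h * (a * b) ^ (h - 1)" for x
    proof -
      have "card ((\<Union>j<h. reach A {x} j) \<inter> U) \<le> card (\<Union>j<h. reach A {x} j)"
        using reach_card[of "{x}"] by (intro card_mono) auto
      also have "\<dots> \<le> (\<Sum>j<h. card (reach A {x} j))" by (intro card_UN_le) auto
      also have "\<dots> \<le> (\<Sum>j<h. (a * b) ^ (h - 1))"
      proof (intro sum_mono)
        fix j assume j: "j \<in> {..<h}"
        have "card (reach A {x} j) \<le> (a * b) ^ j" using reach_card[of "{x}" j] by simp
        also have "\<dots> \<le> (a * b) ^ (h - 1)" using ab j by (intro power_increasing) auto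
        finally show "card (reach A {x} j) \<le> (a * b) ^ (h - 1)" .
      qed
      finally show ?thesis by simp
    qed
    then have "(\<Sum>x\<in>U. card ((\<Union>j<h. reach A {x} j) \<inter> U)) \<le> (\<Sum>x\<in>U. h * (a * b) ^ (h - 1))"
      by (intro sum_mono)
    then have "card R \<le> m * (h * (a * b) ^ (h - 1))"
      unfolding R_def by (subst card_SigmaI) (use fin in \<open>auto simp: U_def\<close>)
    then show "real (card R) \<le> real m * (real h * real (a * b) ^ (h - 1))"
      by (metis of_nat_le_iff of_nat_mult of_nat_power)
  qed
  have cardD: "real (card D') \<le> real (h + 1) * real \<sigma> * real (a * b) ^ h"
  proof -
    have "card D' \<le> card D"
      unfolding D'_def D_def using reach_card[OF S0(1)] by (intro card_mono) auto
    also have "\<dots> \<le> (\<Sum>i\<le>h. card (reach A S0 i))" unfolding D_def by (intro card_UN_le) auto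
    also have "\<dots> \<le> (\<Sum>i\<le>h. \<sigma> * (a * b) ^ h)"
    proof (intro sum_mono)
      fix i assume i: "i \<in> {..h}"
      have "card (reach A S0 i) \<le> card S0 * (a * b) ^ i" using reach_card[OF S0(1), of i] by simp
      also have "\<dots> \<le> \<sigma> * (a * b) ^ h" using ab i S0 by (intro mult_mono power_increasing) auto
      finally show "card (reach A S0 i) \<le> \<sigma> * (a * b) ^ h" .
    qed
    finally have "card D' \<le> (h + 1) * \<sigma> * (a * b) ^ h" by (simp add: algebra_simps)
    then show ?thesis by (metis of_nat_le_iff of_nat_mult of_nat_power)
  qed
  \<comment> \<open>The product is the indicator that every target has a neighbour in
    \<open>D'\<close>; the double sum counts the detours and is at least \<open>1\<close> once there
    is one.\<close>
  have "bern ?S p (\<lambda>B. of_bool ((\<forall>v\<in>W. \<exists>y\<in>D. (y, v) \<in> B) \<or>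
      (\<exists>v\<in>W. \<exists>w\<in>W. w \<noteq> v \<and> (\<exists>x y j. j < h \<and> (x, w) \<in> B \<and> y \<in> reach A {x} j \<and> (y, v) \<in> B))))
    \<le> bern ?S p (\<lambda>B. (\<Prod>v\<in>W. of_bool (B \<inter> (D' \<times> {v}) \<noteq> {}))
        + (\<Sum>(w, v)\<in>WW. \<Sum>(x, y)\<in>R. of_bool ((x, w) \<in> B \<and> (y, v) \<in> B)))"
  proof (intro bern_mono)
    fix B assume B: "B \<subseteq> ?S"
    have nonneg: "0 \<le> (\<Prod>v\<in>W. of_bool (B \<inter> (D' \<times> {v}) \<noteq> {}) :: real)"
      "0 \<le> (\<Sum>(w, v)\<in>WW. \<Sum>(x, y)\<in>R. of_bool ((x, w) \<in> B \<and> (y, v) \<in> B) :: real)"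
      by (auto intro!: prod_nonneg sum_nonneg)
    have 1: "(\<Prod>v\<in>W. of_bool (B \<inter> (D' \<times> {v}) \<noteq> {}) :: real) = 1" if "\<forall>v\<in>W. \<exists>y\<in>D. (y, v) \<in> B"
      using that B by (intro prod.neutral) (fastforce simp: D'_def U_def)
    have 2: "1 \<le> (\<Sum>(w, v)\<in>WW. \<Sum>(x, y)\<in>R. of_bool ((x, w) \<in> B \<and> (y, v) \<in> B) :: real)"
      if "v \<in> W" "w \<in> W" "w \<noteq> v" "j < h" "(x, w) \<in> B" "y \<in> reach A {x} j" "(y, v) \<in> B" for v w x y j
    proof -
      have xy: "(x, y) \<in> R" using that B by (auto simp: R_def U_def)
      have "1 \<le> (\<Sum>(x, y)\<in>R. of_bool ((x, w) \<in> B \<and> (y, v) \<in> B) :: real)"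
        using that by (intro order_trans[OF _ member_le_sum[OF xy _ finR]]) auto
      also have "\<dots> \<le> (\<Sum>(w, v)\<in>WW. \<Sum>(x, y)\<in>R. of_bool ((x, w) \<in> B \<and> (y, v) \<in> B))"
        using that fin
        by (intro order_trans[OF _ member_le_sum[of "(w, v)"]]) (auto simp: WW_def intro!: sum_nonneg)
      finally show ?thesis .
    qed
    show "of_bool ((\<forall>v\<in>W. \<exists>y\<in>D. (y, v) \<in> B) \<or>
      (\<exists>v\<in>W. \<exists>w\<in>W. w \<noteq> v \<and> (\<exists>x y j. j < h \<and> (x, w) \<in> B \<and> y \<in> reach A {x} j \<and> (y, v) \<in> B)))
      \<le> (\<Prod>v\<in>W. of_bool (B \<inter> (D' \<times> {v}) \<noteq> {}) :: real)
        + (\<Sum>(w, v)\<in>WW. \<Sum>(x, y)\<in>R. of_bool ((x, w) \<in> B \<and> (y, v) \<in> B))"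
      (is "of_bool (?P \<or> ?Q) \<le> ?X + ?Y")
    proof (cases "?P \<or> ?Q")
      case True
      then have "1 \<le> ?X + ?Y"
      proof
        assume ?P
        then show ?thesis using 1 nonneg by simp
      next
        assume ?Q
        then have "1 \<le> ?Y" using 2 by blast
        then show ?thesis using nonneg by simp
      qed
      then show ?thesis using True by simp
    next
      case False
      then have "of_bool (?P \<or> ?Q) = (0::real)" by (simp only: of_bool_eq)
      then show ?thesis using nonneg by linarith
    qed
  qed (use p in auto)
  also have "\<dots> = (1 - (1 - p) ^ card D') ^ s + real (card WW) * (real (card R) * p\<^sup>2)"
  proof -
    have "bern ?S p (\<lambda>B. \<Prod>v\<in>W. of_bool (B \<inter> (D' \<times> {v}) \<noteq> {}))
      = (\<Prod>v\<in>W. bern (D' \<times> {v}) p (\<lambda>B. of_bool (B \<noteq> {})))"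
      by (rule bern_prod) (use fin in \<open>auto simp: D'_def U_def disjoint_family_on_def\<close>)
    also have "\<dots> = (\<Prod>v\<in>W. 1 - (1 - p) ^ card D')"
    proof (intro prod.cong refl)
      fix v
      have "bern (D' \<times> {v}) p (\<lambda>B. of_bool (B \<noteq> {}))
        = bern (D' \<times> {v}) p (\<lambda>B. 1 - of_bool (B = {}))"
        by (intro bern_cong) auto
      then show "bern (D' \<times> {v}) p (\<lambda>B. of_bool (B \<noteq> {})) = 1 - (1 - p) ^ card D'"
        using fin by (simp add: bern_diff bern_avoid card_cartesian_product)
    qed
    finally have 1: "bern ?S p (\<lambda>B. \<Prod>v\<in>W. of_bool (B \<inter> (D' \<times> {v}) \<noteq> {}))
      = (1 - (1 - p) ^ card D') ^ s" by (simp add: cardW)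
    have "bern ?S p (\<lambda>B. \<Sum>(w, v)\<in>WW. \<Sum>(x, y)\<in>R. of_bool ((x, w) \<in> B \<and> (y, v) \<in> B))
      = (\<Sum>(w, v)\<in>WW. \<Sum>(x, y)\<in>R. bern ?S p (\<lambda>B. of_bool ((x, w) \<in> B \<and> (y, v) \<in> B)))"
      by (simp add: bern_sum case_prod_unfold)
    also have "\<dots> = (\<Sum>(w, v)\<in>WW. \<Sum>(x, y)\<in>R. p\<^sup>2)"
    proof (intro sum.cong refl, clarify, intro sum.cong refl, clarify)
      fix w v x y assume "(w, v) \<in> WW" "(x, y) \<in> R"
      then show "bern ?S p (\<lambda>B. of_bool ((x, w) \<in> B \<and> (y, v) \<in> B)) = p\<^sup>2"
        using fin by (intro bern_pair) (auto simp: WW_def R_def U_def)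
    qed
    finally show ?thesis using 1 by (simp add: bern_add case_prod_unfold)
  qed
  also have "\<dots> \<le> exp (- (real s * exp (- 2 * p * (real (h + 1) * real \<sigma> * real (a * b) ^ h))))
      + (real s)\<^sup>2 * (real m * (real h * real (a * b) ^ (h - 1))) * p\<^sup>2"
  proof (intro add_mono)
    have "card WW \<le> card (W \<times> W)" unfolding WW_def using fin by (intro card_mono) auto
    then have "real (card WW) \<le> (real s)\<^sup>2"
      by (simp add: card_cartesian_product cardW power2_eq_square flip: of_nat_mult)
    then have "real (card WW) * (real (card R) * p\<^sup>2)
       \<le> (real s)\<^sup>2 * ((real m * (real h * real (a * b) ^ (h - 1))) * p\<^sup>2)"
      using cardR by (intro mult_mono) auto
    then show "real (card WW) * (real (card R) * p\<^sup>2)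
       \<le> (real s)\<^sup>2 * (real m * (real h * real (a * b) ^ (h - 1))) * p\<^sup>2" by (simp add: mult.assoc)
    let ?q = "(1 - p) ^ card D'"
    have q: "0 \<le> ?q" "?q \<le> 1" using p by (auto intro: power_le_one)
    \<comment> \<open>This is where \<open>p \<le> 1/2\<close> enters:
      \<open>(1 + 2 * p) * (1 - p) = 1 + p * (1 - 2 * p) \<ge> 1\<close>.\<close>
    have "exp (- 2 * p) \<le> 1 - p"
    proof -
      have "1 + 2 * p \<le> exp (2 * p)" by simp
      moreover have "1 \<le> (1 + 2 * p) * (1 - p)" using p mult_nonneg_nonneg[of p "1 - 2 * p"]
        by (simp add: algebra_simps)
      ultimately have "1 \<le> exp (2 * p) * (1 - p)"
        using p mult_right_mono[of "1 + 2 * p" "exp (2 * p)" "1 - p"] by linarith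
      then show ?thesis by (simp add: exp_minus field_simps)
    qed
    then have "exp (- 2 * p) ^ card D' \<le> ?q" by (intro power_mono) auto
    then have "exp (- 2 * p * card D') \<le> ?q" by (simp add: exp_of_nat_mult[symmetric] mult.commute)
    moreover have "- 2 * p * (real (h + 1) * real \<sigma> * real (a * b) ^ h) \<le> - 2 * p * card D'"
      using cardD p by (intro mult_left_mono_neg) auto
    ultimately have qlow: "exp (- 2 * p * (real (h + 1) * real \<sigma> * real (a * b) ^ h)) \<le> ?q"
      using exp_le_cancel_iff order_trans by blast
    have "(1 - ?q) ^ s \<le> exp (- ?q) ^ s"
      using q exp_ge_add_one_self[of "- ?q"] by (intro power_mono) auto
    also have "\<dots> = exp (- (real s * ?q))" by (simp add: exp_of_nat_mult[symmetric])
    also have "\<dots> \<le> exp (- (real s * exp (- 2 * p * (real (h + 1) * real \<sigma> * real (a * b) ^ h))))"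
      using mult_left_mono[OF qlow, of "real s"] by simp
    finally show "(1 - ?q) ^ s \<le> exp (- (real s * exp (- 2 * p * (real (h + 1) * real \<sigma> * real (a * b) ^ h))))" .
  qed
  finally show ?thesis .
qed

text \<open>Union bound over the vertices of one side, with \<open>card_upper_tail\<close> applied
  to the star of each. The integer part turns the complementary event into a degree bound of type
  \<open>nat\<close>.\<close>

lemma degree_exceeds:
  assumes "0 \<le> p" "p \<le> 1" "finite X" "finite Y" "1 \<le> t"
  shows "bern (X \<times> Y) p (\<lambda>A. of_bool (\<exists>x\<in>X. nat \<lfloor>t\<rfloor> < card {y. (x, y) \<in> A}))
    \<le> real (card X) * (exp (p * card Y) * 2 powr (- t))" (is ?thesis1)
    and "bern (X \<times> Y) p (\<lambda>A. of_bool (\<exists>y\<in>Y. nat \<lfloor>t\<rfloor> < card {x. (x, y) \<in> A}))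
    \<le> real (card Y) * (exp (p * card X) * 2 powr (- t))" (is ?thesis2)
proof -
  have fl: "t < real c" if "nat \<lfloor>t\<rfloor> < c" for c using that by linarith
  have fin: "finite (X \<times> Y)" using assms by auto
  have "bern (X \<times> Y) p (\<lambda>A. of_bool (\<exists>x\<in>X. nat \<lfloor>t\<rfloor> < card {y. (x, y) \<in> A}))
    \<le> bern (X \<times> Y) p (\<lambda>A. \<Sum>x\<in>X. of_bool (t < real (card (A \<inter> ({x} \<times> Y)))))"
  proof (intro bern_mono assms)
    fix A assume A: "A \<subseteq> X \<times> Y"
    have "A \<inter> ({x} \<times> Y) = Pair x ` {y. (x, y) \<in> A}" for x using A by auto
    then have "card (A \<inter> ({x} \<times> Y)) = card {y. (x, y) \<in> A}" for x
      by (simp add: card_image inj_on_def)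
    then have "1 \<le> (\<Sum>x\<in>X. of_bool (t < real (card (A \<inter> ({x} \<times> Y)))) :: real)"
      if "x \<in> X" "nat \<lfloor>t\<rfloor> < card {y. (x, y) \<in> A}" for x
      using that fl assms by (intro order_trans[OF _ member_le_sum[of x]]) auto
    then show "of_bool (\<exists>x\<in>X. nat \<lfloor>t\<rfloor> < card {y. (x, y) \<in> A})
      \<le> (\<Sum>x\<in>X. of_bool (t < real (card (A \<inter> ({x} \<times> Y)))) :: real)"
      by (cases "\<exists>x\<in>X. nat \<lfloor>t\<rfloor> < card {y. (x, y) \<in> A}") (auto intro!: sum_nonneg)
  qed
  also have "\<dots> \<le> (\<Sum>x\<in>X. exp (p * card Y) * 2 powr (- t))"
    unfolding bern_sum
  proof (intro sum_mono)
    fix x assume "x \<in> X"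
    then have "bern (X \<times> Y) p (\<lambda>A. of_bool (t < real (card (A \<inter> ({x} \<times> Y)))))
      \<le> exp (p * card ({x} \<times> Y)) * 2 powr (- t)"
      using assms fin by (intro card_upper_tail) auto
    then show "bern (X \<times> Y) p (\<lambda>A. of_bool (t < real (card (A \<inter> ({x} \<times> Y)))))
      \<le> exp (p * card Y) * 2 powr (- t)" by (simp add: card_cartesian_product)
  qed
  finally show ?thesis1 by simp
  have "bern (X \<times> Y) p (\<lambda>A. of_bool (\<exists>y\<in>Y. nat \<lfloor>t\<rfloor> < card {x. (x, y) \<in> A}))
    \<le> bern (X \<times> Y) p (\<lambda>A. \<Sum>y\<in>Y. of_bool (t < real (card (A \<inter> (X \<times> {y})))))"
  proof (intro bern_mono assms)
    fix A assume A: "A \<subseteq> X \<times> Y"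
    have "A \<inter> (X \<times> {y}) = (\<lambda>x. (x, y)) ` {x. (x, y) \<in> A}" for y using A by auto
    then have "card (A \<inter> (X \<times> {y})) = card {x. (x, y) \<in> A}" for y
      by (simp add: card_image inj_on_def)
    then have "1 \<le> (\<Sum>y\<in>Y. of_bool (t < real (card (A \<inter> (X \<times> {y})))) :: real)"
      if "y \<in> Y" "nat \<lfloor>t\<rfloor> < card {x. (x, y) \<in> A}" for y
      using that fl assms by (intro order_trans[OF _ member_le_sum[of y]]) auto
    then show "of_bool (\<exists>y\<in>Y. nat \<lfloor>t\<rfloor> < card {x. (x, y) \<in> A})
      \<le> (\<Sum>y\<in>Y. of_bool (t < real (card (A \<inter> (X \<times> {y})))) :: real)"
      by (cases "\<exists>y\<in>Y. nat \<lfloor>t\<rfloor> < card {x. (x, y) \<in> A}") (auto intro!: sum_nonneg)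
  qed
  also have "\<dots> \<le> (\<Sum>y\<in>Y. exp (p * card X) * 2 powr (- t))"
    unfolding bern_sum
  proof (intro sum_mono)
    fix y assume "y \<in> Y"
    then have "bern (X \<times> Y) p (\<lambda>A. of_bool (t < real (card (A \<inter> (X \<times> {y})))))
      \<le> exp (p * card (X \<times> {y})) * 2 powr (- t)"
      using assms fin by (intro card_upper_tail) auto
    then show "bern (X \<times> Y) p (\<lambda>A. of_bool (t < real (card (A \<inter> (X \<times> {y})))))
      \<le> exp (p * card X) * 2 powr (- t)" by (simp add: card_cartesian_product)
  qed
  finally show ?thesis2 by simp
qed

text \<open>The edges away from the targets \<open>{1..s}\<close> are exposed first; large degrees
  there account for the first two terms. Otherwise \<open>not_reached\<close> shows that small
  rainbow connectivity forces one of the events of \<open>targets_missed\<close> in the second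
  stage. Vertex \<open>0\<close> of \<open>V\<close> is not a target, so the start set is determined
  by the first stage.\<close>

lemma rb_prob_rc_le:
  fixes m n s d k :: nat and p tU tV :: real
  defines "h \<equiv> (d - 1) div 2" and "\<sigma> \<equiv> (if odd d then 1 else tV)"
  assumes p: "0 \<le> p" "p \<le> 1/2" and "d \<ge> 1" "k \<ge> 1" "m > 0" "s < n" and t: "1 \<le> tU" "1 \<le> tV"
  shows "rb_prob m n p (\<lambda>E. rc m n k E \<le> enat (d + 1))
    \<le> real m * (exp (p * n) * 2 powr (- tU)) + real n * (exp (p * m) * 2 powr (- tV))
      + exp (- (real s * exp (- 2 * p * (real (h + 1) * \<sigma> * (tU * tV) ^ h))))
      + (real s)\<^sup>2 * (real m * (real h * (tU * tV) ^ (h - 1))) * p\<^sup>2"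
proof -
  define W where "W = {1..s}"
  define V' where "V' = {..<n} - W"
  define a where "a = nat \<lfloor>tU\<rfloor>"
  define b where "b = nat \<lfloor>tV\<rfloor>"
  define \<sigma>' where "\<sigma>' = (if odd d then 1 else b)"
  define K where "K = exp (- (real s * exp (- 2 * p * (real (h + 1) * \<sigma> * (tU * tV) ^ h))))
      + (real s)\<^sup>2 * (real m * (real h * (tU * tV) ^ (h - 1))) * p\<^sup>2"
  define Q where "Q = (\<lambda>E. rc m n k E \<le> enat (d + 1))"
  define S1 where "S1 = {..<m} \<times> V'"
  define S2 where "S2 = {..<m} \<times> W"
  define bad where "bad = (\<lambda>A. (\<exists>x\<in>{..<m}. a < card {y. (x, y) \<in> A}) \<or> (\<exists>y\<in>V'. b < card {x. (x, y) \<in> A}))"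
  have fin: "finite S1" "finite S2" "finite V'" by (auto simp: S1_def S2_def V'_def W_def)
  have S: "{..<m} \<times> {..<n} = S1 \<union> S2" "S1 \<inter> S2 = {}"
    using \<open>s < n\<close> by (auto simp: S1_def S2_def V'_def W_def)
  have ab: "1 \<le> a" "1 \<le> b" "real a \<le> tU" "real b \<le> tV"
    using t le_nat_floor[of 1 tU] le_nat_floor[of 1 tV] of_nat_floor[of tU] of_nat_floor[of tV]
    by (simp_all add: a_def b_def)
  have ab1: "real (a * b) \<le> tU * tV" "1 \<le> a * b" using ab t mult_le_mono[of 1 a 1 b] by (auto intro!: mult_mono)
  have \<sigma>: "real \<sigma>' \<le> \<sigma>" using ab by (auto simp: \<sigma>'_def \<sigma>_def)
  have K0: "0 \<le> K" unfolding K_def using t by auto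
  have "rb_prob m n p Q = bern S1 p (\<lambda>A. bern S2 p (\<lambda>B. of_bool (Q (A \<union> B))))"
    unfolding rb_prob_eq_bern S by (rule bern_Un) (use fin S in auto)
  also have "\<dots> \<le> bern S1 p (\<lambda>A. of_bool (bad A) + K)"
  proof (intro bern_mono)
    fix A assume A: "A \<subseteq> S1"
    then have finA: "finite A" using fin finite_subset by auto
    show "bern S2 p (\<lambda>B. of_bool (Q (A \<union> B))) \<le> of_bool (bad A) + K"
    proof (cases "bad A")
      case True
      then show ?thesis using K0 p fin
        by (intro bern_le_const) (auto simp: add_increasing2)
    next
      case False
      have deg: "card {y. (x, y) \<in> A} \<le> a" for x
      proof (cases "x < m")
        case False
        then have "{y. (x, y) \<in> A} = {}" using A by (auto simp: S1_def)
        then show ?thesis by simp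
      qed (use \<open>\<not> bad A\<close> in \<open>auto simp: bad_def not_less\<close>)
      have deg': "card {x. (x, y) \<in> A} \<le> b" for y
      proof (cases "y \<in> V'")
        case False
        then have "{x. (x, y) \<in> A} = {}" using A by (auto simp: S1_def)
        then show ?thesis by simp
      qed (use \<open>\<not> bad A\<close> in \<open>auto simp: bad_def not_less\<close>)
      have S0: "finite (start_set d A)" "card (start_set d A) \<le> \<sigma>'"
      proof -
        have "start_set d A \<subseteq> insert 0 {..<m}" using A by (auto simp: start_set_def S1_def)
        then show "finite (start_set d A)" by (rule finite_subset) simp
        show "card (start_set d A) \<le> \<sigma>'" using deg' by (auto simp: start_set_def \<sigma>'_def)
      qed
      have "bern S2 p (\<lambda>B. of_bool (Q (A \<union> B))) \<le> bern S2 p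
        (\<lambda>B. of_bool ((\<forall>v\<in>{1..s}. \<exists>y\<in>(\<Union>i\<le>h. reach A (start_set d A) i). (y, v) \<in> B) \<or>
      (\<exists>v\<in>{1..s}. \<exists>w\<in>{1..s}. w \<noteq> v \<and> (\<exists>x y j. j < h \<and> (x, w) \<in> B \<and> y \<in> reach A {x} j \<and> (y, v) \<in> B))))"
      proof (intro bern_mono)
        fix B assume B: "B \<subseteq> S2"
        have A': "{e \<in> A \<union> B. snd e \<notin> W} = A"
          using A B by (auto simp: S1_def S2_def V'_def)
        have start: "start_set d (A \<union> B) = start_set d A"
          using B by (auto simp: start_set_def S2_def W_def)
        have inB: "(x, v) \<in> A \<union> B \<longleftrightarrow> (x, v) \<in> B" if "v \<in> W" for x v
          using A that by (auto simp: S1_def V'_def)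
        have "(\<forall>v\<in>W. \<exists>y\<in>(\<Union>i\<le>h. reach A (start_set d A) i). (y, v) \<in> B) \<or>
          (\<exists>v\<in>W. \<exists>w\<in>W. w \<noteq> v \<and> (\<exists>x y j. j < h \<and> (x, w) \<in> B \<and> y \<in> reach A {x} j \<and> (y, v) \<in> B))"
          if QAB: "Q (A \<union> B)"
        proof (rule ccontr)
          assume "\<not> ?thesis"
          then have no1: "\<not> (\<forall>v\<in>W. \<exists>y\<in>(\<Union>i\<le>h. reach A (start_set d A) i). (y, v) \<in> B)"
            and no2: "\<not> (\<exists>v\<in>W. \<exists>w\<in>W. w \<noteq> v \<and> (\<exists>x y j. j < h \<and> (x, w) \<in> B \<and> y \<in> reach A {x} j \<and> (y, v) \<in> B))"
            by (simp_all only: de_Morgan_disj simp_thms)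
          \<comment> \<open>A target that is not adjacent to any vertex reached in the first stage.
            By \<open>not_reached\<close> it is then not reached in the whole graph either, since
            detours are excluded by \<open>no2\<close>.\<close>
          from no1 obtain v where v1: "v \<in> W"
            and v2: "\<not> (\<exists>y\<in>(\<Union>i\<le>h. reach A (start_set d A) i). (y, v) \<in> B)" by blast
          have v: "v \<in> W" "\<And>i y. i \<le> h \<Longrightarrow> y \<in> reach A (start_set d A) i \<Longrightarrow> (y, v) \<notin> B"
            using v1 v2 by blast+
          have via: "\<And>w x y j. w \<in> W \<Longrightarrow> w \<noteq> v \<Longrightarrow> j < h \<Longrightarrow> (x, w) \<in> B \<Longrightarrow> y \<in> reach A {x} j
              \<Longrightarrow> (y, v) \<notin> B" using no2 v1 by blast
          have "v \<noteq> 0" "v < n" using v(1) \<open>s < n\<close> by (auto simp: W_def)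
          then obtain i y where iy: "i \<le> h" "y \<in> reach (A \<union> B) (start_set d (A \<union> B)) i" "(y, v) \<in> A \<union> B"
            using rc_le_imp_reach[OF QAB[unfolded Q_def] \<open>k \<ge> 1\<close> \<open>d \<ge> 1\<close> _ _ \<open>m > 0\<close>, of v]
            unfolding h_def by blast
          have "(y, v) \<notin> A \<union> B"
          proof (rule not_reached[OF v(1) _ _ iy(1,2)], unfold A' start)
            show "(y, v) \<notin> A \<union> B" if "i \<le> h" "y \<in> reach A (start_set d A) i" for i y
              unfolding inB[OF v1] by (rule v(2)[OF that])
            show "(y, v) \<notin> A \<union> B" if "w \<in> W" "w \<noteq> v" "j < h" "(x, w) \<in> A \<union> B" "y \<in> reach A {x} j"
              for w x y j
              unfolding inB[OF v1] by (rule via[OF that(1-3) _ that(5)]) (use that(4) inB[OF that(1)] in simp)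
          qed
          then show False using iy by blast
        qed
        then show "of_bool (Q (A \<union> B)) \<le> (of_bool ((\<forall>v\<in>{1..s}. \<exists>y\<in>(\<Union>i\<le>h. reach A (start_set d A) i). (y, v) \<in> B) \<or>
          (\<exists>v\<in>{1..s}. \<exists>w\<in>{1..s}. w \<noteq> v \<and> (\<exists>x y j. j < h \<and> (x, w) \<in> B \<and> y \<in> reach A {x} j \<and> (y, v) \<in> B)))::real)"
          unfolding W_def by (rule of_bool_mono)
      qed (use p in auto)
      also have "\<dots> \<le> exp (- (real s * exp (- 2 * p * (real (h + 1) * real \<sigma>' * real (a * b) ^ h))))
      + (real s)\<^sup>2 * (real m * (real h * real (a * b) ^ (h - 1))) * p\<^sup>2"
        unfolding S2_def W_def by (rule targets_missed[OF p finA S0 deg deg' ab1(2)])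
      also have "\<dots> \<le> K"
      proof -
        have pw: "real (a * b) ^ j \<le> (tU * tV) ^ j" for j
          using ab1 by (intro power_mono) auto
        have "real (h + 1) * real \<sigma>' * real (a * b) ^ h \<le> real (h + 1) * \<sigma> * (tU * tV) ^ h"
          using \<sigma> pw by (intro mult_mono) auto
        then have "- 2 * p * (real (h + 1) * \<sigma> * (tU * tV) ^ h)
          \<le> - 2 * p * (real (h + 1) * real \<sigma>' * real (a * b) ^ h)"
          using p by (intro mult_left_mono_neg) auto
        then have 1: "real s * exp (- 2 * p * (real (h + 1) * \<sigma> * (tU * tV) ^ h))
          \<le> real s * exp (- 2 * p * (real (h + 1) * real \<sigma>' * real (a * b) ^ h))"
          by (intro mult_left_mono) (simp_all only: exp_le_cancel_iff of_nat_0_le_iff)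
        have 2: "(real s)\<^sup>2 * (real m * (real h * real (a * b) ^ (h - 1))) * p\<^sup>2
          \<le> (real s)\<^sup>2 * (real m * (real h * (tU * tV) ^ (h - 1))) * p\<^sup>2"
          using pw by (intro mult_right_mono mult_left_mono) auto
        show ?thesis unfolding K_def using 1 2 by (intro add_mono) (simp_all only: exp_le_cancel_iff neg_le_iff_le)
      qed
      finally show ?thesis using False by simp
    qed
  qed (use p in auto)
  also have "\<dots> = bern S1 p (\<lambda>A. of_bool (bad A)) + K" using fin by (simp add: bern_add)
  also have "bern S1 p (\<lambda>A. of_bool (bad A)) \<le> bern S1 p (\<lambda>A. of_bool (\<exists>x\<in>{..<m}. a < card {y. (x, y) \<in> A})
     + of_bool (\<exists>y\<in>V'. b < card {x. (x, y) \<in> A}))"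
    using p by (intro bern_mono) (auto simp: bad_def)
  also have "\<dots> \<le> real (card {..<m}) * (exp (p * card V') * 2 powr (- tU))
      + real (card V') * (exp (p * card {..<m}) * 2 powr (- tV))"
    unfolding bern_add S1_def a_def b_def using p t fin by (intro add_mono degree_exceeds) auto
  also have "\<dots> \<le> real m * (exp (p * n) * 2 powr (- tU)) + real n * (exp (p * m) * 2 powr (- tV))"
  proof -
    have "card V' \<le> n" using card_mono[of "{..<n}" V'] by (auto simp: V'_def)
    then show ?thesis using p by (intro add_mono mult_mono) (auto intro!: mult_left_mono)
  qed
  finally show ?thesis unfolding K_def Q_def by simp
qed

section \<open>Disjoint walks in random layered graphs\<close>

definition layered :: "('v \<times> 'v) set \<Rightarrow> (nat \<Rightarrow> 'v set) \<Rightarrow> nat \<Rightarrow> 'v list \<Rightarrow> bool" where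
  "layered A L l zs \<longleftrightarrow> length zs = Suc l \<and> (\<forall>i\<le>l. zs ! i \<in> L i) \<and> (\<forall>i<l. (zs ! i, zs ! Suc i) \<in> A)"

definition layer_edges :: "(nat \<Rightarrow> 'v set) \<Rightarrow> nat \<Rightarrow> ('v \<times> 'v) set" where
  "layer_edges L l = (\<Union>i<l. L i \<times> L (Suc i))"

text \<open>Only disjointness of the territories \<open>T g\<close> matters later, so the tree structure inside a
  territory is not recorded.\<close>
definition forest :: "('v \<times> 'v) set \<Rightarrow> (nat \<Rightarrow> 'v set) \<Rightarrow> nat \<Rightarrow> nat \<Rightarrow> nat \<Rightarrow> bool" where
  "forest A L l N s \<longleftrightarrow> (\<exists>T. disjoint_family_on T {..<N} \<and>
     (\<forall>g<N. T g \<subseteq> (\<Union>i\<le>l. L i) \<and> card (T g \<inter> L l) = s \<and>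
        (\<forall>z\<in>T g \<inter> L l. \<exists>zs. layered A L l zs \<and> zs ! l = z \<and> set (tl zs) \<subseteq> T g)))"

text \<open>Both ends are cut off before comparing, since the first and last layers will be the
  single vertices to be connected.\<close>

definition disjoint_walks :: "('v \<times> 'v) set \<Rightarrow> (nat \<Rightarrow> 'v set) \<Rightarrow> nat \<Rightarrow> nat \<Rightarrow> bool" where
  "disjoint_walks A L l k \<longleftrightarrow> (\<exists>P :: nat \<Rightarrow> 'v list. (\<forall>i<k. layered A L l (P i)) \<and>
     (\<forall>i<k. \<forall>j<k. i \<noteq> j \<longrightarrow> set (butlast (tl (P i))) \<inter> set (butlast (tl (P j))) = {}))"

definition children :: "('v \<times> 'v) set \<Rightarrow> 'v set \<Rightarrow> 'v set \<Rightarrow> nat \<Rightarrow> ('v \<Rightarrow> 'v set) \<Rightarrow> bool" where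
  "children B S L b C \<longleftrightarrow> disjoint_family_on C S \<and>
     (\<forall>a\<in>S. C a \<subseteq> L \<and> card (C a) = b \<and> {a} \<times> C a \<subseteq> B)"

text \<open>The vertices of \<open>S\<close> choose their children one after another. The earlier
  ones occupy at most \<open>b\<close> vertices of \<open>L\<close> each, so at least
  \<open>R0\<close> remain free, and \<open>card_lower_tail\<close> bounds the probability of having
  fewer than \<open>b\<close> neighbours among these. The edges at the next vertex are independent
  of all earlier choices.\<close>

lemma private_children:
  assumes "finite S" "finite L" "card S * b + R0 \<le> card L" "0 \<le> q" "q \<le> 1"
  shows "bern (S \<times> L) q (\<lambda>B. of_bool (\<not> (\<exists>C. children B S L b C)))
    \<le> real (card S) * (2 ^ b * (1 - q / 2) ^ R0)"
  using assms(1,3)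
proof (induction S rule: finite_induct)
  case empty
  then show ?case by (simp add: children_def disjoint_family_on_def)
next
  case (insert a S)
  let ?\<delta> = "2 ^ b * (1 - q / 2) ^ R0"
  have eq: "insert a S \<times> L = S \<times> L \<union> {a} \<times> L" by auto
  have fin: "finite (S \<times> L)" "finite ({a} \<times> L)" using insert assms by auto
  have "bern (insert a S \<times> L) q (\<lambda>B. of_bool (\<not> (\<exists>C. children B (insert a S) L b C)))
    = bern (S \<times> L) q (\<lambda>A. bern ({a} \<times> L) q (\<lambda>B. of_bool (\<not> (\<exists>C. children (A \<union> B) (insert a S) L b C))))"
    unfolding eq by (rule bern_Un) (use insert fin in auto)
  also have "\<dots> \<le> bern (S \<times> L) q (\<lambda>A. of_bool (\<not> (\<exists>C. children A S L b C)) + ?\<delta>)"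
  proof (intro bern_mono assms)
    fix A
    show "bern ({a} \<times> L) q (\<lambda>B. of_bool (\<not> (\<exists>C. children (A \<union> B) (insert a S) L b C)))
      \<le> of_bool (\<not> (\<exists>C. children A S L b C)) + ?\<delta>"
    proof (cases "\<exists>C. children A S L b C")
      case False
      then show ?thesis using fin assms by (intro bern_le_const) auto
    next
      case True
      then obtain C where C: "children A S L b C" by blast
      define R where "R = L - (\<Union>a\<in>S. C a)"
      have "card (\<Union>a\<in>S. C a) \<le> (\<Sum>a\<in>S. card (C a))" by (rule card_UN_le[OF insert.hyps(1)])
      also have "\<dots> = card S * b" using C by (simp add: children_def)
      finally have "card L - card S * b \<le> card R"
        unfolding R_def using C assms(2) by (subst card_Diff_subset)
          (auto simp: children_def intro: finite_subset)
      then have R: "R0 \<le> card R" using insert.prems insert.hyps by simp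
      have "bern ({a} \<times> L) q (\<lambda>B. of_bool (\<not> (\<exists>C. children (A \<union> B) (insert a S) L b C)))
        \<le> bern ({a} \<times> L) q (\<lambda>B. of_bool (card (B \<inter> ({a} \<times> R)) < b))"
      proof (intro bern_mono assms)
        fix B
        have "\<exists>C. children (A \<union> B) (insert a S) L b C" if bcard: "b \<le> card (B \<inter> ({a} \<times> R))"
        proof -
          obtain X where X: "X \<subseteq> B \<inter> ({a} \<times> R)" "card X = b"
            by (rule obtain_subset_with_card_n[OF bcard])
          have "fst e = a" if "e \<in> X" for e using X(1) that by auto
          then have "inj_on snd X" by (intro inj_onI prod_eqI) auto
          then have "card (snd ` X) = b" using X by (simp add: card_image)
          moreover have "{a} \<times> snd ` X \<subseteq> B" "snd ` X \<subseteq> R" using X by auto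
          ultimately have "children (A \<union> B) (insert a S) L b (C(a := snd ` X))"
            using C insert.hyps unfolding children_def R_def
            by (auto simp: disjoint_family_on_def)
          then show ?thesis by blast
        qed
        then show "of_bool (\<not> (\<exists>C. children (A \<union> B) (insert a S) L b C))
          \<le> (of_bool (card (B \<inter> ({a} \<times> R)) < b) :: real)"
          by (cases "b \<le> card (B \<inter> ({a} \<times> R))") auto
      qed
      also have "\<dots> \<le> 2 ^ b * (1 - q / 2) ^ card ({a} \<times> R)"
        using fin assms by (intro card_lower_tail) (auto simp: R_def)
      also have "\<dots> \<le> ?\<delta>"
        using R assms by (intro mult_left_mono power_decreasing) (auto simp: card_cartesian_product)
      finally show ?thesis using True by simp
    qed
  qed
  also have "\<dots> = bern (S \<times> L) q (\<lambda>A. of_bool (\<not> (\<exists>C. children A S L b C))) + ?\<delta>"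
    using fin by (simp add: bern_add)
  also have "\<dots> \<le> real (card S) * ?\<delta> + ?\<delta>" using insert by (intro add_mono insert.IH) auto
  finally show ?case using insert by (simp add: algebra_simps)
qed

lemma layer_edges_Suc: "layer_edges L (Suc l) = layer_edges L l \<union> L l \<times> L (Suc l)"
  by (auto simp: layer_edges_def less_Suc_eq)

lemma layer_edges_disjoint:
  assumes "disjoint_family_on L {..Suc l}"
  shows "layer_edges L l \<inter> L l \<times> L (Suc l) = {}"
proof -
  have "L i \<inter> L l = {}" if "i < l" for i
    using disjoint_family_onD[OF assms, of i l] that by simp
  then show ?thesis by (auto simp: layer_edges_def)
qed

lemma finite_layer_edges: "(\<And>i. i \<le> l \<Longrightarrow> finite (L i)) \<Longrightarrow> finite (layer_edges L l)"
  by (auto simp: layer_edges_def)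

lemma layered_snoc:
  assumes "layered A L l zs" "(zs ! l, z) \<in> B" "z \<in> L (Suc l)"
  shows "layered (A \<union> B) L (Suc l) (zs @ [z])"
  using assms unfolding layered_def
  by (auto simp: nth_append le_Suc_eq less_Suc_eq)

lemma set_tl_snoc: "zs \<noteq> [] \<Longrightarrow> set (tl (zs @ [z])) = insert z (set (tl zs))"
  by (cases zs) auto

text \<open>Given the forest, the edges to the next layer are still unexposed. Let its at most
  \<open>N * s\<close> leaves choose private children and add the children of each leaf to the
  territory of that leaf; every tree then has \<open>s * b\<close> leaves.\<close>

lemma forest_step:
  assumes "finite (L l)" "finite (L (Suc l))" "disjoint_family_on L {..Suc l}"
    and "N * s * b + R0 \<le> card (L (Suc l))" "0 \<le> q" "q \<le> 1" "forest A L l N s"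
  shows "bern (L l \<times> L (Suc l)) q (\<lambda>B. of_bool (\<not> forest (A \<union> B) L (Suc l) N (s * b)))
    \<le> real (N * s) * (2 ^ b * (1 - q / 2) ^ R0)"
proof -
  obtain T where T: "disjoint_family_on T {..<N}" "\<And>g. g < N \<Longrightarrow> T g \<subseteq> (\<Union>i\<le>l. L i)"
      "\<And>g. g < N \<Longrightarrow> card (T g \<inter> L l) = s"
      "\<And>g z. g < N \<Longrightarrow> z \<in> T g \<inter> L l \<Longrightarrow> \<exists>zs. layered A L l zs \<and> zs ! l = z \<and> set (tl zs) \<subseteq> T g"
    using assms(7) unfolding forest_def by blast
  define S where "S = (\<Union>g<N. T g \<inter> L l)"
  have S: "S \<subseteq> L l" "finite S" using assms(1) by (auto simp: S_def)
  have cardS: "card S \<le> N * s"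
    unfolding S_def using card_UN_le[of "{..<N}" "\<lambda>g. T g \<inter> L l"] T(3) by simp
  have disjL: "L i \<inter> L (Suc l) = {}" if "i \<le> l" for i
    using disjoint_family_onD[OF assms(3), of i "Suc l"] that by simp
  have main: "forest (A \<union> B) L (Suc l) N (s * b)" if C: "children B S (L (Suc l)) b C" for B C
  proof -
    define X where "X = (\<lambda>g. \<Union>a\<in>T g \<inter> L l. C a)"
    define T' where "T' = (\<lambda>g. T g \<union> X g)"
    have CS: "C a \<subseteq> L (Suc l)" "card (C a) = b" "{a} \<times> C a \<subseteq> B" if "a \<in> S" for a
      using C that unfolding children_def by blast+
    have CC: "C a \<inter> C a' = {}" if "a \<in> S" "a' \<in> S" "a \<noteq> a'" for a a'
      using C that unfolding children_def disjoint_family_on_def by blast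
    have inS: "a \<in> S" if "g < N" "a \<in> T g \<inter> L l" for g a using that by (auto simp: S_def)
    have X: "X g \<subseteq> L (Suc l)" if "g < N" for g
      unfolding X_def by (intro UN_least CS(1) inS[OF that])
    have TX: "T g \<inter> L (Suc l) = {}" if gN: "g < N" for g 
    proof (rule ccontr)
      assume "T g \<inter> L (Suc l) \<noteq> {}"
      then obtain z where z: "z \<in> T g" "z \<in> L (Suc l)" by blast
      then obtain i where "i \<le> l" "z \<in> L i" using T(2)[OF gN] by blast
      then show False using disjL[of i] z by blast
    qed
    have Ts: "T g \<inter> T g' = {}" if "g < N" "g' < N" "g \<noteq> g'" for g g'
      using disjoint_family_onD[OF T(1)] that by auto
    have Xs: "X g \<inter> X g' = {}" if "g < N" "g' < N" "g \<noteq> g'" for g g'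
    proof -
      have "C a \<inter> C a' = {}" if "a \<in> T g \<inter> L l" "a' \<in> T g' \<inter> L l" for a a'
      proof (rule CC)
        show "a \<in> S" "a' \<in> S" using inS[OF \<open>g < N\<close> that(1)] inS[OF \<open>g' < N\<close> that(2)] by auto
        show "a \<noteq> a'" using Ts[OF \<open>g < N\<close> \<open>g' < N\<close> \<open>g \<noteq> g'\<close>] that by blast
      qed
      then show ?thesis unfolding X_def by blast
    qed
    have "disjoint_family_on T' {..<N}"
      unfolding disjoint_family_on_def
    proof (intro ballI impI)
      fix g g' assume "g \<in> {..<N}" "g' \<in> {..<N}" "g \<noteq> g'"
      then show "T' g \<inter> T' g' = {}"
        using Ts[of g g'] Xs[of g g'] TX[of g] TX[of g'] X[of g] X[of g'] unfolding T'_def by auto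
    qed
    moreover have "T' g \<subseteq> (\<Union>i\<le>Suc l. L i)" if "g < N" for g
      using T(2)[OF that] X[OF that] unfolding T'_def atMost_Suc by blast
    moreover have T'L: "T' g \<inter> L (Suc l) = X g" if "g < N" for g
      using TX[OF that] X[OF that] unfolding T'_def by auto
    moreover have "card (X g) = s * b" if "g < N" for g
    proof -
      have "card (X g) = (\<Sum>a\<in>T g \<inter> L l. card (C a))"
        unfolding X_def
      proof (rule card_UN_disjoint)
        show "finite (T g \<inter> L l)" using assms(1) by auto
        show "\<forall>i\<in>T g \<inter> L l. finite (C i)"
          by (intro ballI finite_subset[OF CS(1)[OF inS[OF that]] assms(2)])
        show "\<forall>i\<in>T g \<inter> L l. \<forall>j\<in>T g \<inter> L l. i \<noteq> j \<longrightarrow> C i \<inter> C j = {}"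
          by (intro ballI impI CC inS[OF that])
      qed
      also have "\<dots> = (\<Sum>a\<in>T g \<inter> L l. b)"
        by (intro sum.cong refl CS(2) inS[OF that])
      finally show ?thesis using T(3)[OF that] by simp
    qed
    moreover have "\<exists>zs. layered (A \<union> B) L (Suc l) zs \<and> zs ! Suc l = z \<and> set (tl zs) \<subseteq> T' g"
      if gz: "g < N" "z \<in> X g" for g z
    proof -
      obtain a where a: "a \<in> T g \<inter> L l" "z \<in> C a" using \<open>z \<in> X g\<close> unfolding X_def by auto
      then have az: "(a, z) \<in> B" "z \<in> L (Suc l)"
        using CS[OF inS[OF gz(1) a(1)]] by blast+
      obtain zs where zs: "layered A L l zs" "zs ! l = a" "set (tl zs) \<subseteq> T g"
        using T(4)[OF gz(1) a(1)] by blast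
      then have len: "length zs = Suc l" by (simp add: layered_def)
      have "layered (A \<union> B) L (Suc l) (zs @ [z])" using zs az by (intro layered_snoc) auto
      moreover have "(zs @ [z]) ! Suc l = z" using len by (simp add: nth_append)
      moreover have "set (tl (zs @ [z])) \<subseteq> T' g"
        using zs(3) that(2) len by (subst set_tl_snoc) (auto simp: T'_def)
      ultimately show ?thesis by blast
    qed
    ultimately show ?thesis unfolding forest_def by (intro exI[of _ T']) (auto simp: T'L)
  qed
  have "bern (L l \<times> L (Suc l)) q (\<lambda>B. of_bool (\<not> forest (A \<union> B) L (Suc l) N (s * b)))
    \<le> bern (L l \<times> L (Suc l)) q (\<lambda>B. of_bool (\<not> (\<exists>C. children (B \<inter> S \<times> L (Suc l)) S (L (Suc l)) b C)))"
  proof (intro bern_mono assms)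
    fix B
    have "children B S (L (Suc l)) b C" if "children (B \<inter> S \<times> L (Suc l)) S (L (Suc l)) b C" for C
      using that unfolding children_def by blast
    then show "of_bool (\<not> forest (A \<union> B) L (Suc l) N (s * b))
      \<le> (of_bool (\<not> (\<exists>C. children (B \<inter> S \<times> L (Suc l)) S (L (Suc l)) b C)) :: real)"
      using main by (cases "\<exists>C. children (B \<inter> S \<times> L (Suc l)) S (L (Suc l)) b C") auto
  qed
  \<comment> \<open>Edges that do not start at a leaf are integrated out.\<close>
  also have "\<dots> = bern (S \<times> L (Suc l)) q (\<lambda>B. of_bool (\<not> (\<exists>C. children B S (L (Suc l)) b C)))"
    by (rule bern_restrict) (use S assms in auto)
  also have "\<dots> \<le> real (card S) * (2 ^ b * (1 - q / 2) ^ R0)"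
  proof (rule private_children)
    have "card S * b \<le> N * s * b" using cardS by simp
    then show "card S * b + R0 \<le> card (L (Suc l))" using assms(4) by linarith
  qed (use S assms in auto)
  also have "\<dots> \<le> real (N * s) * (2 ^ b * (1 - q / 2) ^ R0)"
    using cardS assms by (intro mult_right_mono) (auto simp del: of_nat_mult)
  finally show ?thesis .
qed

text \<open>The trees start as single vertices, namely \<open>N\<close> neighbours of
  \<open>x\<close>. The common root \<open>x\<close> belongs to no territory, which is why
  \<open>forest\<close> looks only at \<open>tl zs\<close>.\<close>

lemma forest_base:
  assumes "L 0 = {x}" "finite (L 1)" "x \<notin> L 1" "N + R0 \<le> card (L 1)" "0 \<le> q" "q \<le> 1"
  shows "bern (layer_edges L 1) q (\<lambda>A. of_bool (\<not> forest A L 1 N 1)) \<le> 2 ^ N * (1 - q / 2) ^ R0"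
proof -
  have eq: "layer_edges L 1 = {x} \<times> L 1" using assms(1) by (auto simp: layer_edges_def)
  have "forest A L 1 N 1" if C: "children A {x} (L 1) N C" for A C
  proof -
    have C: "C x \<subseteq> L 1" "card (C x) = N" "{x} \<times> C x \<subseteq> A" using C by (auto simp: children_def)
    obtain h where h: "bij_betw h {..<N} (C x)"
      using ex_bij_betw_nat_finite[of "C x"] C assms(2) finite_subset by (metis atLeast0LessThan)
    have hC: "h g \<in> C x" if "g < N" for g using h that by (auto simp: bij_betw_def)
    have "disjoint_family_on (\<lambda>g. {h g}) {..<N}"
      using h by (auto simp: disjoint_family_on_def bij_betw_def inj_on_def)
    moreover have "layered A L 1 [x, h g]" if "g < N" for g
      using hC[OF that] C assms(1) by (auto simp: layered_def less_Suc_eq le_Suc_eq)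
    moreover have "{h g} \<inter> L 1 = {h g}" "{h g} \<subseteq> (\<Union>i\<le>1. L i)" if "g < N" for g
      using hC[OF that] C by auto
    ultimately show ?thesis unfolding forest_def
      by (intro exI[of _ "\<lambda>g. {h g}"]) (auto intro!: exI[of _ "[x, h _]"])
  qed
  then have "bern (layer_edges L 1) q (\<lambda>A. of_bool (\<not> forest A L 1 N 1))
    \<le> bern (layer_edges L 1) q (\<lambda>A. of_bool (\<not> (\<exists>C. children A {x} (L 1) N C)))"
    using assms by (intro bern_mono) auto
  also have "\<dots> \<le> real (card {x}) * (2 ^ N * (1 - q / 2) ^ R0)"
    unfolding eq by (rule private_children) (use assms in auto)
  finally show ?thesis by simp
qed

text \<open>Here \<open>b 1\<close> is the number of trees, and \<open>b 2, ..., b l\<close> are the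
  branching numbers inside each tree. In every layer at most \<open>Z\<close> vertices choose
  children, each failing with probability at most \<open>\<delta>\<close>.\<close>

lemma forest_chain:
  assumes "L 0 = {x}" "\<And>i. i \<le> l \<Longrightarrow> finite (L i)" "disjoint_family_on L {..l}"
    and "\<And>i. 1 \<le> i \<Longrightarrow> i \<le> l \<Longrightarrow> (\<Prod>j\<in>{1..i}. b j) + R0 i \<le> card (L i)"
    and "\<And>i. 1 \<le> i \<Longrightarrow> i \<le> l \<Longrightarrow> 2 ^ b i * (1 - q / 2) ^ R0 i \<le> \<delta>"
    and "\<And>i. i \<le> l \<Longrightarrow> real (\<Prod>j\<in>{1..i}. b j) \<le> Z" "0 \<le> q" "q \<le> 1" "0 \<le> \<delta>" "1 \<le> l"
  shows "bern (layer_edges L l) q (\<lambda>A. of_bool (\<not> forest A L l (b 1) (\<Prod>j\<in>{2..l}. b j)))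
    \<le> real l * Z * \<delta>"
  using assms(10,2-6)
proof (induction l rule: dec_induct)
  case base
  have "1 \<le> Z" using base.prems(5)[of 0] by simp
  have "x \<notin> L 1" using disjoint_family_onD[OF base.prems(2), of 0 1] assms(1) by auto
  then have "bern (layer_edges L 1) q (\<lambda>A. of_bool (\<not> forest A L 1 (b 1) 1))
    \<le> 2 ^ b 1 * (1 - q / 2) ^ R0 1"
    using assms base by (intro forest_base[of L x]) auto
  also have "\<dots> \<le> \<delta>" using base by simp
  also have "\<dots> \<le> Z * \<delta>" using \<open>1 \<le> Z\<close> assms(9) mult_right_mono[of 1 Z \<delta>] by simp
  finally show ?case by simp
next
  case (step l)
  let ?s = "\<Prod>j\<in>{2..l}. b j"
  have prod_eq: "(\<Prod>j\<in>{1..i}. b j) = b 1 * (\<Prod>j\<in>{2..i}. b j)" if "1 \<le> i" for i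
    using that by (subst prod.atLeast_Suc_atMost) (auto simp: numeral_2_eq_2)
  have s_Suc: "(\<Prod>j\<in>{2..Suc l}. b j) = ?s * b (Suc l)"
    using step.hyps by (simp add: prod.nat_ivl_Suc' mult.commute)
  have fin: "finite (layer_edges L l)" "finite (L l \<times> L (Suc l))"
    using step.prems(1) by (auto intro!: finite_layer_edges)
  have sub: "disjoint_family_on L {..l}"
    by (rule disjoint_family_on_mono[OF _ step.prems(2)]) auto
  have "bern (layer_edges L (Suc l)) q (\<lambda>A. of_bool (\<not> forest A L (Suc l) (b 1) (?s * b (Suc l))))
    = bern (layer_edges L l) q (\<lambda>A. bern (L l \<times> L (Suc l)) q
      (\<lambda>B. of_bool (\<not> forest (A \<union> B) L (Suc l) (b 1) (?s * b (Suc l)))))"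
    unfolding layer_edges_Suc
    by (rule bern_Un) (use fin layer_edges_disjoint[OF step.prems(2)] in auto)
  also have "\<dots> \<le> bern (layer_edges L l) q (\<lambda>A. of_bool (\<not> forest A L l (b 1) ?s) + Z * \<delta>)"
  proof (intro bern_mono assms)
    fix A
    have Z: "real (b 1 * ?s) \<le> Z"
      using step.prems(5)[of l] step.hyps by (simp only: prod_eq[symmetric])
    then have "0 \<le> Z" by (rule order_trans[OF of_nat_0_le_iff])
    then have Z0: "0 \<le> Z * \<delta>" using assms(9) by (rule mult_nonneg_nonneg)
    show "bern (L l \<times> L (Suc l)) q (\<lambda>B. of_bool (\<not> forest (A \<union> B) L (Suc l) (b 1) (?s * b (Suc l))))
      \<le> of_bool (\<not> forest A L l (b 1) ?s) + Z * \<delta>"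
    proof (cases "forest A L l (b 1) ?s")
      case False
      then show ?thesis using fin assms Z0 by (intro bern_le_const) auto
    next
      case True
      have cap: "b 1 * ?s * b (Suc l) + R0 (Suc l) \<le> card (L (Suc l))"
        using step.prems(3)[of "Suc l"] prod_eq[of "Suc l"] s_Suc by (simp add: mult.assoc)
      have "bern (L l \<times> L (Suc l)) q (\<lambda>B. of_bool (\<not> forest (A \<union> B) L (Suc l) (b 1) (?s * b (Suc l))))
        \<le> real (b 1 * ?s) * (2 ^ b (Suc l) * (1 - q / 2) ^ R0 (Suc l))"
        using step.prems(1) by (intro forest_step[OF _ _ step.prems(2) cap assms(7,8) True]) auto
      also have "\<dots> \<le> Z * \<delta>"
        using Z \<open>0 \<le> Z\<close> step.prems(4)[of "Suc l"] assms(8) by (intro mult_mono) auto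
      finally show ?thesis using True by simp
    qed
  qed
  also have "\<dots> = bern (layer_edges L l) q (\<lambda>A. of_bool (\<not> forest A L l (b 1) ?s)) + Z * \<delta>"
    using fin by (simp add: bern_add)
  also have "\<dots> \<le> real l * Z * \<delta> + Z * \<delta>"
    using sub step.prems by (intro add_mono step.IH) auto
  finally show ?case unfolding s_Suc by (simp add: algebra_simps)
qed

text \<open>Walks ending in different territories of a forest have disjoint interiors, so it
  suffices that the last vertex is adjacent to \<open>k\<close> territories.\<close>
lemma disjoint_walks_step:
  assumes "finite (L l)" "L (Suc l) = {y}" "1 \<le> l" "0 \<le> q" "q \<le> 1" "forest A L l N s"
  shows "bern (L l \<times> L (Suc l)) q (\<lambda>B. of_bool (\<not> disjoint_walks (A \<union> B) L (Suc l) k))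
    \<le> 2 ^ k * ((1 + (1 - q) ^ s) / 2) ^ N"
proof -
  obtain T where T: "disjoint_family_on T {..<N}"
      "\<And>g. g < N \<Longrightarrow> card (T g \<inter> L l) = s"
      "\<And>g z. g < N \<Longrightarrow> z \<in> T g \<inter> L l \<Longrightarrow> \<exists>zs. layered A L l zs \<and> zs ! l = z \<and> set (tl zs) \<subseteq> T g"
    using assms(6) unfolding forest_def by blast
  define F where "F = (\<lambda>g. (T g \<inter> L l) \<times> {y})"
  have fin: "finite (L l \<times> L (Suc l))" using assms by auto
  have main: "disjoint_walks (A \<union> B) L (Suc l) k" if kcard: "k \<le> card {g\<in>{..<N}. B \<inter> F g \<noteq> {}}" for B
  proof -
    obtain G where G: "G \<subseteq> {g\<in>{..<N}. B \<inter> F g \<noteq> {}}" "card G = k" "finite G"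
      by (rule obtain_subset_with_card_n[OF kcard])
    obtain h where h: "bij_betw h {..<k} G"
      using ex_bij_betw_nat_finite[OF G(3)] G(2) by (metis atLeast0LessThan)
    have "\<exists>zs. layered (A \<union> B) L (Suc l) zs \<and> set (butlast (tl zs)) \<subseteq> T g" if gG: "g \<in> G" for g
    proof -
      obtain z where z: "z \<in> T g \<inter> L l" "(z, y) \<in> B" "g < N"
        using G gG unfolding F_def by auto
      then obtain zs where zs: "layered A L l zs" "zs ! l = z" "set (tl zs) \<subseteq> T g"
        using T(3) by blast
      then have "zs \<noteq> []" by (auto simp: layered_def)
      have "layered (A \<union> B) L (Suc l) (zs @ [y])" using zs z assms(2) by (intro layered_snoc) auto
      moreover have "butlast (tl (zs @ [y])) = tl zs" using \<open>zs \<noteq> []\<close> by simp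
      ultimately show ?thesis using zs(3) by metis
    qed
    then obtain Q where Q: "\<And>g. g \<in> G \<Longrightarrow> layered (A \<union> B) L (Suc l) (Q g)"
      "\<And>g. g \<in> G \<Longrightarrow> set (butlast (tl (Q g))) \<subseteq> T g" by metis
    have hG: "h i \<in> G" if "i < k" for i using h that by (auto simp: bij_betw_def)
    have "set (butlast (tl (Q (h i)))) \<inter> set (butlast (tl (Q (h j)))) = {}"
      if "i < k" "j < k" "i \<noteq> j" for i j
    proof -
      have "h i \<noteq> h j" using h that by (auto simp: bij_betw_def inj_on_def)
      moreover have "h i < N" "h j < N" using hG that G by auto
      ultimately have "T (h i) \<inter> T (h j) = {}" using T(1) by (auto simp: disjoint_family_on_def)
      then show ?thesis using Q(2)[OF hG[OF that(1)]] Q(2)[OF hG[OF that(2)]] by blast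
    qed
    then show ?thesis unfolding disjoint_walks_def
      using Q(1) hG by (intro exI[of _ "\<lambda>i. Q (h i)"]) auto
  qed
  have "bern (L l \<times> L (Suc l)) q (\<lambda>B. of_bool (\<not> disjoint_walks (A \<union> B) L (Suc l) k))
    \<le> bern (L l \<times> L (Suc l)) q (\<lambda>B. of_bool (card {g\<in>{..<N}. B \<inter> F g \<noteq> {}} < k))"
    using main by (intro bern_mono assms) (auto simp: not_less of_bool_def)
  also have "\<dots> \<le> 2 ^ k * ((1 + (1 - q) ^ s) / 2) ^ card {..<N}"
    using T fin assms
    by (intro hits_lower_tail) (auto simp: F_def card_cartesian_product disjoint_family_on_def)
  finally show ?thesis by simp
qed

text \<open>The edges into \<open>y\<close> are exposed last: either the forest up to layer
  \<open>l\<close> fails, or \<open>disjoint_walks_step\<close> applies to it.\<close>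

lemma disjoint_walks_prob:
  assumes "L 0 = {x}" "L (Suc l) = {y}" "\<And>i. i \<le> l \<Longrightarrow> finite (L i)" "disjoint_family_on L {..Suc l}"
    and "\<And>i. 1 \<le> i \<Longrightarrow> i \<le> l \<Longrightarrow> (\<Prod>j\<in>{1..i}. b j) + R0 i \<le> card (L i)"
    and "\<And>i. 1 \<le> i \<Longrightarrow> i \<le> l \<Longrightarrow> 2 ^ b i * (1 - q / 2) ^ R0 i \<le> \<delta>"
    and "\<And>i. i \<le> l \<Longrightarrow> real (\<Prod>j\<in>{1..i}. b j) \<le> Z" "0 \<le> q" "q \<le> 1" "0 \<le> \<delta>" "1 \<le> l"
  shows "bern (layer_edges L (Suc l)) q (\<lambda>A. of_bool (\<not> disjoint_walks A L (Suc l) k))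
    \<le> real l * Z * \<delta> + 2 ^ k * ((1 + (1 - q) ^ (\<Prod>j\<in>{2..l}. b j)) / 2) ^ b 1"
proof -
  let ?s = "\<Prod>j\<in>{2..l}. b j"
  let ?K = "2 ^ k * ((1 + (1 - q) ^ ?s) / 2) ^ b 1"
  have fin: "finite (layer_edges L l)" "finite (L l \<times> L (Suc l))"
    using assms(2,3) by (auto intro!: finite_layer_edges)
  have sub: "disjoint_family_on L {..l}"
    by (rule disjoint_family_on_mono[OF _ assms(4)]) auto
  have "bern (layer_edges L (Suc l)) q (\<lambda>A. of_bool (\<not> disjoint_walks A L (Suc l) k))
    = bern (layer_edges L l) q (\<lambda>A. bern (L l \<times> L (Suc l)) q
      (\<lambda>B. of_bool (\<not> disjoint_walks (A \<union> B) L (Suc l) k)))"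
    unfolding layer_edges_Suc
    by (rule bern_Un) (use fin layer_edges_disjoint[OF assms(4)] in auto)
  also have "\<dots> \<le> bern (layer_edges L l) q (\<lambda>A. of_bool (\<not> forest A L l (b 1) ?s) + ?K)"
  proof (intro bern_mono assms)
    fix A
    show "bern (L l \<times> L (Suc l)) q (\<lambda>B. of_bool (\<not> disjoint_walks (A \<union> B) L (Suc l) k))
      \<le> of_bool (\<not> forest A L l (b 1) ?s) + ?K"
    proof (cases "forest A L l (b 1) ?s")
      case False
      have "0 \<le> ?K" using assms(8,9) by simp
      then show ?thesis using fin assms False by (intro bern_le_const) (auto intro: add_increasing2)
    next
      case True
      then show ?thesis
        using disjoint_walks_step[OF _ assms(2,11,8,9) True, of k] assms(3) by simp
    qed
  qed
  also have "\<dots> = bern (layer_edges L l) q (\<lambda>A. of_bool (\<not> forest A L l (b 1) ?s)) + ?K"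
    using fin by (simp add: bern_add)
  also have "\<dots> \<le> real l * Z * \<delta> + ?K"
    by (intro add_mono order_refl forest_chain[of L x]) (use assms sub in auto)
  finally show ?thesis .
qed

section \<open>Rainbow paths from layers\<close>

text \<open>Forgets the direction of a pair taken from consecutive layers. The value
  \<open>(0, 0)\<close> is a dummy for pairs on one side, which never occur between such
  layers.\<close>

definition bip_edge :: "(nat + nat) \<times> (nat + nat) \<Rightarrow> nat \<times> nat" where
  "bip_edge e = (case e of (Inl i, Inr j) \<Rightarrow> (i, j) | (Inr j, Inl i) \<Rightarrow> (i, j) | _ \<Rightarrow> (0, 0))"

text \<open>The condition of \<open>rainbow_k_colouring\<close> for a single pair, isolated for the
  union bound over pairs.\<close>

definition linked :: "(nat \<times> nat) set \<Rightarrow> (nat \<times> nat \<Rightarrow> nat) \<Rightarrow> nat \<Rightarrow> nat + nat \<Rightarrow> nat + nat \<Rightarrow> bool" where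
  "linked E c k u v \<longleftrightarrow> (\<exists>P :: nat \<Rightarrow> (nat + nat) list.
           (\<forall>i<k. is_path E (P i) u v \<and> rainbow c (P i)) \<and>
           (\<forall>i<k. \<forall>j<k. i \<noteq> j \<longrightarrow> P i \<noteq> P j \<and> interior (P i) \<inter> interior (P j) = {}))"

lemma bip_edge_iff:
  assumes "isl a \<noteq> isl b"
  shows "bip_adj E a b \<longleftrightarrow> bip_edge (a, b) \<in> E" "edge_col c a b = c (bip_edge (a, b))"
  using assms by (cases a; cases b; auto simp: bip_adj_def edge_col_def bip_edge_def)+

lemma bip_edge_eqD:
  assumes "bip_edge (a, b) = bip_edge (a', b')" "isl a \<noteq> isl b" "isl a' \<noteq> isl b'"
  shows "a = a' \<and> b = b' \<or> a = b' \<and> b = a'"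
  using assms by (cases a; cases b; cases a'; cases b') (auto simp: bip_edge_def)

text \<open>By \<open>side\<close> the layers alternate between \<open>U\<close> and
  \<open>V\<close>, starting from the side of \<open>x\<close>, so that consecutive layers span
  edges of the bipartite graph.\<close>

locale bip_layers =
  fixes m n l :: nat and x y :: "nat + nat" and L :: "nat \<Rightarrow> (nat + nat) set"
  assumes L0: "L 0 = {x}" and Ll: "L l = {y}" and l2: "2 \<le> l"
    and disj: "disjoint_family_on L {..l}"
    and verts: "\<And>i. i \<le> l \<Longrightarrow> L i \<subseteq> bip_verts m n"
    and side: "\<And>i v. i \<le> l \<Longrightarrow> v \<in> L i \<Longrightarrow> isl v \<longleftrightarrow> (isl x \<longleftrightarrow> even i)"
begin

abbreviation "H \<equiv> layer_edges L l"

text \<open>The colour prescribed for an edge. Edges outside the layers get the default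
  \<open>0\<close>, so that the value is always an available colour, as thinning demands of every
  edge.\<close>

definition layer_index :: "nat \<times> nat \<Rightarrow> nat" where
  "layer_index e = (if \<exists>i<l. e \<in> bip_edge ` (L i \<times> L (Suc i))
     then LEAST i. e \<in> bip_edge ` (L i \<times> L (Suc i)) else 0)"

lemma layer_unique: "i \<le> l \<Longrightarrow> j \<le> l \<Longrightarrow> v \<in> L i \<Longrightarrow> v \<in> L j \<Longrightarrow> i = j"
  using disj by (auto simp: disjoint_family_on_def)

lemma side_Suc: "i < l \<Longrightarrow> a \<in> L i \<Longrightarrow> b \<in> L (Suc i) \<Longrightarrow> isl a \<noteq> isl b"
  using side[of i a] side[of "Suc i" b] by auto

text \<open>The same edge could arise only from equal or from reversed pairs. Reversal would give
  both \<open>i = Suc j\<close> and \<open>Suc i = j\<close>.\<close>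

lemma edge_layers_eq:
  assumes "i < l" "j < l" "a \<in> L i" "b \<in> L (Suc i)" "a' \<in> L j" "b' \<in> L (Suc j)"
    "bip_edge (a, b) = bip_edge (a', b')"
  shows "i = j \<and> a = a' \<and> b = b'"
proof -
  from bip_edge_eqD[OF assms(7) side_Suc[OF assms(1,3,4)] side_Suc[OF assms(2,5,6)]]
  show ?thesis
  proof
    assume "a = a' \<and> b = b'"
    then show ?thesis using layer_unique[of i j a] assms by auto
  next
    assume "a = b' \<and> b = a'"
    then have "i = Suc j" "Suc i = j"
      using layer_unique[of i "Suc j" a] layer_unique[of "Suc i" j b] assms by auto
    then show ?thesis by simp
  qed
qed

lemma inj_bip_edge: "inj_on bip_edge H"
proof (rule inj_onI)
  fix e f assume "e \<in> H" "f \<in> H" "bip_edge e = bip_edge f"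
  then obtain i j where "i < l" "j < l" "e \<in> L i \<times> L (Suc i)" "f \<in> L j \<times> L (Suc j)"
    by (auto simp: layer_edges_def)
  then show "e = f" using edge_layers_eq[of i j "fst e" "snd e" "fst f" "snd f"] \<open>bip_edge e = bip_edge f\<close>
    by (auto simp: prod_eq_iff)
qed

lemma layer_index: assumes "i < l" "a \<in> L i" "b \<in> L (Suc i)" shows "layer_index (bip_edge (a, b)) = i"
proof -
  have 1: "bip_edge (a, b) \<in> bip_edge ` (L i \<times> L (Suc i))" using assms by auto
  have 2: "j = i" if "j \<le> i" "bip_edge (a, b) \<in> bip_edge ` (L j \<times> L (Suc j))" for j
  proof -
    obtain a' b' where "a' \<in> L j" "b' \<in> L (Suc j)" "bip_edge (a, b) = bip_edge (a', b')"
      using \<open>bip_edge (a, b) \<in> bip_edge ` (L j \<times> L (Suc j))\<close> by blast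
    then show ?thesis using edge_layers_eq[of i j a b a' b'] assms that(1) by simp
  qed
  have "(LEAST i. bip_edge (a, b) \<in> bip_edge ` (L i \<times> L (Suc i))) = i"
  proof (rule Least_equality[where P="\<lambda>i. bip_edge (a, b) \<in> bip_edge ` (L i \<times> L (Suc i))", OF 1])
    fix j assume "bip_edge (a, b) \<in> bip_edge ` (L j \<times> L (Suc j))"
    then show "i \<le> j" using 2[of j] by linarith
  qed
  then show ?thesis using 1 assms(1) unfolding layer_index_def by auto
qed

lemma layer_index_less: "layer_index e < l"
proof (cases "\<exists>i<l. e \<in> bip_edge ` (L i \<times> L (Suc i))")
  case True
  then obtain i where i: "i < l" "e \<in> bip_edge ` (L i \<times> L (Suc i))" by blast
  then show ?thesis using layer_index[of i] by auto
next
  case False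
  then have "layer_index e = 0" unfolding layer_index_def by (simp only: if_False)
  then show ?thesis using l2 by simp
qed

lemma bip_edge_in: "bip_edge ` H \<subseteq> {..<m} \<times> {..<n}"
proof
  fix e assume "e \<in> bip_edge ` H"
  then obtain i a b where *: "i < l" "a \<in> L i" "b \<in> L (Suc i)" "e = bip_edge (a, b)"
    by (auto simp: layer_edges_def)
  then have "a \<in> bip_verts m n" "b \<in> bip_verts m n" "isl a \<noteq> isl b"
    using verts[of i] verts[of "Suc i"] side_Suc by auto
  then show "e \<in> {..<m} \<times> {..<n}" unfolding *(4)
    by (cases a; cases b) (auto simp: bip_edge_def bip_verts_def)
qed

text \<open>The colours along such a walk are exactly \<open>0, ..., l - 1\<close>, hence distinct;
  disjoint layers make the vertices distinct. The interior is nonempty because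
  \<open>2 \<le> l\<close>.\<close>

lemma layered_imp_path:
  assumes "layered {e \<in> H. bip_edge e \<in> E \<and> c (bip_edge e) = layer_index (bip_edge e)} L l zs"
  shows "is_path E zs x y" "rainbow c zs" "interior zs \<noteq> {}"
proof -
  have len: "length zs = Suc l" and zL: "\<And>i. i \<le> l \<Longrightarrow> zs ! i \<in> L i"
    and zA: "\<And>i. i < l \<Longrightarrow> bip_edge (zs ! i, zs ! Suc i) \<in> E \<and>
       c (bip_edge (zs ! i, zs ! Suc i)) = layer_index (bip_edge (zs ! i, zs ! Suc i))"
    using assms by (auto simp: layered_def)
  have sides: "isl (zs ! i) \<noteq> isl (zs ! Suc i)" if "i < l" for i
    using side_Suc[OF that] zL[of i] zL[of "Suc i"] that by auto
  have ne: "zs \<noteq> []" using len by auto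
  have "hd zs = x" using zL[of 0] L0 len by (simp add: hd_conv_nth ne)
  moreover have "last zs = y" using zL[of l] Ll len by (simp add: last_conv_nth ne)
  moreover have "distinct zs"
    unfolding distinct_conv_nth
  proof (intro allI impI)
    fix i j assume "i < length zs" "j < length zs" "i \<noteq> j"
    then show "zs ! i \<noteq> zs ! j" using layer_unique[of i j "zs ! i"] zL[of i] zL[of j] len by auto
  qed
  ultimately show "is_path E zs x y"
    using len l2 zA sides bip_edge_iff(1) unfolding is_path_def by simp
  have "edge_col c (zs ! i) (zs ! Suc i) = i" if "i < l" for i
    using that zA[OF that] bip_edge_iff(2)[OF sides[OF that]]
      layer_index[OF that, of "zs ! i" "zs ! Suc i"] zL[of i] zL[of "Suc i"] by simp
  then have "map (\<lambda>i. edge_col c (zs ! i) (zs ! Suc i)) [0..<length zs - 1] = [0..<l]"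
    using len by (intro nth_equalityI) auto
  then show "rainbow c zs" unfolding rainbow_def by simp
  have "length (butlast (tl zs)) \<noteq> 0" using len l2 by simp
  then have "butlast (tl zs) \<noteq> []" by (intro notI) (simp only: list.size)
  then show "interior zs \<noteq> {}" by (simp add: interior_def)
qed

text \<open>Averaging over colourings, the edges of prescribed colour form a random set of density
  \<open>p / r\<close>, and disjoint layered walks in it are disjoint rainbow paths. Injectivity of
  \<open>bip_edge\<close> then carries the random edge set over to pairs between consecutive
  layers.\<close>

lemma linked_prob:
  assumes "0 \<le> p" "p \<le> 1" "l \<le> r"
  shows "avg_col ({..<m} \<times> {..<n}) r (\<lambda>c. bern ({..<m} \<times> {..<n}) p (\<lambda>E. of_bool (\<not> linked E c k x y)))
    \<le> bern H (p / real r) (\<lambda>A. of_bool (\<not> disjoint_walks A L l k))"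
proof -
  let ?S = "{..<m} \<times> {..<n}"
  define F where "F = (\<lambda>X. of_bool (\<not> disjoint_walks {e \<in> H. bip_edge e \<in> X} L l k) :: real)"
  have fin: "finite (L i)" if "i \<le> l" for i
    by (rule finite_subset[OF verts[OF that]]) (simp add: bip_verts_def)
  have finH: "finite H" using fin by (rule finite_layer_edges)
  have "linked E c k x y"
    if walks: "disjoint_walks {e \<in> H. bip_edge e \<in> {e \<in> E. c e = layer_index e}} L l k" for E c
  proof -
    obtain P :: "nat \<Rightarrow> (nat + nat) list" where P:
      "\<And>i. i < k \<Longrightarrow> layered {e \<in> H. bip_edge e \<in> E \<and> c (bip_edge e) = layer_index (bip_edge e)} L l (P i)"
      "\<And>i j. i < k \<Longrightarrow> j < k \<Longrightarrow> i \<noteq> j \<Longrightarrow> interior (P i) \<inter> interior (P j) = {}"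
      using walks unfolding disjoint_walks_def interior_def mem_Collect_eq by blast
    \<comment> \<open>Disjoint nonempty interiors force the paths to be different.\<close>
    have "P i \<noteq> P j" if "i < k" "j < k" "i \<noteq> j" for i j
      using P(2)[OF that] layered_imp_path(3)[OF P(1)[OF that(1)]] by auto
    then show ?thesis unfolding linked_def using layered_imp_path(1,2)[OF P(1)] P(2)
      by (intro exI[of _ P] conjI allI impI) simp_all
  qed
  then have "avg_col ?S r (\<lambda>c. bern ?S p (\<lambda>E. of_bool (\<not> linked E c k x y)))
    \<le> avg_col ?S r (\<lambda>c. bern ?S p (\<lambda>E. F {e \<in> E. c e = layer_index e}))"
    unfolding F_def by (intro avg_col_mono bern_mono assms of_bool_mono) blast
  also have "\<dots> = bern ?S (p / real r) F"
  proof (rule avg_col_thin)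
    show "layer_index e < r" for e using layer_index_less[of e] assms(3) by simp
  qed (use assms l2 in auto)
  also have "\<dots> = bern ?S (p / real r) (\<lambda>X. F (X \<inter> bip_edge ` H))"
  proof -
    have "{e \<in> H. bip_edge e \<in> X} = {e \<in> H. bip_edge e \<in> X \<inter> bip_edge ` H}" for X by auto
    then have "F X = F (X \<inter> bip_edge ` H)" for X unfolding F_def by simp
    then show ?thesis by simp
  qed
  also have "\<dots> = bern (bip_edge ` H) (p / real r) F"
    using bip_edge_in by (intro bern_restrict) auto
  also have "\<dots> = bern H (p / real r) (\<lambda>A. F (bip_edge ` A))"
    by (rule bern_image[OF finH inj_bip_edge])
  also have "\<dots> = bern H (p / real r) (\<lambda>A. of_bool (\<not> disjoint_walks A L l k))"
  proof (intro bern_cong)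
    fix A assume "A \<subseteq> H"
    then have "{e \<in> H. bip_edge e \<in> bip_edge ` A} = A"
      using inj_on_image_mem_iff[OF inj_bip_edge _ \<open>A \<subseteq> H\<close>] by blast
    then show "F (bip_edge ` A) = of_bool (\<not> disjoint_walks A L l k)" by (simp add: F_def)
  qed
  finally show ?thesis .
qed

end

text \<open>Averaging over the colourings replaces the existence of a good colouring.\<close>
lemma rc_gt_prob:
  assumes "0 \<le> p" "p \<le> 1" "r > 0"
    and pair: "\<And>x y. x \<in> bip_verts m n \<Longrightarrow> y \<in> bip_verts m n \<Longrightarrow> x \<noteq> y \<Longrightarrow>
      avg_col ({..<m} \<times> {..<n}) r
        (\<lambda>c. bern ({..<m} \<times> {..<n}) p (\<lambda>E. of_bool (\<not> linked E c k x y))) \<le> \<eta>"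
    and "0 \<le> \<eta>"
  shows "1 - rb_prob m n p (\<lambda>E. rc m n k E \<le> enat r) \<le> (real (m + n))\<^sup>2 * \<eta>"
proof -
  let ?S = "{..<m} \<times> {..<n}"
  let ?Q = "\<lambda>E. rc m n k E \<le> enat r"
  define PP where "PP = {(x, y). x \<in> bip_verts m n \<and> y \<in> bip_verts m n \<and> x \<noteq> y}"
  have PP: "PP \<subseteq> bip_verts m n \<times> bip_verts m n" by (auto simp: PP_def)
  have finV: "finite (bip_verts m n)" by (simp add: bip_verts_def)
  have cardV: "card (bip_verts m n) = m + n"
    unfolding bip_verts_def by (subst card_Un_disjoint) (auto simp: card_image)
  have finPP: "finite PP" using finite_subset[OF PP] finV by auto
  have "card PP \<le> (m + n)\<^sup>2"
    using card_mono[OF _ PP] finV by (simp add: card_cartesian_product cardV power2_eq_square)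
  then have cardPP: "real (card PP) \<le> (real (m + n))\<^sup>2" by (metis of_nat_le_iff of_nat_power)
  have "1 - rb_prob m n p ?Q = bern ?S p (\<lambda>E. of_bool (\<not> ?Q E))"
  proof -
    have "bern ?S p (\<lambda>E. of_bool (\<not> ?Q E)) = bern ?S p (\<lambda>E. 1 - of_bool (?Q E))"
      by (intro bern_cong) auto
    then show ?thesis by (simp add: rb_prob_eq_bern bern_diff)
  qed
  also have "\<dots> \<le> bern ?S p (\<lambda>E. avg_col ?S r (\<lambda>c. \<Sum>(x, y)\<in>PP. of_bool (\<not> linked E c k x y)))"
  proof (intro bern_mono assms)
    fix E assume E: "E \<subseteq> ?S"
    have nn: "0 \<le> (\<Sum>(x, y)\<in>PP. of_bool (\<not> linked E c k x y) :: real)" for c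
      by (auto intro!: sum_nonneg)
    \<comment> \<open>Every single colouring either witnesses that \<open>rc\<close> is at most
      \<open>r\<close> or leaves a pair of \<open>PP\<close> unlinked.\<close>
    have "avg_col ?S r (\<lambda>_. of_bool (\<not> ?Q E) :: real)
      \<le> avg_col ?S r (\<lambda>c. \<Sum>(x, y)\<in>PP. of_bool (\<not> linked E c k x y))"
    proof (rule avg_col_mono)
      fix c assume c: "c \<in> ?S \<rightarrow>\<^sub>E {..<r}"
      show "of_bool (\<not> ?Q E) \<le> (\<Sum>(x, y)\<in>PP. of_bool (\<not> linked E c k x y) :: real)"
      proof (cases "\<forall>(x, y)\<in>PP. linked E c k x y")
        case True
        have "\<forall>e\<in>E. c e < r" using c E by auto
        then have "rainbow_k_colouring m n E k r c"
          using True unfolding rainbow_k_colouring_def PP_def linked_def by blast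
        then have "rc m n k E \<le> enat r" unfolding rc_def by (intro INF_lower) auto
        then show ?thesis using nn by simp
      next
        case False
        then obtain x y where xy: "(x, y) \<in> PP" "\<not> linked E c k x y" by auto
        have "of_bool (\<not> ?Q E) \<le> (of_bool (\<not> linked E c k x y) :: real)" using xy by simp
        also have "\<dots> \<le> (\<Sum>(x, y)\<in>PP. of_bool (\<not> linked E c k x y))"
          using member_le_sum[of "(x, y)" PP "\<lambda>(x, y). of_bool (\<not> linked E c k x y) :: real"] xy finPP
          by auto
        finally show ?thesis .
      qed
    qed
    then show "of_bool (\<not> ?Q E) \<le> avg_col ?S r (\<lambda>c. \<Sum>(x, y)\<in>PP. of_bool (\<not> linked E c k x y) :: real)"
      using assms by simp
  qed
  also have "\<dots> = (\<Sum>(x, y)\<in>PP. avg_col ?S r (\<lambda>c. bern ?S p (\<lambda>E. of_bool (\<not> linked E c k x y))))"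
    by (simp add: case_prod_unfold avg_col_sum bern_sum avg_col_bern)
  also have "\<dots> \<le> (\<Sum>(x, y)\<in>PP. \<eta>)"
    by (intro sum_mono) (auto simp: PP_def intro!: pair)
  also have "\<dots> \<le> (real (m + n))\<^sup>2 * \<eta>" using cardPP assms(5) by (simp add: case_prod_unfold mult_right_mono)
  finally show ?thesis .
qed

text \<open>Use the largest possible branching until the product reaches \<open>X\<close>, then branching 1.\<close>
lemma greedy_branching:
  fixes \<beta> :: "nat \<Rightarrow> nat" and X :: real
  assumes "1 \<le> l" "1 \<le> X" "\<And>i. 1 \<le> i \<Longrightarrow> i \<le> l \<Longrightarrow> 1 \<le> \<beta> i" "X \<le> real (\<Prod>i\<in>{1..l}. \<beta> i)"
  shows "\<exists>b. (\<forall>i. 1 \<le> i \<longrightarrow> i \<le> l \<longrightarrow> 1 \<le> b i \<and> b i \<le> \<beta> i) \<and> X \<le> real (\<Prod>i\<in>{1..l}. b i) \<and>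
     real (\<Prod>i\<in>{1..l}. b i) \<le> 2 * X \<and> min (real (\<beta> 1)) X \<le> real (b 1)"
  using assms(1,3,4)
proof (induction l rule: dec_induct)
  case base
  define b1 where "b1 = nat \<lceil>X\<rceil>"
  have b1: "X \<le> real b1" "real b1 \<le> X + 1" using assms(2) unfolding b1_def by linarith+
  have "b1 \<le> \<beta> 1" using base(2) unfolding b1_def by (simp add: ceiling_le_iff nat_le_iff)
  moreover have "1 \<le> b1" using b1 assms(2) by simp
  ultimately show ?case using b1 assms(2) by (intro exI[of _ "\<lambda>_. b1"]) auto
next
  case (step l)
  have P: "prod f {1..Suc l} = prod f {1..l} * f (Suc l)" for f :: "nat \<Rightarrow> nat" by simp
  show ?case
  proof (cases "X \<le> real (\<Prod>i\<in>{1..l}. \<beta> i)")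
    case True
    then obtain b where b: "\<And>i. 1 \<le> i \<Longrightarrow> i \<le> l \<Longrightarrow> 1 \<le> b i \<and> b i \<le> \<beta> i" "X \<le> real (prod b {1..l})"
      "real (prod b {1..l}) \<le> 2 * X" "min (real (\<beta> 1)) X \<le> real (b 1)"
      using step.IH[OF _ True] step.prems(1) by auto
    let ?b = "b(Suc l := 1)"
    have "prod ?b {1..l} = prod b {1..l}" by (intro prod.cong) auto
    then have eq: "prod ?b {1..Suc l} = prod b {1..l}" unfolding P by simp
    have "1 \<le> ?b i \<and> ?b i \<le> \<beta> i" if "1 \<le> i" "i \<le> Suc l" for i
      using b(1)[of i] step.prems(1)[of i] that by (cases "i = Suc l") auto
    moreover have "?b 1 = b 1" using step.hyps by simp
    ultimately show ?thesis using b(2-4)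
      by (intro exI[of _ ?b]) (simp only: eq, blast)
  next
    case False
    define M where "M = prod \<beta> {1..l}"
    have M: "1 \<le> M" unfolding M_def using step.prems(1) by (intro prod_ge_1) auto
    \<comment> \<open>The full product \<open>M\<close> of the earlier factors is below
      \<open>X\<close>, so rounding up the last factor adds at most \<open>M\<close> and keeps the
      total below \<open>2 * X\<close>.\<close>
    define w where "w = nat \<lceil>X / M\<rceil>"
    have X0: "0 < X / M" using assms(2) M by simp
    then have w: "X / M \<le> real w" "real w \<le> X / M + 1" unfolding w_def by linarith+
    have "X / M \<le> real (\<beta> (Suc l))"
      using step.prems(2) M unfolding P M_def[symmetric] by (simp add: field_simps)
    then have w\<beta>: "w \<le> \<beta> (Suc l)" unfolding w_def by (simp add: ceiling_le_iff nat_le_iff)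
    have w1: "1 \<le> w" using w(1) X0 by (cases w) auto
    let ?b = "\<beta>(Suc l := w)"
    have "prod ?b {1..l} = prod \<beta> {1..l}" by (intro prod.cong) auto
    then have eq: "prod ?b {1..Suc l} = M * w" unfolding P M_def by simp
    have "1 \<le> ?b i \<and> ?b i \<le> \<beta> i" if "1 \<le> i" "i \<le> Suc l" for i
      using step.prems(1)[of i] that w1 w\<beta> by (cases "i = Suc l") auto
    moreover have "X \<le> real (M * w)" using w(1) M by (simp add: field_simps)
    moreover have "real (M * w) \<le> 2 * X"
    proof -
      have "real M * real w \<le> real M * (X / M + 1)" using w(2) by (intro mult_left_mono) auto
      also have "\<dots> = X + M" using M by (simp add: field_simps)
      finally show ?thesis using False unfolding M_def[symmetric] by simp
    qed
    moreover have "min (real (\<beta> 1)) X \<le> real (?b 1)" using step.hyps by simp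
    ultimately show ?thesis by (intro exI[of _ ?b]) (simp only: eq, blast)
  qed
qed

text \<open>Aim at between \<open>Z / q\<close> and \<open>2 * Z / q\<close> leaves, so that the
  expected number of leaves adjacent to \<open>y\<close> lies between \<open>Z\<close> and
  \<open>2 * Z\<close>. The bound \<open>G\<close> on the expected degrees into each layer makes the
  growth of the forest fail only with probability of order \<open>exp (- G / 8)\<close> per
  vertex.\<close>

lemma disjoint_walks_bound:
  fixes L :: "nat \<Rightarrow> 'v set" and q G Z :: real
  assumes "L 0 = {x}" "L (Suc l) = {y}" "\<And>i. i \<le> l \<Longrightarrow> finite (L i)" "disjoint_family_on L {..Suc l}"
    and "1 \<le> l" "0 < q" "q \<le> 1/2"
    and G: "\<And>i. 1 \<le> i \<Longrightarrow> i \<le> l \<Longrightarrow> G \<le> q * card (L i)" "16 \<le> G" "32 * Z \<le> G" and Z: "1 \<le> Z"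
    and prod: "Z / q \<le> (\<Prod>i\<in>{1..l}. q * card (L i) / 16)"
  shows "bern (layer_edges L (Suc l)) q (\<lambda>A. of_bool (\<not> disjoint_walks A L (Suc l) k))
    \<le> real l * (2 * Z / q) * exp (- G / 8) + 2 ^ k * exp (- Z / 4)"
proof -
  define X where "X = Z / q"
  \<comment> \<open>Branching is limited to an eighth of the expected degree: the lower tail
    \<open>exp (- q * card (L i) / 4)\<close> then absorbs \<open>2 ^ b i\<close> and leaves the
    exponent \<open>G / 8\<close>. As this eighth is at least \<open>2\<close>, rounding down costs
    at most a factor \<open>2\<close>, hence the \<open>16\<close> in the hypothesis.\<close>
  define \<beta> where "\<beta> = (\<lambda>i. nat \<lfloor>q * card (L i) / 8\<rfloor>)"
  have X: "2 * Z \<le> X" using assms(6,7) Z unfolding X_def by (simp add: field_simps mult_left_le)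
  have \<beta>: "q * card (L i) / 16 \<le> real (\<beta> i)" "real (\<beta> i) \<le> q * card (L i) / 8" "1 \<le> \<beta> i"
    if "1 \<le> i" "i \<le> l" for i
  proof -
    have "2 \<le> q * card (L i) / 8" using G(1)[OF that] G(2) by simp
    moreover have "q * card (L i) / 8 - 1 \<le> real (\<beta> i)" unfolding \<beta>_def by linarith
    ultimately show "q * card (L i) / 16 \<le> real (\<beta> i)" "1 \<le> \<beta> i" by linarith+
    show "real (\<beta> i) \<le> q * card (L i) / 8" unfolding \<beta>_def
      using assms(6) by (intro of_nat_floor) simp
  qed
  have "(\<Prod>i\<in>{1..l}. q * card (L i) / 16) \<le> (\<Prod>i\<in>{1..l}. real (\<beta> i))"
    using \<beta>(1) assms(6) by (intro prod_mono) auto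
  then have "X \<le> real (\<Prod>i\<in>{1..l}. \<beta> i)" using prod unfolding X_def by simp
  then obtain b where b: "\<And>i. 1 \<le> i \<Longrightarrow> i \<le> l \<Longrightarrow> 1 \<le> b i \<and> b i \<le> \<beta> i"
     "X \<le> real (\<Prod>i\<in>{1..l}. b i)" "real (\<Prod>i\<in>{1..l}. b i) \<le> 2 * X" "min (real (\<beta> 1)) X \<le> real (b 1)"
    using greedy_branching[OF assms(5) _ \<beta>(3) \<open>X \<le> real (\<Prod>i\<in>{1..l}. \<beta> i)\<close>] X Z by auto
  define Y where "Y = (\<lambda>i. \<Prod>j\<in>{1..i}. b j)"
  define R0 where "R0 = (\<lambda>i. card (L i) - Y i)"
  have Y: "real (Y i) \<le> 2 * X" if "i \<le> l" for i
  proof -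
    have "Y i dvd Y l" unfolding Y_def using that by (intro prod_dvd_prod_subset) auto
    moreover have "0 < Y l" unfolding Y_def using b(1) by (intro prod_pos) (auto simp: Suc_le_eq)
    ultimately have "Y i \<le> Y l" by (rule dvd_imp_le)
    then show ?thesis using b(3) unfolding Y_def by linarith
  qed
  \<comment> \<open>At most half of each layer is ever occupied: there are at most
    \<open>2 * X\<close> vertices, and \<open>32 * Z \<le> G\<close> yields
    \<open>4 * X \<le> card (L i)\<close>.\<close>
  have YL: "2 * real (Y i) \<le> card (L i)" if "1 \<le> i" "i \<le> l" for i
  proof -
    have "q * (4 * X) \<le> q * card (L i)"
      using G(1)[OF that] G(3) assms(6) Z unfolding X_def by simp
    then have "4 * X \<le> card (L i)" using assms(6) by simp
    then show ?thesis using Y[OF that(2)] by simp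
  qed
  let ?s = "\<Prod>j\<in>{2..l}. b j"
  have "bern (layer_edges L (Suc l)) q (\<lambda>A. of_bool (\<not> disjoint_walks A L (Suc l) k))
    \<le> real l * (2 * X) * exp (- G / 8) + 2 ^ k * ((1 + (1 - q) ^ ?s) / 2) ^ b 1"
  proof (rule disjoint_walks_prob[OF assms(1-4)])
    show "(\<Prod>j\<in>{1..i}. b j) + R0 i \<le> card (L i)" if "1 \<le> i" "i \<le> l" for i
    proof -
      have "Y i + R0 i \<le> card (L i)" using YL[OF that] unfolding R0_def by simp
      then show ?thesis by (simp only: Y_def)
    qed
    show "2 ^ b i * (1 - q / 2) ^ R0 i \<le> exp (- G / 8)" if "1 \<le> i" "i \<le> l" for i
    proof -
      have "(2::real) ^ b i \<le> exp 1 ^ b i"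
        using exp_ge_add_one_self[of 1] by (intro power_mono) auto
      also have "\<dots> = exp (b i)" by (simp add: exp_of_nat_mult[symmetric])
      also have "\<dots> \<le> exp (q * card (L i) / 8)" using b(1)[OF that] \<beta>(2)[OF that] by simp
      finally have 1: "(2::real) ^ b i \<le> exp (q * card (L i) / 8)" .
      have "(1 - q / 2) ^ R0 i \<le> exp (- q / 2) ^ R0 i"
        using assms(7) exp_ge_add_one_self[of "- q / 2"] by (intro power_mono) auto
      also have "\<dots> = exp (- (q / 2 * R0 i))" by (simp add: exp_of_nat_mult[symmetric])
      also have "\<dots> \<le> exp (- (q / 2 * (card (L i) / 2)))"
        using YL[OF that] assms(6) unfolding R0_def by (simp add: of_nat_diff)
      finally have 2: "(1 - q / 2) ^ R0 i \<le> exp (- (q * card (L i) / 4))" by simp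
      have "2 ^ b i * (1 - q / 2) ^ R0 i \<le> exp (q * card (L i) / 8) * exp (- (q * card (L i) / 4))"
        using 1 2 assms(7) by (intro mult_mono) auto
      also have "\<dots> \<le> exp (- G / 8)" using G(1)[OF that] by (simp add: exp_add[symmetric])
      finally show ?thesis .
    qed
    show "real (\<Prod>j\<in>{1..i}. b j) \<le> 2 * X" if "i \<le> l" for i using Y[OF that] by (simp only: Y_def)
  qed (use assms in auto)
  also have "((1 + (1 - q) ^ ?s) / 2) ^ b 1 \<le> exp (- Z / 4)"
  proof -
    define s where "s = ?s"
    have Ns: "b 1 * s = (\<Prod>j\<in>{1..l}. b j)"
      using assms(5) unfolding s_def by (subst (2) prod.atLeast_Suc_atMost) (auto simp: numeral_2_eq_2)
    \<comment> \<open>With at least \<open>2 * Z\<close> trees and at most \<open>2 * Z / q\<close>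
      leaves, a tree has \<open>q * s \<le> 1\<close>. In this range it is missed with probability
      at most \<open>1 - q * s / 2\<close>, so the hits on different trees do not lose more than a
      constant factor in the exponent.\<close>
    have "2 * Z \<le> real (\<beta> 1)" using \<beta>(1)[of 1] G(1)[of 1] G(3) assms(5) by simp
    then have N: "2 * Z \<le> real (b 1)" using b(4) X by linarith
    have bs: "q * (real (b 1) * real s) \<le> 2 * Z" "Z \<le> q * (real (b 1) * real s)"
      using b(2,3) assms(6) unfolding Ns[symmetric] X_def by (simp_all add: field_simps)
    have "real (b 1) * (q * s) \<le> real (b 1) * 1" using bs(1) N by (simp add: algebra_simps)
    then have qs: "q * s \<le> 1" "0 \<le> q * s" using N Z assms(6) by auto
    have "(1 - q) ^ s \<le> exp (- q) ^ s"
      using assms(7) exp_ge_add_one_self[of "- q"] by (intro power_mono) auto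
    also have "\<dots> = exp (- (q * s))" by (simp add: exp_of_nat_mult[symmetric] mult.commute)
    also have "\<dots> \<le> 1 - q * s / 2"
    proof -
      have "1 \<le> (1 + q * s) * (1 - q * s / 2)"
        using qs mult_nonneg_nonneg[of "q * s" "1 - q * s"] by (simp add: algebra_simps)
      also have "\<dots> \<le> exp (q * s) * (1 - q * s / 2)"
        using qs by (intro mult_right_mono) auto
      finally show ?thesis by (simp add: exp_minus field_simps)
    qed
    finally have "(1 + (1 - q) ^ s) / 2 \<le> 1 + (- (q * s / 4))" by simp
    also have "\<dots> \<le> exp (- (q * s / 4))" by (rule exp_ge_add_one_self)
    finally have "((1 + (1 - q) ^ s) / 2) ^ b 1 \<le> exp (- (q * s / 4)) ^ b 1"
      using assms(7) by (intro power_mono) auto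
    also have "\<dots> = exp (- (q * (real (b 1) * real s) / 4))"
      by (simp add: exp_of_nat_mult[symmetric] algebra_simps)
    also have "\<dots> \<le> exp (- Z / 4)" using bs(2) by simp
    finally show ?thesis unfolding s_def .
  qed
  finally show ?thesis unfolding X_def by (simp add: mult_left_mono)
qed

section \<open>Layers cut out as blocks of vertices\<close>

text \<open>Consecutive factors pair up to \<open>A * B\<close>, whichever comes first. Among the
  first \<open>d - 1\<close> factors a single one is left over when \<open>d\<close> is even, and it
  is at least \<open>A\<close>; all further factors are at least \<open>1\<close>.\<close>

lemma alternating_prod_ge:
  fixes A B :: real and c :: bool
  assumes "1 \<le> A" "A \<le> B" "1 \<le> d" "d - 1 \<le> l"
  shows "A ^ (d div 2) * B ^ ((d - 1) div 2) \<le> (\<Prod>i\<in>{1..l}. if c = even i then A else B)"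
proof -
  let ?f = "\<lambda>i::nat. if c = even i then A else B"
  have even: "prod ?f {1..2 * j} = A ^ j * B ^ j" for j
  proof (induction j)
    case (Suc j)
    have "2 * Suc j = Suc (Suc (2 * j))" by simp
    then show ?case using Suc by (auto simp: algebra_simps)
  qed simp
  have "A ^ (d div 2) * B ^ ((d - 1) div 2) \<le> prod ?f {1..d - 1}"
  proof (cases "odd d")
    case True
    then obtain j where "d = 2 * j + 1" by (rule oddE)
    then show ?thesis using even[of j] by simp
  next
    case False
    then obtain j where j: "d = 2 * Suc j" using assms(3)
      by (metis evenE mult_0_right not_one_le_zero old.nat.exhaust)
    have "A ^ Suc j * B ^ j \<le> prod ?f {1..2 * j} * ?f (Suc (2 * j))"
      unfolding even using assms(1,2) by (auto simp: algebra_simps mult_left_mono mult_right_mono)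
    then show ?thesis using j by simp
  qed
  also have "\<dots> \<le> prod ?f {1..l}"
    using assms by (intro prod_mono2) auto
  finally show ?thesis .
qed

text \<open>Inner layer \<open>i\<close> is the \<open>i\<close>-th block of consecutive vertices on
  the side that the parity of \<open>i\<close> dictates, so layers on the same side are disjoint
  too. Deleting \<open>x\<close> and \<open>y\<close> keeps the inner layers away from the two end
  layers wherever these lie.\<close>

definition block_layers :: "nat \<Rightarrow> nat \<Rightarrow> nat + nat \<Rightarrow> nat + nat \<Rightarrow> nat \<Rightarrow> nat \<Rightarrow> (nat + nat) set" where
  "block_layers wU wV x y l i = (if i = 0 then {x} else if i = l then {y} else
     (if isl x = even i then Inl ` {(i - 1) * wU..<i * wU} else Inr ` {(i - 1) * wV..<i * wV}) - {x, y})"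

lemma blocks_disjoint:
  assumes "v < i * w" "(j - Suc 0) * w \<le> v" "i < j"
  shows False
proof -
  have "i * w \<le> (j - Suc 0) * w" using assms(3) by (intro mult_right_mono) auto
  then show ?thesis using assms(1,2) by linarith
qed

lemma bip_layers_blocks:
  assumes "x \<in> bip_verts m n" "y \<in> bip_verts m n" "x \<noteq> y" "2 \<le> l" "l \<le> d + 1" "1 \<le> d"
    and "isl y \<longleftrightarrow> (isl x \<longleftrightarrow> even l)"
  shows "bip_layers m n l x y (block_layers (m div d) (n div d) x y l)"
proof
  let ?L = "block_layers (m div d) (n div d) x y l"
  show "?L 0 = {x}" "?L l = {y}" using assms(4) by (auto simp: block_layers_def)
  show "2 \<le> l" by fact
  have "?L i \<inter> ?L j = {}" if "i < j" "j \<le> l" for i j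
  proof (cases "i = 0 \<or> j = l")
    case True
    then show ?thesis using that assms(3) by (auto simp: block_layers_def)
  next
    case False
    then show ?thesis using that by (auto simp: block_layers_def dest: blocks_disjoint)
  qed
  then show "disjoint_family_on ?L {..l}"
    unfolding disjoint_family_on_def by (metis Int_commute atMost_iff nat_neq_iff)
  \<comment> \<open>From \<open>i < l \<le> d + 1\<close> there are at most \<open>d\<close> inner
    layers, and \<open>d\<close> blocks of width \<open>w div d\<close> fit.\<close>
  have blk: "i * (w div d) \<le> w" if "i < l" for i w
  proof -
    have "i * (w div d) \<le> d * (w div d)" using that assms(5) by (intro mult_right_mono) auto
    then show ?thesis by (metis order_trans times_div_less_eq_dividend)
  qed
  show "?L i \<subseteq> bip_verts m n" if "i \<le> l" for i
    using that assms(1,2) blk[of i m] blk[of i n]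
    by (cases "i = l") (auto simp: block_layers_def bip_verts_def)
  show "isl v \<longleftrightarrow> (isl x \<longleftrightarrow> even i)" if "i \<le> l" "v \<in> ?L i" for i v
    using that assms(7) by (cases "i = 0"; cases "i = l"; cases "isl x = even i") (auto simp: block_layers_def)
qed

lemma card_block_layers:
  assumes "1 \<le> i" "i < l" "4 * d \<le> m" "4 * d \<le> n" "1 \<le> d"
  shows "(if isl x = even i then real m else real n) / (4 * real d)
    \<le> real (card (block_layers (m div d) (n div d) x y l i))"
proof -
  have cd: "card B - 2 \<le> card (B - {x, y})" if "finite B" for B :: "(nat + nat) set"
  proof -
    have "card B - card {x, y} \<le> card (B - {x, y})" by (rule diff_card_le_card_Diff) simp
    moreover have "card {x, y} \<le> 2" by (simp add: card_insert_if)
    ultimately show ?thesis by linarith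
  qed
  have num: "real w / (4 * real d) \<le> real (w div d - 2)" if "4 * d \<le> w" for w
  proof -
    have "w mod d < d" using assms(5) by simp
    moreover have "w = d * (w div d) + w mod d" by simp
    ultimately have "w < d * (w div d) + d" by linarith
    then have "real w < real (d * (w div d) + d)" by (simp only: of_nat_less_iff)
    then have "real w / d < real (w div d) + 1" using assms(5) by (simp add: field_simps)
    moreover have "4 \<le> real w / d"
    proof -
      have "real (4 * d) \<le> real w" using that by (simp only: of_nat_le_iff)
      then show ?thesis using assms(5) by (simp add: field_simps)
    qed
    \<comment> \<open>Rounding and deleting two vertices together cost at most \<open>3\<close>, and
      \<open>t - 3 \<ge> t / 4\<close> for \<open>t \<ge> 4\<close>.\<close>
    moreover have "t / 4 \<le> f - 2" if "t < f + 1" "4 \<le> t" for t f :: real using that by simp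
    ultimately have "real w / d / 4 \<le> real (w div d) - 2" by blast
    then show ?thesis by (simp add: of_nat_diff field_simps)
  qed
  have blk: "i * w - (i - 1) * w = w" for w
    using assms(1) by (cases i) auto
  show ?thesis
  proof (cases "isl x = even i")
    case True
    have "card (Inl ` {(i - 1) * (m div d)..<i * (m div d)} :: (nat + nat) set) = m div d"
      by (subst card_image) (simp_all only: inj_Inl card_atLeastLessThan blk)
    then have "m div d - 2 \<le> card (block_layers (m div d) (n div d) x y l i)"
      using cd[of "Inl ` {(i - 1) * (m div d)..<i * (m div d)}"] assms True
      by (simp add: block_layers_def)
    then show ?thesis using num[OF assms(3)] True by (simp del: of_nat_diff)
  next
    case False
    have "card (Inr ` {(i - 1) * (n div d)..<i * (n div d)} :: (nat + nat) set) = n div d"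
      by (subst card_image) (simp_all only: inj_Inr card_atLeastLessThan blk)
    then have "n div d - 2 \<le> card (block_layers (m div d) (n div d) x y l i)"
      using cd[of "Inr ` {(i - 1) * (n div d)..<i * (n div d)}"] assms False
      by (simp add: block_layers_def)
    then show ?thesis using num[OF assms(4)] False by (simp del: of_nat_diff)
  qed
qed

text \<open>The sides of \<open>x\<close> and \<open>y\<close> fix the parity of the path length, so
  exactly one of \<open>d\<close> and \<open>d + 1\<close> serves as \<open>l\<close>; both are
  within the number of colours. The constant \<open>64\<close> combines the \<open>4\<close> of
  \<open>card_block_layers\<close> with the \<open>16\<close> of
  \<open>disjoint_walks_bound\<close>.\<close>

lemma linked_pair_bound:
  fixes m n d k :: nat and p Z :: real
  defines "q \<equiv> p / real (d + 1)"
  defines "A \<equiv> q * real m / (64 * real d)" and "B \<equiv> q * real n / (64 * real d)"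
  assumes xy: "x \<in> bip_verts m n" "y \<in> bip_verts m n" "x \<noteq> y"
    and d: "2 \<le> d" and p: "0 < p" "p \<le> 1" and mn: "m \<le> n" "4 * d \<le> m"
    and Z: "1 \<le> Z" "2 * Z \<le> A" and prod: "Z / q \<le> A ^ (d div 2) * B ^ ((d - 1) div 2)"
  shows "avg_col ({..<m} \<times> {..<n}) (d + 1)
      (\<lambda>c. bern ({..<m} \<times> {..<n}) p (\<lambda>E. of_bool (\<not> linked E c k x y)))
    \<le> real d * (2 * Z / q) * exp (- 2 * A) + 2 ^ k * exp (- Z / 4)"
proof -
  obtain l where l: "d \<le> l" "l \<le> d + 1" "isl y \<longleftrightarrow> (isl x \<longleftrightarrow> even l)"
  proof (cases "isl y \<longleftrightarrow> (isl x \<longleftrightarrow> even d)")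
    case True
    then show ?thesis using that[of d] by simp
  next
    case False
    then show ?thesis using that[of "d + 1"] by auto
  qed
  define L where "L = block_layers (m div d) (n div d) x y l"
  interpret bip_layers m n l x y L
    unfolding L_def by (rule bip_layers_blocks) (use xy d l in auto)
  obtain l' where l': "l = Suc l'" "1 \<le> l'" using l d by (cases l) auto
  have q: "0 < q" "q \<le> 1/2" using p d unfolding q_def by (auto simp: field_simps)
  have AB: "1 \<le> A" "A \<le> B"
  proof -
    show "1 \<le> A" using Z by linarith
    show "A \<le> B" using mn q unfolding A_def B_def by (intro divide_right_mono mult_left_mono) auto
  qed
  have cardL: "(if isl x = even i then 16 * A else 16 * B) \<le> q * card (L i)" if "1 \<le> i" "i \<le> l'" for i
  proof -
    have "q * ((if isl x = even i then real m else real n) / (4 * real d)) \<le> q * card (L i)"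
      using card_block_layers[of i l d m n x y] that l' d mn q unfolding L_def
      by (intro mult_left_mono) auto
    then show ?thesis using d unfolding A_def B_def by (auto simp: field_simps split: if_splits)
  qed
  have "avg_col ({..<m} \<times> {..<n}) (d + 1)
      (\<lambda>c. bern ({..<m} \<times> {..<n}) p (\<lambda>E. of_bool (\<not> linked E c k x y)))
    \<le> bern (layer_edges L (Suc l')) q (\<lambda>A. of_bool (\<not> disjoint_walks A L (Suc l') k))"
    using linked_prob[of p "d + 1" k] p l unfolding q_def l' by simp
  also have "\<dots> \<le> real l' * (2 * Z / q) * exp (- (16 * A) / 8) + 2 ^ k * exp (- Z / 4)"
  proof (rule disjoint_walks_bound)
    show "L 0 = {x}" by (rule L0)
    show "L (Suc l') = {y}" using Ll l' by simp
    show "finite (L i)" if "i \<le> l'" for i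
      using verts[of i] that l' by (intro finite_subset[of "L i" "bip_verts m n"]) (auto simp: bip_verts_def)
    show "disjoint_family_on L {..Suc l'}" using disj l' by simp
    show "16 * A \<le> q * card (L i)" if "1 \<le> i" "i \<le> l'" for i
      using cardL[OF that] AB by (auto split: if_splits)
    have "Z / q \<le> (\<Prod>i\<in>{1..l'}. if isl x = even i then A else B)"
    proof (rule order_trans[OF prod alternating_prod_ge[OF AB]])
      show "1 \<le> d" "d - 1 \<le> l'" using d l l' by linarith+
    qed
    also have "\<dots> \<le> (\<Prod>i\<in>{1..l'}. q * card (L i) / 16)"
    proof (intro prod_mono conjI)
      fix i assume "i \<in> {1..l'}"
      then show "(if isl x = even i then A else B) \<le> q * card (L i) / 16"
        using cardL[of i] by (auto split: if_splits)
    qed (use AB in auto)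
    finally show "Z / q \<le> (\<Prod>i\<in>{1..l'}. q * card (L i) / 16)" .
  qed (use l' q AB Z in auto)
  also have "real l' * (2 * Z / q) * exp (- (16 * A) / 8) \<le> real d * (2 * Z / q) * exp (- 2 * A)"
    using l l' Z q by (intro mult_mono) auto
  finally show ?thesis by simp
qed

section \<open>Monotonicity in the edges and in the edge probability\<close>

text \<open>The additional edges receive colour \<open>0\<close>; all paths within \<open>A\<close>
  keep their colours.\<close>

lemma rc_mono:
  assumes "rc m n k A \<le> enat r" "A \<subseteq> B" "r > 0"
  shows "rc m n k B \<le> enat r"
proof -
  obtain r' c where r': "rainbow_k_colouring m n A k r' c" "r' \<le> r"
    using assms(1) by (rule rc_leE)
  define c' where "c' = (\<lambda>e. if e \<in> A then c e else 0)"
  have path: "is_path B xs u v" "rainbow c' xs" if "is_path A xs u v" "rainbow c xs" for xs u v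
  proof -
    have adj: "bip_adj A (xs ! i) (xs ! Suc i)" if "i < length xs - 1" for i
      using \<open>is_path A xs u v\<close> that by (auto simp: is_path_def)
    have "bip_adj B a b" "edge_col c' a b = edge_col c a b" if "bip_adj A a b" for a b
      using that assms(2) by (cases a; cases b; auto simp: bip_adj_def edge_col_def c'_def)+
    note B = this
    show "is_path B xs u v" using that(1) adj B(1) by (auto simp: is_path_def)
    have "map (\<lambda>i. edge_col c' (xs ! i) (xs ! Suc i)) [0..<length xs - 1]
      = map (\<lambda>i. edge_col c (xs ! i) (xs ! Suc i)) [0..<length xs - 1]"
      by (rule map_cong[OF refl], rule B(2), rule adj) simp
    then show "rainbow c' xs" using that(2) by (simp only: rainbow_def)
  qed
  have "rainbow_k_colouring m n B k r c'"
    unfolding rainbow_k_colouring_def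
  proof (intro conjI ballI impI)
    show "c' e < r" if "e \<in> B" for e
      using r' assms(3) unfolding rainbow_k_colouring_def c'_def by (auto intro: less_le_trans)
    fix u v assume "u \<in> bip_verts m n" "v \<in> bip_verts m n" "u \<noteq> v"
    then obtain P :: "nat \<Rightarrow> (nat + nat) list" where "\<forall>i<k. is_path A (P i) u v \<and> rainbow c (P i)"
      "\<forall>i<k. \<forall>j<k. i \<noteq> j \<longrightarrow> P i \<noteq> P j \<and> interior (P i) \<inter> interior (P j) = {}"
      using r'(1) unfolding rainbow_k_colouring_def by blast
    then show "\<exists>P :: nat \<Rightarrow> (nat + nat) list. (\<forall>i<k. is_path B (P i) u v \<and> rainbow c' (P i)) \<and>
      (\<forall>i<k. \<forall>j<k. i \<noteq> j \<longrightarrow> P i \<noteq> P j \<and> interior (P i) \<inter> interior (P j) = {})"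
      using path by (intro exI[of _ P]) blast
  qed
  then show ?thesis unfolding rc_def by (intro INF_lower) auto
qed

lemma rb_prob_mono:
  assumes "0 \<le> p" "p \<le> p'" "p' \<le> 1" "r > 0"
  shows "rb_prob m n p (\<lambda>E. rc m n k E \<le> enat r) \<le> rb_prob m n p' (\<lambda>E. rc m n k E \<le> enat r)"
  unfolding rb_prob_eq_bern using assms
  by (intro bern_mono_p of_bool_mono) (auto intro: rc_mono)

section \<open>Threshold estimates\<close>

lemma div2_add_pred_div2: "(d div 2) + ((d - 1) div 2) = d - 1" for d :: nat
  by presburger

text \<open>Applies \<open>rb_prob_rc_le\<close> with about \<open>n\<close> to the power
  \<open>\<delta>\<close> targets and with the degree bounds \<open>3 * (P * n)\<close> and
  \<open>3 * (P * m)\<close>, where \<open>P = c * ps\<close> dominates \<open>p\<close>. The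
  constant \<open>c\<close> is small enough for a target to escape with probability at least
  \<open>real n powr (- (\<delta> / 2))\<close>.\<close>

lemma below_threshold_bound:
  fixes m n d k :: nat and p ps c \<delta> :: real
  defines "h \<equiv> (d - 1) div 2" and "lg \<equiv> log 2 (real n)"
  assumes d: "2 \<le> d" and k: "1 \<le> k" and p: "0 \<le> p" "p \<le> c * ps" "c * ps \<le> 1/2"
    and c: "0 < c" "c \<le> 1" "8 * (6 * (real h + 1) * 9 ^ h) * c \<le> \<delta>" and \<delta>: "\<delta> \<le> 1/8" "0 < \<delta>"
    and mn: "1 \<le> m" "m \<le> n" "2 \<le> n"
    and ps: "0 < ps" "lg ^ 4 \<le> ps * m" "1 \<le> c * lg ^ 4" "real n powr (4 * \<delta>) \<le> ps * n"
      "ps ^ d * real m ^ (d div 2) * real n ^ h \<le> 2 * lg"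
  shows "rb_prob m n p (\<lambda>E. rc m n k E \<le> enat (d + 1))
    \<le> 2 * real n * exp (- c * lg ^ 4) + exp (- (real n powr (\<delta> / 2) / 2))
      + (2 * real h * 9 ^ h / c) * (lg * real n powr (- 2 * \<delta>))"
proof -
  define P where "P = c * ps"
  define s where "s = nat \<lfloor>real n powr \<delta>\<rfloor>"
  define \<sigma> where "\<sigma> = (if odd d then 1 else P * m)"
  have P: "0 < P" "p \<le> P" "P \<le> 1/2" using p c ps by (auto simp: P_def)
  have lg0: "0 < lg" using mn unfolding lg_def by simp
  have Pm': "c * lg ^ 4 \<le> P * m" unfolding P_def using ps(2) c by (simp add: mult.assoc)
  then have Pm: "1 \<le> P * m" using ps(3) by linarith
  have "P * m \<le> P * n" using P mn by (intro mult_left_mono) auto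
  then have Pn: "1 \<le> P * n" "c * lg ^ 4 \<le> P * n" using Pm Pm' by linarith+
  have \<sigma>: "1 \<le> \<sigma>" using Pm by (simp add: \<sigma>_def)
  have cd: "c ^ d \<le> c" using c d power_decreasing[of 1 d c] by simp
  \<comment> \<open>One estimate for both parities: for odd \<open>d\<close> one has
    \<open>2 * h + 1 = d\<close>, and for even \<open>d\<close> the missing factor
    \<open>P * m\<close> is \<open>\<sigma>\<close>, the size scale of the start set. Bounding
    \<open>c ^ d\<close> by \<open>c\<close> makes the right side proportional to
    \<open>c\<close>.\<close>
  have size: "P ^ (2 * h + 1) * real m ^ h * real n ^ h * \<sigma> \<le> 2 * c * lg"
  proof -
    have "P ^ (2 * h + 1) * real m ^ h * real n ^ h * \<sigma> = P ^ d * real m ^ (d div 2) * real n ^ h"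
    proof (cases "odd d")
      case True
      then obtain j where "d = 2 * j + 1" by (rule oddE)
      then show ?thesis by (simp add: h_def \<sigma>_def)
    next
      case False
      then obtain j where j: "d = 2 * j" by (auto elim: evenE)
      then obtain i where "j = Suc i" using d by (cases j) auto
      then show ?thesis using False j by (simp add: h_def \<sigma>_def algebra_simps)
    qed
    also have "\<dots> = c ^ d * (ps ^ d * real m ^ (d div 2) * real n ^ h)"
      by (simp add: P_def power_mult_distrib)
    also have "\<dots> \<le> c * (2 * lg)" by (rule mult_mono[OF cd ps(5)]) (use ps c in auto)
    finally show ?thesis by simp
  qed
  have pow: "(3 * (P * n) * (3 * (P * m))) ^ j = 9 ^ j * P ^ (2 * j) * real m ^ j * real n ^ j" for j
  proof -
    have "3 * (P * n) * (3 * (P * m)) = 9 * P\<^sup>2 * m * n" by (simp add: power2_eq_square)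
    then show ?thesis by (simp only: power_mult_distrib power_mult)
  qed
  have npow: "1 \<le> real n powr \<delta>" using mn \<delta> by (intro ge_one_powr_ge_zero) auto
  have s: "real s \<le> real n powr \<delta>" "real n powr \<delta> / 2 \<le> real s" "s < n"
  proof -
    show 1: "real s \<le> real n powr \<delta>" unfolding s_def by (intro of_nat_floor) simp
    have "real n powr \<delta> - 1 \<le> real s" "1 \<le> real s"
      using npow le_nat_floor[of 1 "real n powr \<delta>"] unfolding s_def by linarith+
    then show "real n powr \<delta> / 2 \<le> real s" by linarith
    have "real n powr \<delta> < real n powr 1" using mn \<delta> by (intro powr_less_mono) auto
    then show "s < n" using 1 mn by simp
  qed
  have "rb_prob m n p (\<lambda>E. rc m n k E \<le> enat (d + 1))
    \<le> real m * (exp (p * n) * 2 powr (- (3 * (P * n)))) + real n * (exp (p * m) * 2 powr (- (3 * (P * m))))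
      + exp (- (real s * exp (- 2 * p * (real (h + 1) * (if odd d then 1 else 3 * (P * m)) * (3 * (P * n) * (3 * (P * m))) ^ h))))
      + (real s)\<^sup>2 * (real m * (real h * (3 * (P * n) * (3 * (P * m))) ^ (h - 1))) * p\<^sup>2"
    unfolding h_def by (rule rb_prob_rc_le) (use p P d k mn s Pm Pn in auto)
  also have "\<dots> \<le> real n * exp (- c * lg ^ 4) + real n * exp (- c * lg ^ 4)
     + exp (- (real n powr (\<delta> / 2) / 2)) + (2 * real h * 9 ^ h / c) * (lg * real n powr (- 2 * \<delta>))"
  proof (intro add_mono)
    \<comment> \<open>The factor \<open>3\<close> in the degree bounds works because
      \<open>3 * ln 2 \<ge> 2\<close>, which leaves \<open>P * w\<close> to spare after absorbing
      \<open>p * w\<close>.\<close>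
    have deg: "exp (p * w) * 2 powr (- (3 * (P * w))) \<le> exp (- c * lg ^ 4)"
      if "c * lg ^ 4 \<le> P * w" "0 \<le> w" for w
    proof -
      have "p * w \<le> P * w" using P that by (intro mult_right_mono) auto
      moreover have "2 * (P * w) \<le> 3 * (P * w) * ln 2"
        using P that ln2_ge_two_thirds mult_left_mono[of "2/3" "ln 2" "3 * (P * w)"] by simp
      ultimately have "p * w - 3 * (P * w) * ln 2 \<le> - (c * lg ^ 4)" using that by linarith
      moreover have "exp (p * w) * 2 powr (- (3 * (P * w))) = exp (p * w - 3 * (P * w) * ln 2)"
        by (simp add: powr_def exp_add[symmetric])
      ultimately show ?thesis by simp
    qed
    show "real m * (exp (p * n) * 2 powr (- (3 * (P * n)))) \<le> real n * exp (- c * lg ^ 4)"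
      using deg[of "real n"] Pn mn by (intro mult_mono) auto
    show "real n * (exp (p * m) * 2 powr (- (3 * (P * m)))) \<le> real n * exp (- c * lg ^ 4)"
      using deg[of "real m"] Pm' by (intro mult_left_mono) auto
    \<comment> \<open>The expected number of edges from a target to the reached set is at most
      \<open>\<delta> / 4 * ln n\<close>. The escape probability thus outweighs the number of
      targets only by half of their exponent.\<close>
    have "p * (real (h + 1) * (if odd d then 1 else 3 * (P * m)) * (3 * (P * n) * (3 * (P * m))) ^ h)
      \<le> P * (real (h + 1) * (3 * \<sigma>) * (3 * (P * n) * (3 * (P * m))) ^ h)"
      using P Pm Pn p \<sigma> by (intro mult_mono) (auto simp: \<sigma>_def)
    also have "\<dots> = 3 * (real h + 1) * 9 ^ h * (P ^ (2 * h + 1) * real m ^ h * real n ^ h * \<sigma>)"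
      unfolding pow by (simp add: algebra_simps)
    also have "\<dots> \<le> 3 * (real h + 1) * 9 ^ h * (2 * c * lg)"
      using size by (intro mult_left_mono) auto
    also have "\<dots> = (8 * (6 * (real h + 1) * 9 ^ h) * c) * (lg / 8)" by simp
    also have "\<dots> \<le> \<delta> * (lg / 8)" using c lg0 by (intro mult_right_mono) auto
    also have "\<dots> \<le> \<delta> * (ln (real n) / 4)"
    proof -
      have "(1::real) / 2 \<le> ln 2" using ln2_ge_two_thirds by simp
      then have "lg \<le> 2 * ln (real n)" using mn mult_left_mono[of "1/2" "ln 2" "ln (real n)"]
        unfolding lg_def log_def by (simp add: field_simps)
      then show ?thesis using \<delta> by (intro mult_left_mono) auto
    qed
    finally have "exp (- (\<delta> / 2) * ln (real n))
      \<le> exp (- 2 * p * (real (h + 1) * (if odd d then 1 else 3 * (P * m)) * (3 * (P * n) * (3 * (P * m))) ^ h))"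
      by simp
    then have "real n powr (- (\<delta> / 2)) \<le> exp (- 2 * p * (real (h + 1) * (if odd d then 1 else 3 * (P * m)) * (3 * (P * n) * (3 * (P * m))) ^ h))"
      (is "_ \<le> ?e") using mn by (simp add: powr_def)
    then have "real n powr \<delta> / 2 * real n powr (- (\<delta> / 2)) \<le> real s * ?e"
      using s by (intro mult_mono) auto
    then show "exp (- (real s * ?e)) \<le> exp (- (real n powr (\<delta> / 2) / 2))"
      by (simp add: powr_add[symmetric])
    show "(real s)\<^sup>2 * (real m * (real h * (3 * (P * n) * (3 * (P * m))) ^ (h - 1))) * p\<^sup>2
      \<le> (2 * real h * 9 ^ h / c) * (lg * real n powr (- 2 * \<delta>))"
    proof (cases h)
      case (Suc j)
      \<comment> \<open>The detour count times \<open>P * n\<close> is again bounded by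
        \<open>size\<close>. Dividing by \<open>P * n\<close>, which is at least
        \<open>c * real n powr (4 * \<delta>)\<close>, beats the factor
        \<open>real n powr (2 * \<delta>)\<close> from pairs of targets.\<close>
      have "real m * (9 ^ j * P ^ (2 * j) * real m ^ j * real n ^ j) * P\<^sup>2 * (P * n)
        = 9 ^ j * (P ^ (2 * h + 1) * real m ^ h * real n ^ h)"
        by (simp add: Suc algebra_simps power2_eq_square)
      also have "\<dots> \<le> 9 ^ h * (2 * c * lg)"
      proof (rule mult_mono)
        have "P ^ (2 * h + 1) * real m ^ h * real n ^ h * 1 \<le> P ^ (2 * h + 1) * real m ^ h * real n ^ h * \<sigma>"
          using \<sigma> P by (intro mult_left_mono) auto
        then show "P ^ (2 * h + 1) * real m ^ h * real n ^ h \<le> 2 * c * lg" using size by simp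
      qed (use Suc P in auto)
      finally have 1: "real m * (9 ^ j * P ^ (2 * j) * real m ^ j * real n ^ j) * P\<^sup>2 * (P * n)
        \<le> 9 ^ h * (2 * c * lg)" (is "?W * _ \<le> _") .
      have W0: "0 \<le> ?W" using P by simp
      have "c * real n powr (4 * \<delta>) \<le> P * n" using ps(4) c unfolding P_def by (simp add: mult.assoc)
      then have "?W * (c * real n powr (4 * \<delta>)) \<le> 9 ^ h * (2 * c * lg)"
        using 1 W0 by (meson mult_left_mono order_trans)
      then have 2: "?W * real n powr (4 * \<delta>) \<le> 9 ^ h * (2 * lg)" using c by (simp add: field_simps)
      have 3: "?W \<le> 9 ^ h * (2 * lg) * real n powr (- (4 * \<delta>))"
        using 2 mn by (simp add: powr_minus field_simps)
      have "(real s)\<^sup>2 * (real m * (real h * (3 * (P * n) * (3 * (P * m))) ^ (h - 1))) * p\<^sup>2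
        = (real s)\<^sup>2 * real h * (real m * (9 ^ j * P ^ (2 * j) * real m ^ j * real n ^ j) * p\<^sup>2)"
        unfolding pow Suc by simp
      also have "\<dots> \<le> (real n powr \<delta>)\<^sup>2 * real h * ?W"
        using s(1) P p by (intro mult_mono power_mono) auto
      also have "\<dots> \<le> (real n powr \<delta>)\<^sup>2 * real h * (9 ^ h * (2 * lg) * real n powr (- (4 * \<delta>)))"
        using 3 by (intro mult_left_mono) auto
      also have "\<dots> = 2 * real h * 9 ^ h * lg * real n powr (- 2 * \<delta>)"
      proof -
        have "(real n powr \<delta>)\<^sup>2 * real n powr (- (4 * \<delta>)) = real n powr (- 2 * \<delta>)"
          by (simp add: power2_eq_square powr_add[symmetric])
        then show ?thesis by (simp add: algebra_simps)
      qed
      also have "\<dots> * 1 \<le> 2 * real h * 9 ^ h * lg * real n powr (- 2 * \<delta>) * (1 / c)"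
        using c lg0 by (intro mult_left_mono) auto
      finally show ?thesis by (simp add: mult.assoc)
    qed simp
  qed
  finally show ?thesis by simp
qed

text \<open>By monotonicity it suffices to treat \<open>P = C * ps\<close>, for which
  \<open>linked_pair_bound\<close> applies to every pair and \<open>rc_gt_prob\<close> collects the
  errors.\<close>

lemma above_threshold_bound:
  fixes m n d k :: nat and p ps K :: real
  defines "lg \<equiv> log 2 (real n)"
  assumes d: "2 \<le> d" and K: "0 \<le> K" "real k \<le> K * lg"
    and p: "64 * d * (d + 1) * (4 * (K + 4)) * ps \<le> p" "p \<le> 1"
    and mn: "1 \<le> m" "m \<le> n" "2 \<le> n"
    and lg: "8 * (K + 4) * lg \<le> lg ^ 4" "4 * real d \<le> lg ^ 4" "1 \<le> lg"
    and ps: "0 < ps" "lg ^ 4 \<le> ps * m" "lg \<le> ps ^ d * real m ^ (d div 2) * real n ^ ((d - 1) div 2)"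
  shows "1 - rb_prob m n p (\<lambda>E. rc m n k E \<le> enat (d + 1))
    \<le> (2 * real n)\<^sup>2 * (real d * (8 * (K + 4) * lg * (real (d + 1) * real n)) * exp (- 2 * lg ^ 4)
        + exp (- 4 * lg))"
proof -
  \<comment> \<open>With this choice \<open>exp (- Z / 4)\<close> equals
    \<open>exp (- (K + 4) * lg)\<close>: the part \<open>K * lg\<close> absorbs
    \<open>2 ^ k\<close>, and \<open>exp (- 4 * lg)\<close> remains to beat the number of pairs. The
    other factors of \<open>C\<close> cancel the thinning and the block sizes, so that the quantity
    \<open>A\<close> of \<open>linked_pair_bound\<close> becomes
    \<open>\<gamma> * (ps * m)\<close>.\<close>
  define \<gamma> where "\<gamma> = 4 * (K + 4)"
  define C where "C = 64 * d * (d + 1) * \<gamma>"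
  define P where "P = C * ps"
  define Z where "Z = \<gamma> * lg"
  have \<gamma>: "1 \<le> \<gamma>" using K by (simp add: \<gamma>_def)
  have C: "1 \<le> C"
  proof -
    have "1 * 1 \<le> real (64 * d * (d + 1)) * \<gamma>"
    proof (intro mult_mono)
      have "1 \<le> 64 * d * (d + 1)" using d by simp
      then show "1 \<le> real (64 * d * (d + 1))" by linarith
    qed (use \<gamma> in auto)
    then show ?thesis by (simp add: C_def)
  qed
  have P: "0 < P" "P \<le> p" "P \<le> 1" using p ps C unfolding P_def C_def \<gamma>_def by auto
  have q: "P / real (d + 1) = 64 * d * \<gamma> * ps" using d by (simp add: P_def C_def field_simps)
  have A: "P / real (d + 1) * real w / (64 * real d) = \<gamma> * (ps * w)" for w
    unfolding q using d by simp
  have "ps \<le> C * ps" using C ps by simp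
  then have ps1: "ps \<le> 1" using P unfolding P_def by linarith
  have "ps * m \<le> 1 * real m" using ps1 by (intro mult_right_mono) auto
  then have "real (4 * d) \<le> real m" using lg(2) ps(2) by simp
  then have m4: "4 * d \<le> m" by (simp only: of_nat_le_iff)
  have grow: "ps * w \<le> \<gamma> * (ps * w)" if "0 \<le> w" for w
    using that ps \<gamma> mult_right_mono[of 1 \<gamma> "ps * w"] by simp
  have Am: "lg ^ 4 \<le> \<gamma> * (ps * m)"
    using ps(2) grow[of "real m"] by linarith
  have "1 - rb_prob m n p (\<lambda>E. rc m n k E \<le> enat (d + 1))
    \<le> 1 - rb_prob m n P (\<lambda>E. rc m n k E \<le> enat (d + 1))"
    using rb_prob_mono[of P p "d + 1" m n k] P p by simp
  also have "\<dots> \<le> (real (m + n))\<^sup>2 * (real d * (2 * Z / (P / real (d + 1))) * exp (- 2 * (\<gamma> * (ps * m)))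
      + 2 ^ k * exp (- Z / 4))"
  proof (rule rc_gt_prob)
    fix x y assume xy: "x \<in> bip_verts m n" "y \<in> bip_verts m n" "x \<noteq> y"
    show "avg_col ({..<m} \<times> {..<n}) (d + 1)
        (\<lambda>c. bern ({..<m} \<times> {..<n}) P (\<lambda>E. of_bool (\<not> linked E c k x y)))
      \<le> real d * (2 * Z / (P / real (d + 1))) * exp (- 2 * (\<gamma> * (ps * m))) + 2 ^ k * exp (- Z / 4)"
      unfolding A[symmetric]
    proof (rule linked_pair_bound[OF xy d P(1,3) mn(2) m4])
      show "1 \<le> Z" using \<gamma> lg mult_mono[of 1 \<gamma> 1 lg] unfolding Z_def by simp
      show "2 * Z \<le> P / real (d + 1) * real m / (64 * real d)"
      proof -
        have "2 * Z = 8 * (K + 4) * lg" unfolding Z_def \<gamma>_def by simp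
        then show ?thesis unfolding A using Am lg(1) by linarith
      qed
      show "Z / (P / real (d + 1)) \<le> (P / real (d + 1) * real m / (64 * real d)) ^ (d div 2)
          * (P / real (d + 1) * real n / (64 * real d)) ^ ((d - 1) div 2)"
      proof -
        \<comment> \<open>The factor \<open>\<gamma>\<close> cancels, and \<open>lg / ps\<close> is
          controlled by the hypothesis on \<open>ps ^ d\<close> after division by one factor
          \<open>ps\<close>.\<close>
        have "Z / (P / real (d + 1)) \<le> lg / ps"
        proof -
          have "Z / (P / real (d + 1)) = lg / (64 * real d * ps)" unfolding q Z_def using \<gamma> by simp
          also have "\<dots> \<le> lg / ps" using d ps lg by (intro divide_left_mono) auto
          finally show ?thesis .
        qed
        also have "\<dots> \<le> ps ^ (d - 1) * real m ^ (d div 2) * real n ^ ((d - 1) div 2)"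
        proof -
          have pd: "ps ^ d = ps * ps ^ (d - 1)" using d by (cases d) auto
          have "lg \<le> ps ^ (d - 1) * real m ^ (d div 2) * real n ^ ((d - 1) div 2) * ps"
            using ps(3) unfolding pd by (simp only: mult_ac)
          then show ?thesis using ps(1) by (simp only: divide_le_eq if_True)
        qed
        also have "\<dots> = (ps * m) ^ (d div 2) * (ps * n) ^ ((d - 1) div 2)"
        proof -
          have "ps ^ (d - 1) = ps ^ (d div 2) * ps ^ ((d - 1) div 2)"
            by (simp only: power_add[symmetric] div2_add_pred_div2)
          then show ?thesis by (simp only: power_mult_distrib mult_ac)
        qed
        also have "\<dots> \<le> (\<gamma> * (ps * m)) ^ (d div 2) * (\<gamma> * (ps * n)) ^ ((d - 1) div 2)"
          using \<gamma> ps by (intro mult_mono power_mono grow) auto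
        finally show ?thesis unfolding A .
      qed
    qed
  qed (use P \<gamma> lg in \<open>auto simp: Z_def\<close>)
  also have "\<dots> \<le> (2 * real n)\<^sup>2 * (real d * (8 * (K + 4) * lg * (real (d + 1) * real n)) * exp (- 2 * lg ^ 4)
        + exp (- 4 * lg))"
  proof (intro mult_mono add_mono power_mono)
    show "2 ^ k * exp (- Z / 4) \<le> exp (- 4 * lg)"
    proof -
      have "(2::real) ^ k \<le> exp 1 ^ k" using exp_ge_add_one_self[of 1] by (intro power_mono) auto
      also have "\<dots> \<le> exp (K * lg)" using K by (simp add: exp_of_nat_mult[symmetric])
      finally have "2 ^ k * exp (- Z / 4) \<le> exp (K * lg) * exp (- Z / 4)" by (intro mult_right_mono) auto
      also have "\<dots> = exp (- 4 * lg)"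
      proof -
        have "K * lg + - Z / 4 = - 4 * lg" unfolding Z_def \<gamma>_def by (simp add: field_simps)
        then show ?thesis by (simp only: exp_add[symmetric])
      qed
      finally show ?thesis .
    qed
    have "1 \<le> lg ^ 4" using lg by simp
    have "ps * m \<le> ps * n" using ps mn by (intro mult_left_mono) auto
    then have "1 \<le> ps * n" using ps(2) \<open>1 \<le> lg ^ 4\<close> by linarith
    also have "\<dots> \<le> P * n" using \<open>ps \<le> C * ps\<close> unfolding P_def by (intro mult_right_mono) auto
    finally have "1 / P \<le> real n" using P by (simp add: field_simps)
    then have "2 * Z * real (d + 1) * (1 / P) \<le> 2 * Z * real (d + 1) * real n"
      using \<gamma> lg by (intro mult_left_mono) (auto simp: Z_def)
    then show "2 * Z / (P / real (d + 1)) \<le> 8 * (K + 4) * lg * (real (d + 1) * real n)"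
    proof -
      have "2 * Z / (P / real (d + 1)) = 2 * Z * real (d + 1) * (1 / P)" by simp
      also note \<open>2 * Z * real (d + 1) * (1 / P) \<le> 2 * Z * real (d + 1) * real n\<close>
      also have "2 * Z * real (d + 1) * real n = 8 * (K + 4) * lg * (real (d + 1) * real n)"
        by (simp add: Z_def \<gamma>_def algebra_simps)
      finally show ?thesis .
    qed
    show "exp (- 2 * (\<gamma> * (ps * m))) \<le> exp (- 2 * lg ^ 4)" using Am by simp
  qed (use mn \<gamma> lg P K in \<open>auto simp: Z_def\<close>)
  finally show ?thesis .
qed

section \<open>Limits of the error terms\<close>

lemma below_bound_tendsto:
  fixes c \<delta> K :: real
  assumes "0 < c" "0 < \<delta>"
  shows "(\<lambda>n::nat. 2 * real n * exp (- c * log 2 (real n) ^ 4) + exp (- (real n powr (\<delta> / 2) / 2))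
      + K * (log 2 (real n) * real n powr (- 2 * \<delta>))) \<longlonglongrightarrow> 0"
  using assms unfolding log_def by real_asymp

lemma above_bound_tendsto:
  fixes K d :: real
  assumes "0 \<le> K" "0 < d"
  shows "(\<lambda>n::nat. (2 * real n)\<^sup>2 * (d * (8 * (K + 4) * log 2 (real n) * ((d + 1) * real n)) * exp (- 2 * log 2 (real n) ^ 4)
        + exp (- 4 * log 2 (real n)))) \<longlonglongrightarrow> 0"
proof -
  \<comment> \<open>Of the change of base only \<open>a > 1\<close> matters:
    \<open>exp (- 4 * (a * ln n))\<close> beats the square of \<open>n\<close>, and the fourth power
    of the logarithm in an exponent beats every power of \<open>n\<close>.\<close>
  define a where "a = 1 / ln (2::real)"
  have "1 < a" using ln_2_less_1 by (simp add: a_def)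
  have "(\<lambda>n::nat. (2 * real n)\<^sup>2 * (d * (8 * (K + 4) * (a * ln (real n)) * ((d + 1) * real n)) * exp (- 2 * (a * ln (real n)) ^ 4)
        + exp (- 4 * (a * ln (real n))))) \<longlonglongrightarrow> 0"
    using assms \<open>1 < a\<close> by real_asymp
  then show ?thesis by (simp add: log_def a_def)
qed

lemma eventually_log_power:
  fixes C :: real
  assumes "0 < C"
  shows "\<forall>\<^sub>F n::nat in sequentially. C * log 2 (real n) \<le> log 2 (real n) ^ 4"
    and "\<forall>\<^sub>F n::nat in sequentially. C \<le> log 2 (real n) ^ 4"
    and "\<forall>\<^sub>F n::nat in sequentially. 1 \<le> log 2 (real n)"
    and "\<forall>\<^sub>F n::nat in sequentially. C \<le> log 2 (real n) ^ 3"
  using assms unfolding log_def by real_asymp+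

lemma rb_prob_bounds:
  assumes "0 \<le> p" "p \<le> 1"
  shows "0 \<le> rb_prob m n p Q" "rb_prob m n p Q \<le> 1"
  unfolding rb_prob_eq_bern using assms by (auto intro!: bern_nonneg bern_le_const)

text \<open>Since \<open>ps * m\<close> and \<open>ps * n\<close> are at least \<open>1\<close>, the
  quantity bounded by \<open>2 * lg\<close> is at least \<open>ps * (ps * m)\<close>, hence at least
  \<open>ps * lg ^ 4\<close>. Thus \<open>ps\<close> is at most \<open>2 / lg ^ 3\<close>. This
  yields the bound \<open>1/2\<close> needed below the threshold.\<close>

lemma small_threshold:
  fixes ps lg :: real and d m n :: nat
  assumes "2 \<le> d" "0 < ps" "1 \<le> lg" "4 \<le> lg ^ 3" "lg ^ 4 \<le> ps * m" "m \<le> n"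
    and "ps ^ d * real m ^ (d div 2) * real n ^ ((d - 1) div 2) \<le> 2 * lg"
  shows "ps \<le> 1/2"
proof -
  have lg4: "1 \<le> lg ^ 4" using assms by simp
  then have pm: "1 \<le> ps * m" using assms by linarith
  have "ps * m \<le> ps * n" using assms by (intro mult_left_mono) auto
  then have pn: "1 \<le> ps * n" using pm by linarith
  have "ps * m * 1 \<le> (ps * m) ^ (d div 2) * (ps * n) ^ ((d - 1) div 2)"
  proof (rule mult_mono)
    show "ps * m \<le> (ps * m) ^ (d div 2)"
      using power_increasing[of 1 "d div 2" "ps * m"] pm assms(1) by simp
    show "1 \<le> (ps * n) ^ ((d - 1) div 2)" using pn by (rule one_le_power)
  qed (use pm in auto)
  then have "ps * lg ^ 4 \<le> ps * ((ps * m) ^ (d div 2) * (ps * n) ^ ((d - 1) div 2))"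
    using assms by (intro mult_left_mono) auto
  also have "\<dots> = ps ^ d * real m ^ (d div 2) * real n ^ ((d - 1) div 2)"
  proof -
    have "ps ^ d = ps * ps ^ (d - 1)" using assms(1) by (cases d) auto
    also have "\<dots> = ps * (ps ^ (d div 2) * ps ^ ((d - 1) div 2))"
      by (simp only: power_add[symmetric] div2_add_pred_div2)
    finally show ?thesis by (simp only: power_mult_distrib mult_ac)
  qed
  finally have "ps * lg ^ 4 \<le> 2 * lg" using assms by linarith
  moreover have "ps * lg ^ 4 = (ps * lg ^ 3) * lg" by (simp add: eval_nat_numeral)
  ultimately have "(ps * lg ^ 3) * lg \<le> 2 * lg" by simp
  then have "ps * lg ^ 3 \<le> 2" using assms by simp
  moreover have "ps * 4 \<le> ps * lg ^ 3" using assms by (intro mult_left_mono) auto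
  ultimately show ?thesis by simp
qed

text \<open>What both parities have in common. The factor \<open>2\<close> leaves room for the
  logarithm of \<open>m * n\<close> in the odd case; \<open>\<delta>\<close> governs the number of
  targets below the threshold.\<close>

definition threshold_regime :: "nat \<Rightarrow> real \<Rightarrow> real \<Rightarrow> nat \<Rightarrow> nat \<Rightarrow> bool" where
  "threshold_regime d \<delta> p m n \<longleftrightarrow> 0 < p \<and> 1 \<le> m \<and> m \<le> n \<and>
     log 2 (real n) ^ 4 \<le> p * real m \<and> real n powr (4 * \<delta>) \<le> p * real n \<and>
     log 2 (real n) \<le> p ^ d * real m ^ (d div 2) * real n ^ ((d - 1) div 2) \<and>
     p ^ d * real m ^ (d div 2) * real n ^ ((d - 1) div 2) \<le> 2 * log 2 (real n)"

lemma sharp_threshold_rc: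
  fixes d :: nat and k m :: "nat \<Rightarrow> nat" and ps :: "nat \<Rightarrow> real" and \<delta> :: real
  assumes d: "2 \<le> d" and kpos: "\<forall>n. k n \<ge> 1"
    and klog: "\<exists>K. \<forall>\<^sub>F n in sequentially. real (k n) \<le> K * log 2 (real n)"
    and \<delta>: "0 < \<delta>" "\<delta> \<le> 1/8"
    and regime: "\<forall>\<^sub>F n in sequentially. threshold_regime d \<delta> (ps n) (m n) n"
  shows "sharp_threshold m (\<lambda>n E. rc (m n) n (k n) E \<le> enat (d + 1)) ps"
proof -
  let ?Q = "\<lambda>n E. rc (m n) n (k n) E \<le> enat (d + 1)"
  define h where "h = (d - 1) div 2"
  obtain K0 where K0: "\<forall>\<^sub>F n in sequentially. real (k n) \<le> K0 * log 2 (real n)" using klog by blast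
  define K where "K = max K0 0"
  have K: "0 \<le> K" "K0 \<le> K" by (auto simp: K_def)
  define C where "C = 64 * real d * (real d + 1) * (4 * (K + 4))"
  define D where "D = 8 * (6 * (real h + 1) * 9 ^ h)"
  have D: "0 < D" by (simp add: D_def)
  \<comment> \<open>Ensures \<open>D * c \<le> \<delta>\<close>, the smallness required by
    \<open>below_threshold_bound\<close>.\<close>
  define c where "c = min 1 (\<delta> / D)"
  have c: "0 < c" "c \<le> 1" using \<delta> D by (auto simp: c_def)
  have "D * c \<le> D * (\<delta> / D)" using D by (intro mult_left_mono) (auto simp: c_def)
  then have Dc: "D * c \<le> \<delta>" using D by simp
  have C: "0 < C" using d K by (auto simp: C_def)
  note lgs = eventually_log_power
  note regime = regime[unfolded threshold_regime_def]
  have ev2: "\<forall>\<^sub>F n in sequentially. (2::nat) \<le> n" by (rule eventually_ge_at_top)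
  have lower: "(\<lambda>n. rb_prob (m n) n (p n) (?Q n)) \<longlonglongrightarrow> 0"
    if p: "\<forall>n. 0 \<le> p n \<and> p n \<le> 1" "\<forall>\<^sub>F n in sequentially. p n \<le> c * ps n" for p
  proof (rule tendsto_sandwich[OF _ _ tendsto_const])
    let ?f = "\<lambda>n::nat. 2 * real n * exp (- c * log 2 (real n) ^ 4) + exp (- (real n powr (\<delta> / 2) / 2))
      + (2 * real h * 9 ^ h / c) * (log 2 (real n) * real n powr (- 2 * \<delta>))"
    show "?f \<longlonglongrightarrow> 0" using c \<delta> by (intro below_bound_tendsto) auto
    show "\<forall>\<^sub>F n in sequentially. 0 \<le> rb_prob (m n) n (p n) (?Q n)"
      using p by (intro always_eventually allI rb_prob_bounds) auto
    have "0 < 1 / c" using c by simp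
    show "\<forall>\<^sub>F n in sequentially. rb_prob (m n) n (p n) (?Q n) \<le> ?f n"
      using regime p(2) ev2 lgs(2)[OF \<open>0 < 1 / c\<close>] lgs(3)[OF zero_less_one] lgs(4)[of 4, simplified]
    proof eventually_elim
      case (elim n)
      have "ps n \<le> 1/2"
        by (rule small_threshold[OF d _ _ elim(6), of "ps n" "m n" n]) (use elim in auto)
      then have "c * ps n \<le> 1 * (1/2)" using c elim by (intro mult_mono) auto
      then show ?case unfolding h_def
        using elim c p Dc \<delta> d kpos unfolding D_def h_def
        by (intro below_threshold_bound[where ps="ps n"]) (auto simp: field_simps)
    qed
  qed
  have upper: "(\<lambda>n. rb_prob (m n) n (p n) (?Q n)) \<longlonglongrightarrow> 1"
    if p: "\<forall>n. 0 \<le> p n \<and> p n \<le> 1" "\<forall>\<^sub>F n in sequentially. C * ps n \<le> p n" for p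
  proof (rule tendsto_sandwich[OF _ _ _ tendsto_const])
    let ?f = "\<lambda>n::nat. (2 * real n)\<^sup>2 * (real d * (8 * (K + 4) * log 2 (real n) * ((real d + 1) * real n))
      * exp (- 2 * log 2 (real n) ^ 4) + exp (- 4 * log 2 (real n)))"
    have "?f \<longlonglongrightarrow> 0" using K d by (intro above_bound_tendsto) auto
    from tendsto_diff[OF tendsto_const[of 1] this] show "(\<lambda>n. 1 - ?f n) \<longlonglongrightarrow> 1" by simp
    show "\<forall>\<^sub>F n in sequentially. rb_prob (m n) n (p n) (?Q n) \<le> 1"
      using p by (intro always_eventually allI rb_prob_bounds) auto
    have pos: "0 < 8 * (K + 4)" "0 < 4 * real d" using K d by auto
    show "\<forall>\<^sub>F n in sequentially. 1 - ?f n \<le> rb_prob (m n) n (p n) (?Q n)"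
      using regime p(2) ev2 lgs(1)[OF pos(1)] lgs(2)[OF pos(2)] lgs(3)[OF zero_less_one] K0
    proof eventually_elim
      case (elim n)
      have kK: "real (k n) \<le> K * log 2 (real n)"
        using elim(6,7) K(2) mult_right_mono[of K0 K "log 2 (real n)"] by linarith
      have "1 - rb_prob (m n) n (p n) (?Q n) \<le> (2 * real n)\<^sup>2 * (real d * (8 * (K + 4) * log 2 (real n)
          * (real (d + 1) * real n)) * exp (- 2 * log 2 (real n) ^ 4) + exp (- 4 * log 2 (real n)))"
        using elim d K(1) kK p
        by (intro above_threshold_bound[where ps="ps n"]) (auto simp: C_def algebra_simps)
      then show ?case by (simp add: add.commute)
    qed
  qed
  show ?thesis unfolding sharp_threshold_def using lower upper c C by blast
qed

section \<open>The two thresholds and their common regime\<close>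

definition odd_threshold :: "nat \<Rightarrow> nat \<Rightarrow> nat \<Rightarrow> real" where
  "odd_threshold d m n = (log 2 (real m * real n)) powr (1 / real d) /
    (real m powr ((real d - 1) / (2 * real d)) * real n powr ((real d - 1) / (2 * real d)))"

definition even_threshold :: "nat \<Rightarrow> nat \<Rightarrow> nat \<Rightarrow> real" where
  "even_threshold d m n = (log 2 (real n)) powr (1 / real d) /
    (real m powr (1 / 2) * real n powr ((real d - 2) / (2 * real d)))"

lemma powr_frac_power: "0 < x \<Longrightarrow> 0 < d \<Longrightarrow> (x powr (real j / real d)) ^ d = x ^ j"
  for x :: real by (simp add: powr_power powr_realpow)

text \<open>With \<open>d = 2 * j + 1\<close> the product in the regime is exactly the logarithm of
  \<open>m * n\<close>, which lies between \<open>lg\<close> and \<open>2 * lg\<close>. From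
  \<open>m \<le> n\<close> the denominator of \<open>p\<close> is at most
  \<open>real n powr (1 - 1 / real d)\<close>, so \<open>p * n\<close> is at least
  \<open>real n powr (1 / real d)\<close>; this determines \<open>\<delta>\<close>.\<close>

lemma odd_threshold_regime:
  fixes d m n :: nat
  defines "p \<equiv> odd_threshold d m n" and "lg \<equiv> log 2 (real n)"
  assumes d: "odd d" "2 \<le> d" and n: "2 \<le> n" and *: "p * real m \<le> p * real n" "lg ^ 4 \<le> p * real m"
  shows "threshold_regime d (1 / (4 * real d)) p m n"
proof -
  have lg: "1 \<le> lg" using n unfolding lg_def by (simp add: le_log_iff)
  then have "0 < lg ^ 4" by simp
  then have pm: "0 < p * real m" using * by linarith
  have "0 \<le> p" unfolding p_def odd_threshold_def by simp
  then have p: "0 < p" "1 \<le> m" using pm by (auto simp: zero_less_mult_iff)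
  then have mn: "m \<le> n" using *(1) by simp
  obtain j where j: "d = 2 * j + 1" using d by (auto elim: oddE)
  have e: "(real d - 1) / (2 * real d) = real j / real d" unfolding j by (simp add: field_simps)
  define A where "A = log 2 (real m * real n)"
  have A: "lg \<le> A" "A \<le> 2 * lg"
  proof -
    have "A = log 2 (real m) + lg" unfolding A_def lg_def using p n by (simp add: log_mult)
    moreover have "0 \<le> log 2 (real m)" "log 2 (real m) \<le> lg" using p mn unfolding lg_def by auto
    ultimately show "lg \<le> A" "A \<le> 2 * lg" by linarith+
  qed
  have pd: "p ^ d = A / (real m ^ j * real n ^ j)"
    unfolding p_def odd_threshold_def e A_def[symmetric] using powr_frac_power[of A d 1] powr_frac_power[of "real m" d j]
      powr_frac_power[of "real n" d j] A lg p n d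
    by (simp add: power_divide power_mult_distrib)
  have X: "p ^ d * real m ^ (d div 2) * real n ^ ((d - 1) div 2) = A"
    unfolding pd using j p n by simp
  have "real n powr (1 / real d) \<le> p * real n"
  proof -
    have "1 \<le> A powr (1 / real d)" using A lg by (intro ge_one_powr_ge_zero) auto
    moreover have "real m powr (real j / real d) * real n powr (real j / real d)
      \<le> real n powr (real j / real d) * real n powr (real j / real d)"
      using mn by (intro mult_right_mono powr_mono2) auto
    moreover have "\<dots> = real n powr (1 - 1 / real d)"
    proof -
      have "real j / real d + real j / real d = (real d - 1) / real d"
        unfolding add_divide_distrib[symmetric] by (simp add: j)
      also have "\<dots> = 1 - 1 / real d" using d by (simp add: diff_divide_distrib)
      finally show ?thesis by (simp only: powr_add[symmetric])
    qed
    ultimately have "1 / real n powr (1 - 1 / real d) \<le> p"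
      unfolding p_def odd_threshold_def e A_def[symmetric] using p n by (intro frac_le) auto
    then have "1 / real n powr (1 - 1 / real d) * real n \<le> p * real n" by (intro mult_right_mono) auto
    moreover have "1 / real n powr (1 - 1 / real d) * real n = real n powr (1 / real d)"
      using n by (simp add: powr_diff)
    ultimately show ?thesis by simp
  qed
  then show ?thesis using p mn * X A unfolding threshold_regime_def lg_def by simp
qed

text \<open>With \<open>d = 2 * (j + 1)\<close> the product in the regime is exactly
  \<open>lg\<close>. The role of \<open>\<epsilon>\<close> is to give \<open>p * n\<close>
  polynomial size: it equals \<open>real n powr \<epsilon>\<close> times
  \<open>p * real n powr (1 - \<epsilon>)\<close>, and the latter is at least
  \<open>lg ^ 4 \<ge> 1\<close>.\<close>

lemma even_threshold_regime:
  fixes d m n :: nat and \<epsilon> :: real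
  defines "p \<equiv> even_threshold d m n" and "lg \<equiv> log 2 (real n)"
  assumes d: "even d" "2 \<le> d" and n: "2 \<le> n" and \<epsilon>: "0 < \<epsilon>" "\<epsilon> < 1"
    and *: "p * real m powr (1 - \<epsilon>) \<le> p * real n powr (1 - \<epsilon>)" "lg ^ 4 \<le> p * real m powr (1 - \<epsilon>)"
  shows "threshold_regime d (min (\<epsilon> / 4) (1 / 8)) p m n"
proof -
  have lg: "1 \<le> lg" using n unfolding lg_def by (simp add: le_log_iff)
  then have lg4: "1 \<le> lg ^ 4" by simp
  then have pm: "0 < p * real m powr (1 - \<epsilon>)" using * by linarith
  have "0 \<le> p" unfolding p_def even_threshold_def by simp
  then have p: "0 < p" "1 \<le> m" using pm by (auto simp: zero_less_mult_iff)
  have mn: "m \<le> n"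
  proof (rule ccontr)
    assume "\<not> m \<le> n"
    then have "real n powr (1 - \<epsilon>) < real m powr (1 - \<epsilon>)" using \<epsilon> by (intro powr_less_mono2) auto
    then show False using *(1) p by simp
  qed
  have "real m powr (1 - \<epsilon>) \<le> real m powr 1" using p \<epsilon> by (intro powr_mono) auto
  then have "p * real m powr (1 - \<epsilon>) \<le> p * real m" using p by (intro mult_left_mono) auto
  then have pm4: "lg ^ 4 \<le> p * real m" using * by linarith
  obtain i where i: "d = 2 * i" using d by (auto elim: evenE)
  then obtain j where j: "d = 2 * (j + 1)" using d by (cases i) auto
  have e: "(real d - 2) / (2 * real d) = real j / real d" "1 / 2 = real (j + 1) / real d"
    unfolding j by (simp_all add: field_simps)
  have pd: "p ^ d = lg / (real m ^ (j + 1) * real n ^ j)"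
    unfolding p_def even_threshold_def e lg_def[symmetric] using powr_frac_power[of lg d 1] powr_frac_power[of "real m" d "j + 1"]
      powr_frac_power[of "real n" d j] lg p n d
    by (simp add: power_divide power_mult_distrib)
  have X: "p ^ d * real m ^ (d div 2) * real n ^ ((d - 1) div 2) = lg"
    unfolding pd using j p n by simp
  have "real n powr (4 * min (\<epsilon> / 4) (1 / 8)) \<le> real n powr \<epsilon> * 1" using n by (simp add: powr_mono)
  also have "\<dots> \<le> real n powr \<epsilon> * (p * real n powr (1 - \<epsilon>))"
    using * lg4 by (intro mult_left_mono) auto
  also have "\<dots> = p * real n"
    using n by (simp add: powr_diff)
  finally show ?thesis using p mn pm4 X lg unfolding threshold_regime_def lg_def by simp
qed

theorem theorem1:
  fixes d :: nat and k m :: "nat \<Rightarrow> nat"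
  assumes d: "d \<ge> 2"
    and kpos: "\<forall>n. k n \<ge> 1"
    and klog: "\<exists>K. \<forall>\<^sub>F n in sequentially. real (k n) \<le> K * log 2 (real n)"
  shows
    "(odd d \<longrightarrow>
       (let p1 = (\<lambda>n. (log 2 (real (m n) * real n)) powr (1 / real d) /
                      (real (m n) powr ((real d - 1) / (2 * real d)) *
                       real n powr ((real d - 1) / (2 * real d))))
        in (\<forall>\<^sub>F n in sequentially.
               p1 n * real n \<ge> p1 n * real (m n) \<and>
               p1 n * real (m n) \<ge> (log 2 (real n)) ^ 4) \<longrightarrow>
           sharp_threshold m (\<lambda>n E. rc (m n) n (k n) E \<le> enat (d + 1)) p1)) \<and>
     (even d \<longrightarrow>
       (let p2 = (\<lambda>n. (log 2 (real n)) powr (1 / real d) /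
                      (real (m n) powr (1 / 2) *
                       real n powr ((real d - 2) / (2 * real d))))
        in (\<exists>\<epsilon>::real. 0 < \<epsilon> \<and> \<epsilon> < 1 \<and>
              (\<forall>\<^sub>F n in sequentially.
                 p2 n * real n powr (1 - \<epsilon>) \<ge> p2 n * real (m n) powr (1 - \<epsilon>) \<and>
                 p2 n * real (m n) powr (1 - \<epsilon>) \<ge> (log 2 (real n)) ^ 4)) \<longrightarrow>
           sharp_threshold m (\<lambda>n E. rc (m n) n (k n) E \<le> enat (d + 1)) p2))"
  unfolding Let_def odd_threshold_def[symmetric] even_threshold_def[symmetric]
proof (intro conjI impI)
  have ev2: "\<forall>\<^sub>F n in sequentially. (2::nat) \<le> n" by (rule eventually_ge_at_top)
  show "sharp_threshold m (\<lambda>n E. rc (m n) n (k n) E \<le> enat (d + 1)) (\<lambda>n. odd_threshold d (m n) n)"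
    if "odd d" and ev: "\<forall>\<^sub>F n in sequentially.
      odd_threshold d (m n) n * real (m n) \<le> odd_threshold d (m n) n * real n \<and>
      log 2 (real n) ^ 4 \<le> odd_threshold d (m n) n * real (m n)"
  proof (rule sharp_threshold_rc[OF d kpos klog, of "1 / (4 * real d)"])
    show "0 < 1 / (4 * real d)" "1 / (4 * real d) \<le> 1 / 8" using d by (auto simp: field_simps)
    from ev ev2
    show "\<forall>\<^sub>F n in sequentially. threshold_regime d (1 / (4 * real d)) (odd_threshold d (m n) n) (m n) n"
      by eventually_elim (rule odd_threshold_regime, use \<open>odd d\<close> d in auto)
  qed
  show "sharp_threshold m (\<lambda>n E. rc (m n) n (k n) E \<le> enat (d + 1)) (\<lambda>n. even_threshold d (m n) n)"
    if "even d" and ex: "\<exists>\<epsilon>::real. 0 < \<epsilon> \<and> \<epsilon> < 1 \<and> (\<forall>\<^sub>F n in sequentially.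
      even_threshold d (m n) n * real (m n) powr (1 - \<epsilon>) \<le> even_threshold d (m n) n * real n powr (1 - \<epsilon>) \<and>
      log 2 (real n) ^ 4 \<le> even_threshold d (m n) n * real (m n) powr (1 - \<epsilon>))"
  proof -
    from ex obtain \<epsilon> :: real where \<epsilon>: "0 < \<epsilon>" "\<epsilon> < 1" and ev: "\<forall>\<^sub>F n in sequentially.
      even_threshold d (m n) n * real (m n) powr (1 - \<epsilon>) \<le> even_threshold d (m n) n * real n powr (1 - \<epsilon>) \<and>
      log 2 (real n) ^ 4 \<le> even_threshold d (m n) n * real (m n) powr (1 - \<epsilon>)" by blast
    show ?thesis
    proof (rule sharp_threshold_rc[OF d kpos klog, of "min (\<epsilon> / 4) (1 / 8)"])
      show "0 < min (\<epsilon> / 4) (1 / 8)" "min (\<epsilon> / 4) (1 / 8) \<le> 1 / 8" using \<epsilon> by auto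
      from ev ev2
      show "\<forall>\<^sub>F n in sequentially.
        threshold_regime d (min (\<epsilon> / 4) (1 / 8)) (even_threshold d (m n) n) (m n) n"
        by eventually_elim (rule even_threshold_regime, use \<open>even d\<close> d \<epsilon> in auto)
    qed
  qed
qed

end
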